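(* Let $K,N,M_a\ge 1$ be integers, let $W,\sigma^2,\eta>0$ and $P_{\rm c}:=M_aP_{\rm dyn}+P_{\rm sta}>0$, and let $\mathbf H_1,\dots,\mathbf H_K\in\mathbb C^{N\times M_a}$ be nonzero matrices. For Hermitian positive semidefinite $\mathbf Q_1,\dots,\mathbf Q_K\in\mathbb C^{N\times N}$ put $$g(\mathbf Q_1,\dots,\mathbf Q_K)=\frac{W\log_2\left|\mathbf I+\frac1{\sigma^2}\sum_{i=1}^K\mathbf H_i^H\mathbf Q_i\mathbf H_i\right|}{\frac1\eta\sum_{i=1}^K\mathrm{Tr}(\mathbf Q_i)+P_{\rm c}} .$$ Start from any positive semidefinite $\mathbf Q_1^{(0)},\dots,\mathbf Q_K^{(0)}$ (for instance all zero), and for $k=0,1,2,\dots$ and, successively, $i=1,\dots,K$, let $$\mathbf Q_i^{(k+1)}=\arg\max_{\mathbf Q_i\succeq 0}\ g\big(\mathbf Q_1^{(k+1)},\dots,\mathbf Q_{i-1}^{(k+1)},\mathbf Q_i,\mathbf Q_{i+1}^{(k)},\dots,\mathbf Q_K^{(k)}\big).$$ Then: (i) the value of $g$ is non-decreasing at each step and converges to a limit; (ii) the covariances $\big(\mathbf Q_1^{(k)},\dots,\mathbf Q_K^{(k)}\big)$ also converge to a limit $(\mathbf Q_1^*,\dots,\mathbf Q_K^* )$ as $k\to\infty$; and (iii) the iteration converges to the global optimum of the unconstrained energy efficiency problem, that is, $$(\mathbf Q_1^*,\dots,\mathbf Q_K^* )\in\arg\max_{\mathbf Q_1\succeq0,\dots,\mathbf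 Q_K\succeq 0} g(\mathbf Q_1,\dots,\mathbf Q_K),\qquad \lim_{k\to\infty} g\big(\mathbf Q_1^{(k)},\dots,\mathbf Q_K^{(k)}\big)=\max_{\mathbf Q_1\succeq0,\dots,\mathbf Q_K\succeq 0} g(\mathbf Q_1,\dots,\mathbf Q_K).$$
   Context: $|\cdot|$ denotes the determinant, $^H$ the conjugate transpose, $\mathbf Q\succeq0$ means Hermitian positive semidefinite. $g$ is the energy efficiency (sum-rate over total power) of the dual MIMO multiple-access channel with $K$ users having $N$ antennas each and a base station with $M_a$ active antennas; $\mathbf H_i$ is the channel matrix of user $i$, $\mathbf Q_i$ its transmit covariance, $W$ the bandwidth, $\sigma^2$ the noise power, $\eta$ the power amplifier efficiency, and $M_aP_{\rm dyn}+P_{\rm sta}$ the transmit-independent power. The iteration is called energy efficient iterative water-filling; each block maximization has a unique maximizer, so the iteration is well defined. *)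

theory Defs
  imports "HOL-Analysis.Analysis"
begin

definition conj_transpose :: "complex^'m^'n \<Rightarrow> complex^'n^'m" where
  "conj_transpose A = (\<chi> i j. cnj (A $ j $ i))"

definition psd :: "complex^'n^'n \<Rightarrow> bool" where
  "psd Q \<longleftrightarrow> conj_transpose Q = Q \<and>
     (\<forall>x :: complex^'n. 0 \<le> Re (\<Sum>i\<in>UNIV. cnj (x $ i) * (Q *v x) $ i))"

text \<open>
  Users are numbered \<open>0, \<dots>, K - 1\<close>; values of \<open>H\<close> and \<open>Q\<close> at indices \<open>\<ge> K\<close> are irrelevant.
  The types \<open>'n\<close> and \<open>'m\<close> index the antennas of a user and of the base station.
  For positive semidefinite arguments the determinant and the traces are real, so
  \<open>Re\<close> only changes the type.
\<close>

definition energy_efficiency ::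
  "real \<Rightarrow> real \<Rightarrow> real \<Rightarrow> real \<Rightarrow> nat \<Rightarrow> (nat \<Rightarrow> complex^'m^'n) \<Rightarrow> (nat \<Rightarrow> complex^'n^'n) \<Rightarrow> real"
where
  "energy_efficiency W noise \<eta> Pc K H Q =
     W * log 2 (Re (det (mat 1 + (1 / noise) *\<^sub>R (\<Sum>i<K. conj_transpose (H i) ** Q i ** H i))))
     / (1 / \<eta> * (\<Sum>i<K. Re (trace (Q i))) + Pc)"

definition feasible :: "nat \<Rightarrow> (nat \<Rightarrow> complex^'n^'n) \<Rightarrow> bool" where
  "feasible K Q \<longleftrightarrow> (\<forall>i<K. psd (Q i))"

text \<open>
  The covariances during sweep \<open>k\<close> once the users \<open>j < i\<close> have been updated, where
  \<open>Q k\<close> are the covariances before sweep \<open>k\<close>.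
\<close>

definition mid_sweep :: "(nat \<Rightarrow> nat \<Rightarrow> 'a) \<Rightarrow> nat \<Rightarrow> nat \<Rightarrow> nat \<Rightarrow> 'a" where
  "mid_sweep Q k i = (\<lambda>j. if j < i then Q (Suc k) j else Q k j)"

text \<open>
  \<open>arg_max\<close> picks some maximizer, if there is one; here every block maximization has
  exactly one.
\<close>

definition iterative_water_filling ::
  "((nat \<Rightarrow> complex^'n^'n) \<Rightarrow> real) \<Rightarrow> nat \<Rightarrow> (nat \<Rightarrow> nat \<Rightarrow> complex^'n^'n) \<Rightarrow> bool"
where
  "iterative_water_filling g K Q \<longleftrightarrow>
     feasible K (Q 0) \<and>
     (\<forall>k. \<forall>i<K. Q (Suc k) i = arg_max (\<lambda>X. g ((mid_sweep Q k i)(i := X))) psd)"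

end

theory Submission
  imports Defs
begin

text \<open>
  Write \<open>g\<close> as a positive multiple of a ratio \<open>f(S) / P\<close> with \<open>f(S) = ln det (I + S)\<close> concave and
  \<open>P\<close> affine.  At a value \<open>\<lambda>\<close> of the ratio, maximality in a block is maximality of the concave
  function \<open>f(S) - \<lambda> P\<close> (Dinkelbach).  Optimal blocks carry no power outside the range of their
  channel, where \<open>Q \<mapsto> H\<^sup>H Q H\<close> is injective, so strong concavity of \<open>f\<close> on bounded sets
  makes every step gain at least a multiple of the squared step length, while first-order optimality
  bounds the optimality gap after a sweep by the step length times the distance to an optimal point.

  Optimal points need not be unique, so convergence of the covariances themselves needs a bound on
  that distance.  All optima share \<open>S\<close> and the total power, hence form a spectrahedron,
  and Sturm's facial reduction argument bounds the distance to it by a power of the residual of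
  these two equations, hence by a power of the gap.  This is a Kurdyka-Lojasiewicz inequality,
  and the usual finite-length argument gives convergence to a global maximizer.
\<close>


text \<open>The obstacle is non-uniqueness. Strong concavity holds in the aggregate \<open>S\<close>
  only, and although each user's map is injective on its own signal space, the joint map to
  \<open>S\<close> may fail to be: users can trade power among themselves. A step therefore controls
  its own length, while the distance to the optimal set needs a separate argument. That bound is of
  Hoelder and not of Lipschitz type because a linear slice of semidefinite cones may miss the
  relative interior (no Slater point). Each facial reduction halves the exponent, and passing from
  the optimality gap to the residual halves it once more, since the gap grows quadratically. The
  exponent has no closed form here; the finite-length argument accepts any value strictly between 0
  and 1. The step-length estimates start only after the first sweep: the initial covariances may lie
  outside the signal spaces and may have value 0.\<close>

section \<open>Quadratic forms that are nonnegative on a subspace\<close>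

text \<open>Along \<open>u + t *\<^sub>R w\<close> the form is a quadratic in \<open>t\<close>
  without constant term; nonnegativity for both signs of \<open>t\<close> kills its linear
  coefficient. This serves both the spectral theorem (Rayleigh maximizers) and the faces of the
  semidefinite cone.\<close>

lemma semidefinite_form_null:
  fixes L :: "'a::euclidean_space \<Rightarrow> 'a"
  assumes L: "linear L" and sym: "\<And>x y. x \<bullet> L y = L x \<bullet> y" and V: "subspace V"
    and nonneg: "\<And>v. v \<in> V \<Longrightarrow> 0 \<le> v \<bullet> L v"
    and u: "u \<in> V" "u \<bullet> L u = 0" and w: "w \<in> V"
  shows "w \<bullet> L u = 0"
proof (rule ccontr)
  interpret linear L by fact
  assume ne: "w \<bullet> L u \<noteq> 0"
  have ineq: "0 \<le> 2 * t * (w \<bullet> L u) + t\<^sup>2 * (w \<bullet> L w)" for t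
  proof -
    have "u + t *\<^sub>R w \<in> V" using u w V by (simp add: subspace_add subspace_scale)
    then have "0 \<le> (u + t *\<^sub>R w) \<bullet> L (u + t *\<^sub>R w)" by (rule nonneg)
    also have "u \<bullet> L w = w \<bullet> L u" using sym[of u w] by (simp add: inner_commute)
    then have "(u + t *\<^sub>R w) \<bullet> L (u + t *\<^sub>R w) = 2 * t * (w \<bullet> L u) + t\<^sup>2 * (w \<bullet> L w)"
      using u(2) by (simp add: add scale inner_add_left inner_add_right power2_eq_square algebra_simps)
    finally show ?thesis .
  qed
  define b where "b = w \<bullet> L u"
  define c where "c = w \<bullet> L w"
  have c: "c \<ge> 0" unfolding c_def using nonneg[OF w] .
  \<comment> \<open>Any positive \<open>s\<close> with \<open>s * c < 2\<close> would do:
    \<open>t = - (s * b)\<close> then makes the quadratic negative.\<close>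
  define s where "s = 1 / (c + 1)"
  have s: "s > 0" "s * c < 1" using c by (auto simp: s_def field_simps)
  have "0 \<le> 2 * (- (s * b)) * b + (- (s * b))\<^sup>2 * c"
    using ineq unfolding b_def c_def by blast
  also have "\<dots> = (s * b\<^sup>2) * (s * c - 2)"
    by (simp add: power2_eq_square algebra_simps)
  also have "\<dots> < 0"
    using s ne by (intro mult_pos_neg mult_pos_pos) (auto simp: b_def)
  finally show False by simp
qed

text \<open>The vector \<open>a\<close> is the orthogonal projection of \<open>v\<close> onto the
  null vectors of the form in \<open>V\<close>. On their orthogonal complement in \<open>V\<close>
  the form is positive definite, and compactness of the unit sphere makes this uniform.\<close>

lemma semidefinite_form_split:
  fixes L :: "'a::euclidean_space \<Rightarrow> 'a"
  assumes "linear L" and V: "subspace V" and nonneg: "\<And>v. v \<in> V \<Longrightarrow> 0 \<le> v \<bullet> L v"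
  shows "subspace {v \<in> V. v \<bullet> L v = 0}"
    and "\<exists>c>0. \<forall>v\<in>V. \<exists>a\<in>V. a \<bullet> L a = 0 \<and> norm a \<le> norm v \<and> c * (norm (v - a))\<^sup>2 \<le> v \<bullet> L v"
proof -
  \<comment> \<open>The symmetric part of \<open>L\<close> has the same quadratic form. The matrices
    \<open>Z\<close> met in facial reduction are not known to be Hermitian, so \<open>L\<close>
    cannot be assumed symmetric.\<close>
  define M where "M v = (1/2) *\<^sub>R (L v + adjoint L v)" for v
  have lM: "linear M" unfolding M_def
    by (intro linear_compose_scale_right linear_compose_add assms(1) adjoint_linear)
  have sym: "x \<bullet> M y = M x \<bullet> y" for x y
  proof -
    have "x \<bullet> adjoint L y = L x \<bullet> y" "y \<bullet> adjoint L x = L y \<bullet> x"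
      using adjoint_works[OF assms(1)] by auto
    then show ?thesis unfolding M_def
      by (simp add: inner_add_left inner_add_right inner_commute)
  qed
  have q: "v \<bullet> M v = v \<bullet> L v" for v
  proof -
    have "v \<bullet> adjoint L v = L v \<bullet> v" using adjoint_works[OF assms(1)] .
    then show ?thesis by (simp add: M_def inner_add_right inner_commute)
  qed
  interpret linear M by fact
  define N where "N = {v \<in> V. v \<bullet> M v = 0}"
  have null: "w \<bullet> M u = 0" if "u \<in> N" "w \<in> V" for u w
    using semidefinite_form_null[OF lM sym V, of u w] nonneg that by (simp add: q N_def)
  have sN: "subspace N"
  proof (rule subspaceI)
    show "0 \<in> N" using V by (simp add: N_def zero subspace_0)
    show "x + y \<in> N" if "x \<in> N" "y \<in> N" for x y
      using null[OF that(1), of "x + y"] null[OF that(2), of "x + y"] that V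
      by (auto simp: N_def add inner_add_right subspace_add)
    show "c *\<^sub>R x \<in> N" if "x \<in> N" for c x
      using that V by (auto simp: N_def scale subspace_scale)
  qed
  then show "subspace {v \<in> V. v \<bullet> L v = 0}" by (simp add: N_def q)
  define W where "W = {v \<in> V. \<forall>u\<in>N. orthogonal v u}"
  have sW: "subspace W"
    using V by (auto simp: W_def subspace_def orthogonal_def inner_add_left)
  have "\<exists>c>0. \<forall>v\<in>W. c * (norm v)\<^sup>2 \<le> v \<bullet> M v"
  proof (cases "W \<subseteq> {0}")
    case True
    then show ?thesis by (intro exI[of _ 1]) (auto simp: zero)
  next
    case False
    let ?K = "W \<inter> sphere 0 1"
    have "compact ?K"
      using closed_subspace[OF sW] by (simp add: compact_Int_closed Int_commute closed_Int_compact)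
    moreover obtain w where "w \<in> W" "w \<noteq> 0" using False by auto
    then have "(1 / norm w) *\<^sub>R w \<in> ?K" using sW by (simp add: subspace_scale)
    then have "?K \<noteq> {}" by blast
    moreover have "continuous_on ?K (\<lambda>v. v \<bullet> M v)"
      by (intro continuous_intros linear_continuous_on linear_conv_bounded_linear[THEN iffD1] lM)
    ultimately have "\<exists>m\<in>?K. \<forall>v\<in>?K. m \<bullet> M m \<le> v \<bullet> M v"
      by (rule continuous_attains_inf)
    then obtain m where m: "m \<in> ?K" "\<And>v. v \<in> ?K \<Longrightarrow> m \<bullet> M m \<le> v \<bullet> M v"
      by blast
    have mN: "m \<notin> N"
    proof
      assume "m \<in> N"
      then have "orthogonal m m" using m(1) by (auto simp: W_def)
      then show False using m(1) by (auto simp: orthogonal_def)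
    qed
    have mV: "m \<in> V" using m(1) by (simp add: W_def)
    then have pos: "m \<bullet> M m > 0"
      using nonneg[OF mV] mN by (auto simp: q N_def order_less_le)
    have "(m \<bullet> M m) * (norm v)\<^sup>2 \<le> v \<bullet> M v" if "v \<in> W" for v
    proof (cases "v = 0")
      case True then show ?thesis by (simp add: zero)
    next
      case False
      then have "(1 / norm v) *\<^sub>R v \<in> ?K" using sW that by (simp add: subspace_scale)
      from m(2)[OF this] have "m \<bullet> M m \<le> (v \<bullet> M v) / (norm v)\<^sup>2"
        by (simp add: scale power2_eq_square)
      then show ?thesis using False by (simp add: pos_le_divide_eq)
    qed
    then show ?thesis using pos by blast
  qed
  then obtain c where c: "c > 0" "\<And>v. v \<in> W \<Longrightarrow> c * (norm v)\<^sup>2 \<le> v \<bullet> M v" by blast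
  show "\<exists>c>0. \<forall>v\<in>V. \<exists>a\<in>V. a \<bullet> L a = 0 \<and> norm a \<le> norm v \<and> c * (norm (v - a))\<^sup>2 \<le> v \<bullet> L v"
  proof (intro exI conjI ballI)
    show "c > 0" by fact
    fix v assume v: "v \<in> V"
    obtain a b where ab: "a \<in> span N" "\<And>w. w \<in> span N \<Longrightarrow> orthogonal b w" "v = a + b"
      using orthogonal_subspace_decomp_exists[of N v] by metis
    have spN: "span N = N" using sN by (simp add: span_eq_iff)
    have aN: "a \<in> N" and aV: "a \<in> V" using ab(1) unfolding spN by (auto simp: N_def)
    have "b = v - a" using ab by simp
    then have bV: "b \<in> V" using aV v V by (simp add: subspace_diff)
    then have bW: "b \<in> W" using ab spN by (auto simp: W_def)
    have "norm a \<le> norm v"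
    proof -
      have "orthogonal a b" using ab(2)[OF ab(1)] by (simp add: orthogonal_commute)
      then have "(norm v)\<^sup>2 = (norm a)\<^sup>2 + (norm b)\<^sup>2" using norm_add_Pythagorean ab(3) by blast
      then show ?thesis using power2_le_imp_le[of "norm a" "norm v"] by simp
    qed
    moreover have "v \<bullet> M v = b \<bullet> M b"
    proof -
      have "b \<bullet> M a = 0" "a \<bullet> M a = 0" using null[OF aN] bV aV by auto
      moreover then have "a \<bullet> M b = 0" using sym[of a b] by (simp add: inner_commute)
      ultimately show ?thesis unfolding ab(3)
        by (simp add: add inner_add_left inner_add_right)
    qed
    moreover have "a \<bullet> L a = 0" using aN by (simp add: N_def q)
    ultimately show "\<exists>a\<in>V. a \<bullet> L a = 0 \<and> norm a \<le> norm v \<and> c * (norm (v - a))\<^sup>2 \<le> v \<bullet> L v"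
      using aV c(2)[OF bW] \<open>b = v - a\<close> by (intro bexI[of _ a]) (auto simp: q[symmetric])
  qed
qed

subsection \<open>Hermitian matrices\<close>

text \<open>Eigenbases must be orthonormal in the complex sense, whereas \<open>\<bullet>\<close> is
  only the real part of this sesquilinear form.\<close>

definition cinner :: "complex^'n \<Rightarrow> complex^'n \<Rightarrow> complex" where
  "cinner u v = (\<Sum>i\<in>UNIV. cnj (u $ i) * v $ i)"

lemma inner_eq_Re_cinner: "u \<bullet> v = Re (cinner u v)"
  by (simp add: cinner_def inner_vec_def inner_complex_def)

lemma cinner_commute: "cinner v u = cnj (cinner u v)"
  by (simp add: cinner_def mult.commute)

lemma cinner_add_right: "cinner u (v + w) = cinner u v + cinner u w"
  and cinner_smult_right: "cinner u (c *s v) = c * cinner u v"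
  and cinner_smult_left: "cinner (c *s u) v = cnj c * cinner u v"
  and cinner_scaleR_right: "cinner u (r *\<^sub>R v) = of_real r * cinner u v"
  and cinner_zero_right [simp]: "cinner u 0 = 0"
  by (simp_all add: cinner_def algebra_simps sum.distrib sum_distrib_left
      vector_scaleR_component scaleR_conv_of_real[where 'a = complex])

lemma cinner_self: "cinner u u = of_real ((norm u)\<^sup>2)"
proof -
  have "Im (cinner u u) = 0" by (simp add: cinner_def mult.commute)
  moreover have "Re (cinner u u) = (norm u)\<^sup>2"
    by (simp add: inner_eq_Re_cinner[symmetric] power2_norm_eq_inner)
  ultimately show ?thesis by (simp add: complex_eq_iff)
qed

lemma conj_transpose_nth [simp]: "conj_transpose A $ i $ j = cnj (A $ j $ i)"
  by (simp add: conj_transpose_def)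

lemma conj_transpose_conj_transpose [simp]: "conj_transpose (conj_transpose A) = A"
  by (simp add: vec_eq_iff)

lemma conj_transpose_mult: "conj_transpose (A ** B) = conj_transpose B ** conj_transpose A"
  by (simp add: vec_eq_iff matrix_matrix_mult_def mult.commute)

lemma conj_transpose_add: "conj_transpose (A + B) = conj_transpose A + conj_transpose B"
  and conj_transpose_scaleR: "conj_transpose (r *\<^sub>R A) = r *\<^sub>R conj_transpose A"
  and conj_transpose_mat_1 [simp]: "conj_transpose (mat 1) = mat 1"
  and conj_transpose_zero [simp]: "conj_transpose 0 = 0"
  by (auto simp: vec_eq_iff mat_def)

lemma cinner_conj_transpose: "cinner (conj_transpose A *v x) y = cinner x (A *v y)"
proof -
  have "cinner (conj_transpose A *v x) y = (\<Sum>i\<in>UNIV. \<Sum>j\<in>UNIV. A $ j $ i * cnj (x $ j) * y $ i)"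
    by (simp add: cinner_def matrix_vector_mult_def sum_distrib_right)
  also have "\<dots> = (\<Sum>j\<in>UNIV. \<Sum>i\<in>UNIV. A $ j $ i * cnj (x $ j) * y $ i)"
    by (rule sum.swap)
  also have "\<dots> = cinner x (A *v y)"
    by (simp add: cinner_def matrix_vector_mult_def sum_distrib_left mult_ac)
  finally show ?thesis .
qed

lemma inner_conj_transpose: "(conj_transpose A *v x) \<bullet> y = x \<bullet> (A *v y)"
  by (simp add: inner_eq_Re_cinner cinner_conj_transpose)

text \<open>A maximizer \<open>u\<close> of the Rayleigh quotient on the complement of
  \<open>B\<close> is a null vector of the form of \<open>r I - A\<close>, which is nonnegative
  there. Hence \<open>L u\<close> is orthogonal to the complement; it also lies in it, so it
  vanishes.\<close>

lemma hermitian_eigenvector_in_complement: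
  fixes A :: "complex^'n^'n"
  assumes A: "conj_transpose A = A" and B: "finite B" "card B < CARD('n)"
    and eig: "\<And>b. b \<in> B \<Longrightarrow> \<exists>r::real. A *v b = r *\<^sub>R b"
  obtains u r where "norm u = 1" "A *v u = r *\<^sub>R u" "\<And>b. b \<in> B \<Longrightarrow> cinner b u = 0"
proof -
  define V where "V = {v. \<forall>b\<in>B. cinner b v = 0}"
  have sV: "subspace V"
    by (auto simp: V_def subspace_def cinner_add_right cinner_scaleR_right)
  obtain x where x: "x \<in> V" "x \<noteq> 0"
  proof -
    \<comment> \<open>Real orthogonality to \<open>b\<close> and to \<open>i b\<close> together is
      complex orthogonality to \<open>b\<close>. The real dimension of the whole space is twice
      \<open>CARD('n)\<close>, which leaves room.\<close>
    let ?S = "B \<union> (\<lambda>b. \<i> *s b) ` B"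
    have "dim ?S \<le> card ?S" using B by (intro dim_le_card') auto
    also have "\<dots> \<le> card B + card ((\<lambda>b. \<i> *s b) ` B)" by (rule card_Un_le)
    also have "\<dots> \<le> 2 * card B" using card_image_le[OF B(1)] by fastforce
    also have "\<dots> < DIM(complex^'n)" using B by simp
    finally obtain x where x: "x \<noteq> 0" "\<And>y. y \<in> span ?S \<Longrightarrow> orthogonal x y"
      using orthogonal_to_subspace_exists by metis
    have "cinner b x = 0" if "b \<in> B" for b
    proof -
      have "b \<bullet> x = 0" "(\<i> *s b) \<bullet> x = 0"
        using x(2)[of b] x(2)[of "\<i> *s b"] that
        by (auto simp: orthogonal_def inner_commute intro: span_base)
      then show ?thesis
        by (simp add: inner_eq_Re_cinner cinner_smult_left complex_eq_iff)
    qed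
    then have "x \<in> V" by (simp add: V_def)
    then show ?thesis using x(1) that by blast
  qed
  let ?K = "V \<inter> sphere 0 1"
  have "compact ?K"
    using closed_subspace[OF sV] by (simp add: compact_Int_closed Int_commute closed_Int_compact)
  moreover have "(1 / norm x) *\<^sub>R x \<in> ?K" using x sV by (simp add: subspace_scale)
  then have "?K \<noteq> {}" by blast
  moreover have "continuous_on ?K (\<lambda>v. v \<bullet> (A *v v))"
    by (intro continuous_intros linear_continuous_on matrix_vector_mul_bounded_linear)
  ultimately have "\<exists>u\<in>?K. \<forall>v\<in>?K. v \<bullet> (A *v v) \<le> u \<bullet> (A *v u)"
    by (rule continuous_attains_sup)
  then obtain u where u: "u \<in> ?K" "\<And>v. v \<in> ?K \<Longrightarrow> v \<bullet> (A *v v) \<le> u \<bullet> (A *v u)"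
    by blast
  define r where "r = u \<bullet> (A *v u)"
  define L where "L w = r *\<^sub>R w - A *v w" for w
  have lL: "linear L" unfolding L_def
    by (intro linear_compose_sub linear_scale_self matrix_vector_mul_linear)
  have symA: "(A *v x) \<bullet> y = x \<bullet> (A *v y)" for x y
    using inner_conj_transpose[of A x y] A by simp
  have nonneg: "0 \<le> v \<bullet> L v" if "v \<in> V" for v
  proof (cases "v = 0")
    case False
    then have "(1 / norm v) *\<^sub>R v \<in> ?K" using sV that by (simp add: subspace_scale)
    from u(2)[OF this] have "(v \<bullet> (A *v v)) / (norm v)\<^sup>2 \<le> r"
      by (simp add: r_def linear_scale[OF matrix_vector_mul_linear] power2_eq_square)
    then have "v \<bullet> (A *v v) \<le> r * (norm v)\<^sup>2" using False by (simp add: pos_divide_le_eq)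
    then show ?thesis by (simp add: L_def inner_diff_right power2_norm_eq_inner)
  qed (simp add: L_def)
  have "u \<in> V" "norm u = 1" using u by auto
  then have "u \<bullet> L u = 0" by (simp add: L_def r_def inner_diff_right norm_eq_1)
  \<comment> \<open>The complement is invariant under \<open>A\<close> because the members of
    \<open>B\<close> are eigenvectors and \<open>A\<close> is Hermitian.\<close>
  have LV: "L u \<in> V"
  proof -
    have "cinner b (A *v u) = 0" if b: "b \<in> B" for b
    proof -
      obtain s :: real where "A *v b = s *\<^sub>R b" using eig[OF b] by blast
      then have "cinner u (A *v b) = of_real s * cinner u b" by (simp add: cinner_scaleR_right)
      moreover have "cinner u b = 0" using \<open>u \<in> V\<close> b cinner_commute[of u b] by (simp add: V_def)
      ultimately show ?thesis
        using cinner_conj_transpose[of A u b] A cinner_commute[of b "A *v u"] by simp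
    qed
    then have "A *v u \<in> V" by (simp add: V_def)
    then show ?thesis using \<open>u \<in> V\<close> sV by (simp add: L_def subspace_diff subspace_scale)
  qed
  have "L u \<bullet> L u = 0"
  proof (rule semidefinite_form_null[OF lL _ sV nonneg \<open>u \<in> V\<close> \<open>u \<bullet> L u = 0\<close> LV])
    show "x \<bullet> L y = L x \<bullet> y" for x y
      by (simp add: L_def inner_diff_left inner_diff_right symA)
  qed
  then have "A *v u = r *\<^sub>R u" by (simp add: L_def)
  then show ?thesis using that \<open>norm u = 1\<close> \<open>u \<in> V\<close> by (auto simp: V_def)
qed

lemma hermitian_orthonormal_eigenbasis:
  fixes A :: "complex^'n^'n"
  assumes A: "conj_transpose A = A"
  obtains u :: "'n \<Rightarrow> complex^'n" and d :: "'n \<Rightarrow> real"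
  where "\<And>i j. cinner (u i) (u j) = (if i = j then 1 else 0)" "\<And>i. A *v u i = d i *\<^sub>R u i"
proof -
  have "\<exists>B. finite B \<and> card B = m \<and> (\<forall>b\<in>B. norm b = 1 \<and> (\<exists>r::real. A *v b = r *\<^sub>R b)) \<and>
          (\<forall>b\<in>B. \<forall>c\<in>B. b \<noteq> c \<longrightarrow> cinner b c = 0)" if "m \<le> CARD('n)" for m
    using that
  proof (induction m)
    case 0
    show ?case by (intro exI[of _ "{}"]) auto
  next
    case (Suc m)
    then obtain B where B: "finite B" "card B = m" "\<And>b. b \<in> B \<Longrightarrow> norm b = 1"
      "\<And>b. b \<in> B \<Longrightarrow> \<exists>r::real. A *v b = r *\<^sub>R b"
      "\<And>b c. b \<in> B \<Longrightarrow> c \<in> B \<Longrightarrow> b \<noteq> c \<Longrightarrow> cinner b c = 0" by auto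
    from B Suc.prems obtain u r where u: "norm u = 1" "A *v u = r *\<^sub>R u"
      "\<And>b. b \<in> B \<Longrightarrow> cinner b u = 0"
      using hermitian_eigenvector_in_complement[OF A B(1)] by (metis Suc_le_eq)
    have "u \<notin> B" using u(1) u(3)[of u] by (auto simp: cinner_self)
    moreover have "cinner u b = 0" if "b \<in> B" for b
      using u(3)[OF that] cinner_commute[of u b] by simp
    ultimately show ?case using B u by (intro exI[of _ "insert u B"]) auto
  qed
  from this[of "CARD('n)"] obtain B where B: "finite B" "card B = CARD('n)"
      "\<And>b. b \<in> B \<Longrightarrow> norm b = 1" "\<And>b. b \<in> B \<Longrightarrow> \<exists>r::real. A *v b = r *\<^sub>R b"
      "\<And>b c. b \<in> B \<Longrightarrow> c \<in> B \<Longrightarrow> b \<noteq> c \<Longrightarrow> cinner b c = 0" by auto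
  obtain u where u: "bij_betw u (UNIV :: 'n set) B"
    using B(1,2) finite_same_card_bij[of "UNIV :: 'n set" B] by auto
  have uB: "u i \<in> B" for i using u by (auto simp: bij_betw_def)
  have "\<exists>d. \<forall>i. A *v u i = (d i :: real) *\<^sub>R u i"
    using B(4)[OF uB] by metis
  then obtain d where d: "\<And>i. A *v u i = (d i :: real) *\<^sub>R u i" by blast
  have "cinner (u i) (u j) = (if i = j then 1 else 0)" for i j
    using B(3)[OF uB] B(5)[OF uB uB, of i j] u
    by (auto simp: cinner_self bij_betw_def dest: injD)
  then show ?thesis using that d by blast
qed

definition diag_mat :: "('n \<Rightarrow> real) \<Rightarrow> complex^'n^'n" where
  "diag_mat d = (\<chi> i j. if i = j then of_real (d i) else 0)"

lemma hermitian_diagonalization: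
  fixes A :: "complex^'n^'n"
  assumes A: "conj_transpose A = A"
  obtains U :: "complex^'n^'n" and d :: "'n \<Rightarrow> real" where "conj_transpose U ** U = mat 1" "U ** conj_transpose U = mat 1"
    "A = U ** diag_mat d ** conj_transpose U"
proof -
  obtain u :: "'n \<Rightarrow> complex^'n" and d :: "'n \<Rightarrow> real"
    where u: "\<And>i j. cinner (u i) (u j) = (if i = j then 1 else 0)" "\<And>i. A *v u i = d i *\<^sub>R u i"
    using hermitian_orthonormal_eigenbasis[OF A] by metis
  define U :: "complex^'n^'n" where "U = (\<chi> i j. u j $ i)"
  have UU: "conj_transpose U ** U = mat 1"
    using u(1) by (simp add: vec_eq_iff matrix_matrix_mult_def U_def mat_def cinner_def)
  then have UU': "U ** conj_transpose U = mat 1"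
    by (simp add: matrix_left_right_inverse)
  have "A ** U = U ** diag_mat d"
  proof -
    have "(A ** U) $ i $ j = (U ** diag_mat d) $ i $ j" for i j
    proof -
      have "(A ** U) $ i $ j = (A *v u j) $ i"
        by (simp add: matrix_matrix_mult_def matrix_vector_mult_def U_def)
      also have "\<dots> = of_real (d j) * u j $ i" by (simp add: u(2) scaleR_conv_of_real[where 'a = complex])
      also have "\<dots> = (U ** diag_mat d) $ i $ j"
        by (simp add: matrix_matrix_mult_def U_def diag_mat_def if_distrib[of "\<lambda>x. _ * x"] sum.delta cong: if_cong)
      finally show ?thesis .
    qed
    then show ?thesis by (simp add: vec_eq_iff)
  qed
  then have "A = U ** diag_mat d ** conj_transpose U"
    using UU' by (metis matrix_mul_assoc matrix_mul_rid)
  then show ?thesis using that UU UU' by blast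
qed


subsection \<open>Positive semidefinite matrices and their rank-one decomposition\<close>

definition outer :: "complex^'n \<Rightarrow> complex^'n^'n" where
  "outer v = (\<chi> i j. v $ i * cnj (v $ j))"

lemma inner_matrix_eq_trace:
  fixes X Y :: "complex^'n^'m"
  shows "X \<bullet> Y = Re (trace (conj_transpose X ** Y))"
proof -
  have "X \<bullet> Y = (\<Sum>i\<in>UNIV. \<Sum>j\<in>UNIV. Re (cnj (X $ i $ j) * Y $ i $ j))"
    by (simp add: inner_vec_def inner_complex_def)
  also have "\<dots> = (\<Sum>j\<in>UNIV. \<Sum>i\<in>UNIV. Re (cnj (X $ i $ j) * Y $ i $ j))"
    by (rule sum.swap)
  also have "\<dots> = Re (trace (conj_transpose X ** Y))"
    by (simp add: trace_def matrix_matrix_mult_def)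
  finally show ?thesis .
qed

lemma inner_mat_1_left: "mat 1 \<bullet> (Y :: complex^'n^'n) = Re (trace Y)"
  by (simp add: inner_matrix_eq_trace)

lemma linear_Re_trace: "linear (\<lambda>Q :: complex^'n^'n. Re (trace Q))"
  by (simp only: inner_mat_1_left[symmetric]) (intro bounded_linear.linear bounded_linear_inner_right)

lemma inner_outer_left: "outer v \<bullet> M = v \<bullet> (M *v v)"
proof -
  have "outer v \<bullet> M = (\<Sum>i\<in>UNIV. \<Sum>j\<in>UNIV. Re (cnj (v $ i) * (M $ i $ j * v $ j)))"
    by (simp add: inner_vec_def inner_complex_def outer_def algebra_simps)
  also have "\<dots> = v \<bullet> (M *v v)"
    by (simp add: inner_eq_Re_cinner cinner_def matrix_vector_mult_def sum_distrib_left)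
  finally show ?thesis .
qed

lemma outer_mult: "outer v *v w = cinner v w *s v"
  by (simp add: vec_eq_iff outer_def matrix_vector_mult_def cinner_def sum_distrib_left
      sum_distrib_right mult_ac)

lemma norm_outer: "norm (outer v) = (norm v)\<^sup>2"
proof -
  have "(norm (outer v))\<^sup>2 = Re (cinner v (cinner v v *s v))"
    by (simp add: power2_norm_eq_inner inner_outer_left outer_mult inner_eq_Re_cinner)
  also have "\<dots> = ((norm v)\<^sup>2)\<^sup>2"
    by (simp add: cinner_smult_right cinner_self power2_eq_square)
  finally show ?thesis by (rule power2_eq_imp_eq) simp_all
qed

lemma trace_outer: "Re (trace (outer v)) = (norm v)\<^sup>2"
  by (simp add: inner_mat_1_left[symmetric] inner_commute[of "mat 1"] inner_outer_left
      power2_norm_eq_inner)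

lemma outer_scaleR: "outer (r *\<^sub>R v) = r\<^sup>2 *\<^sub>R outer v"
  by (simp add: vec_eq_iff outer_def power2_eq_square)

lemma norm_matrix_squared: "(norm A)\<^sup>2 = (\<Sum>i\<in>UNIV. \<Sum>j\<in>UNIV. (cmod (A $ i $ j))\<^sup>2)"
  by (simp add: norm_vec_def L2_set_def sum_nonneg)

text \<open>With \<open>x^H\<close> the conjugate transpose of \<open>x\<close>, this is
  \<open>v v^H - a a^H = v (v - a)^H + (v - a) a^H\<close> together with multiplicativity of the
  norm on \<open>x y^H\<close>.\<close>

lemma norm_outer_diff: "norm (outer v - outer a) \<le> (norm v + norm a) * norm (v - a)"
proof -
  define P :: "complex^'a \<Rightarrow> complex^'a \<Rightarrow> complex^'a^'a"
    where "P x y = (\<chi> i j. x $ i * cnj (y $ j))" for x y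
  have nP: "norm (P x y) = norm x * norm y" for x y
  proof -
    have "(norm (P x y))\<^sup>2 = (\<Sum>i\<in>UNIV. \<Sum>j\<in>UNIV. (cmod (x $ i))\<^sup>2 * (cmod (y $ j))\<^sup>2)"
      by (simp add: norm_matrix_squared P_def norm_mult power_mult_distrib)
    also have "\<dots> = (norm x)\<^sup>2 * (norm y)\<^sup>2"
      by (simp add: norm_vec_def L2_set_def sum_nonneg sum_product)
    finally show ?thesis
      by (metis norm_ge_zero mult_nonneg_nonneg power_mult_distrib power2_eq_iff_nonneg)
  qed
  have "outer v - outer a = P v (v - a) + P (v - a) a"
    by (simp add: vec_eq_iff outer_def P_def algebra_simps)
  then have "norm (outer v - outer a) \<le> norm (P v (v - a)) + norm (P (v - a) a)"
    by (metis norm_triangle_ineq)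
  then show ?thesis by (simp add: nP algebra_simps)
qed

lemma psd_iff: "psd Q \<longleftrightarrow> conj_transpose Q = Q \<and> (\<forall>x. 0 \<le> x \<bullet> (Q *v x))"
  by (simp add: psd_def inner_eq_Re_cinner cinner_def)

lemma inner_mult_conj_transpose:
  "w \<bullet> ((C ** D ** conj_transpose C) *v w) = (conj_transpose C *v w) \<bullet> (D *v (conj_transpose C *v w))"
  by (simp add: matrix_vector_mul_assoc[symmetric] inner_conj_transpose)

lemma mult_outer: "C ** outer v ** conj_transpose C = outer (C *v v)"
proof -
  have "(\<Sum>k\<in>UNIV. (\<Sum>l\<in>UNIV. C $ i $ l * (v $ l * cnj (v $ k))) * cnj (C $ j $ k))
      = (\<Sum>l\<in>UNIV. C $ i $ l * v $ l) * (\<Sum>k\<in>UNIV. cnj (C $ j $ k) * cnj (v $ k))" for i j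
    by (simp add: sum_distrib_left sum_distrib_right mult_ac)
  then show ?thesis
    by (simp add: vec_eq_iff matrix_matrix_mult_def outer_def matrix_vector_mult_def)
qed

lemma psd_outer [simp]: "psd (outer v)"
proof -
  have "x \<bullet> (outer v *v x) = (cmod (cinner v x))\<^sup>2" for x
    using cinner_commute[of x v]
    by (simp add: outer_mult inner_eq_Re_cinner cinner_smult_right cmod_power2)
      (simp add: power2_eq_square)
  then show ?thesis by (simp add: psd_iff vec_eq_iff outer_def mult.commute)
qed

lemma psd_zero [simp]: "psd 0"
  by (simp add: psd_iff)

lemma psd_add: "psd P \<Longrightarrow> psd Q \<Longrightarrow> psd (P + Q)"
  by (simp add: psd_iff conj_transpose_add matrix_vector_mult_add_rdistrib inner_add_right)

lemma scaleR_matrix_vector_mult: "(r *\<^sub>R A) *v x = r *\<^sub>R (A *v (x :: complex^'n))"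
  by (simp add: vec_eq_iff matrix_vector_mult_def scaleR_right.sum)

lemma psd_scaleR: "psd Q \<Longrightarrow> 0 \<le> r \<Longrightarrow> psd (r *\<^sub>R Q)"
  by (simp add: psd_iff conj_transpose_scaleR scaleR_matrix_vector_mult)

lemma closed_psd: "closed {Q :: complex^'n^'n. psd Q}"
proof -
  have "{Q :: complex^'n^'n. psd Q} = {Q. conj_transpose Q = Q} \<inter> (\<Inter>x. {Q. 0 \<le> outer x \<bullet> Q})"
    by (auto simp: psd_iff inner_outer_left)
  moreover have "linear (conj_transpose :: complex^'n^'n \<Rightarrow> _)"
    by (intro linearI) (simp_all add: conj_transpose_add conj_transpose_scaleR)
  then have "continuous_on UNIV (conj_transpose :: complex^'n^'n \<Rightarrow> _)"
    by (simp add: linear_continuous_on linear_conv_bounded_linear)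
  then have "closed {Q :: complex^'n^'n. conj_transpose Q = Q}"
    by (intro closed_Collect_eq) auto
  ultimately show ?thesis
    by (auto intro!: closed_Int closed_INT closed_halfspace_component_ge closed_Collect_le continuous_intros)
qed

lemma diag_mat_mult: "diag_mat d *v x = (\<chi> i. of_real (d i) * x $ i)"
  by (simp add: vec_eq_iff diag_mat_def matrix_vector_mult_def if_distrib[of "\<lambda>x. x * _"] cong: if_cong)

lemma diag_mat_mult_diag_mat: "diag_mat d ** diag_mat e = diag_mat (\<lambda>i. d i * e i)"
  by (auto simp: vec_eq_iff diag_mat_def matrix_matrix_mult_def if_distrib[of "\<lambda>x. x * _"] cong: if_cong)

lemma conj_transpose_diag_mat [simp]: "conj_transpose (diag_mat d) = diag_mat d"
  by (simp add: vec_eq_iff diag_mat_def)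

lemma diag_mat_1 [simp]: "diag_mat (\<lambda>i. 1) = mat 1"
  by (simp add: vec_eq_iff diag_mat_def mat_def)

lemma diag_mat_diff: "diag_mat d - diag_mat e = diag_mat (\<lambda>i. d i - e i)"
  by (simp add: vec_eq_iff diag_mat_def)

lemma inner_diag_mat: "x \<bullet> (diag_mat d *v x) = (\<Sum>i\<in>UNIV. d i * (cmod (x $ i))\<^sup>2)"
  by (simp add: diag_mat_mult inner_vec_def inner_complex_def cmod_power2)
    (simp add: power2_eq_square algebra_simps)

text \<open>The vector \<open>w\<close> is chosen so that \<open>conj_transpose C\<close> maps it to
  the \<open>i\<close>-th unit vector. Each diagonal entry thus becomes a value of the quadratic
  form, and definiteness turns into signs of the \<open>d i\<close>.\<close>

lemma quadratic_form_congruence: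
  fixes C B :: "complex^'n^'n"
  assumes "C ** B = mat 1"
  shows "\<exists>w. w \<noteq> 0 \<and> w \<bullet> ((C ** diag_mat d ** conj_transpose C) *v w) = d i"
proof -
  define w where "w = conj_transpose B *v axis i 1"
  have "conj_transpose C ** conj_transpose B = mat 1"
  proof -
    have "B ** C = mat 1" using assms by (simp add: matrix_left_right_inverse)
    then show ?thesis by (metis conj_transpose_mult conj_transpose_mat_1)
  qed
  then have w: "conj_transpose C *v w = axis i 1"
    by (simp add: w_def matrix_vector_mul_assoc)
  have "w \<noteq> 0" using w by (metis axis_eq_0_iff matrix_vector_mult_0_right zero_neq_one)
  moreover have "w \<bullet> ((C ** diag_mat d ** conj_transpose C) *v w) = d i"
    unfolding inner_mult_conj_transpose w inner_diag_mat
    by (simp add: axis_def if_distrib[of cmod] if_distrib[of "\<lambda>x. x\<^sup>2"] if_distrib[of "\<lambda>x. _ * x"] cong: if_cong)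
  ultimately show ?thesis by blast
qed

text \<open>The summands are the eigenvectors scaled by the square roots of their eigenvalues. From
  here on, statements about semidefinite matrices are proved on rank-one terms and summed along the
  list.\<close>

lemma psd_eq_sum_outer:
  fixes Q :: "complex^'n^'n"
  assumes "psd Q"
  obtains vs where "Q = sum_list (map outer vs)"
proof -
  obtain U :: "complex^'n^'n" and d where U: "conj_transpose U ** U = mat 1" "U ** conj_transpose U = mat 1"
    and Q: "Q = U ** diag_mat d ** conj_transpose U"
    using hermitian_diagonalization[of Q] assms by (auto simp: psd_iff)
  have d: "d i \<ge> 0" for i
    using quadratic_form_congruence[OF U(2), of d i] assms Q by (metis psd_iff)
  define v where "v i = sqrt (d i) *\<^sub>R column i U" for i
  have "Q $ a $ b = (\<Sum>i\<in>UNIV. outer (v i)) $ a $ b" for a b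
  proof -
    have "Q $ a $ b = (\<Sum>i\<in>UNIV. U $ a $ i * of_real (d i) * cnj (U $ b $ i))"
      by (simp add: Q matrix_matrix_mult_def diag_mat_def if_distrib[of "\<lambda>x. _ * x"] cong: if_cong)
    also have "\<dots> = (\<Sum>i\<in>UNIV. outer (v i) $ a $ b)"
      using d by (simp add: v_def outer_scaleR)
        (simp add: outer_def column_def scaleR_conv_of_real[where 'a = complex] mult_ac)
    finally show ?thesis by simp
  qed
  then have Qs: "Q = (\<Sum>i\<in>UNIV. outer (v i))" by (simp add: vec_eq_iff)
  obtain xs where xs: "set xs = (UNIV :: 'n set)" "distinct xs"
    using finite_distinct_list[of "UNIV :: 'n set"] by auto
  have "Q = sum_list (map outer (map v xs))"
    using sum_list_distinct_conv_sum_set[OF xs(2), of "outer \<circ> v"] by (simp add: Qs xs comp_def)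
  then show ?thesis using that by blast
qed

lemma psd_sum_outer: "psd (sum_list (map outer vs))"
  by (induction vs) (auto simp: psd_add)

lemma sum_list_mult_outer:
  "C ** sum_list (map outer vs) ** conj_transpose C = sum_list (map outer (map ((*v) C) vs))"
proof (induction vs)
  case Nil
  show ?case by (simp add: vec_eq_iff matrix_matrix_mult_def)
next
  case (Cons v vs)
  have "C ** (outer v + X) ** conj_transpose C = outer (C *v v) + C ** X ** conj_transpose C" for X
    by (simp add: mult_outer[symmetric] vec_eq_iff matrix_matrix_mult_def algebra_simps sum.distrib)
  then show ?case using Cons.IH by simp
qed

lemma psd_congruence: "psd Q \<Longrightarrow> psd (C ** Q ** conj_transpose C)"
  by (metis psd_eq_sum_outer psd_sum_outer sum_list_mult_outer)

lemma trace_sum_outer: "Re (trace (sum_list (map outer vs))) = (\<Sum>v\<leftarrow>vs. (norm v)\<^sup>2)"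
  by (induction vs) (simp_all add: trace_add trace_outer trace_def[of 0])

lemma norm_sum_outer_le: "norm (sum_list (map outer vs)) \<le> (\<Sum>v\<leftarrow>vs. (norm v)\<^sup>2)"
  by (induction vs) (auto simp: norm_outer intro: order_trans[OF norm_triangle_ineq])

text \<open>Norm and trace agree on rank-one terms, and the triangle inequality does the rest. So
  bounded transmit power means bounded covariances.\<close>

lemma psd_norm_le_trace: "psd Q \<Longrightarrow> norm Q \<le> Re (trace Q)"
  by (metis psd_eq_sum_outer trace_sum_outer norm_sum_outer_le)


subsection \<open>The log-determinant\<close>

lemma norm_sum_mult_squared_le:
  fixes a b :: "'k::finite \<Rightarrow> complex"
  shows "(cmod (\<Sum>j\<in>UNIV. a j * b j))\<^sup>2 \<le> (\<Sum>j\<in>UNIV. (cmod (a j))\<^sup>2) * (\<Sum>j\<in>UNIV. (cmod (b j))\<^sup>2)"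
proof -
  have "cmod (\<Sum>j\<in>UNIV. a j * b j) \<le> (\<Sum>j\<in>UNIV. cmod (a j) * cmod (b j))"
    by (rule order_trans[OF norm_sum]) (simp add: norm_mult)
  then have "(cmod (\<Sum>j\<in>UNIV. a j * b j))\<^sup>2 \<le> (\<Sum>j\<in>UNIV. cmod (a j) * cmod (b j))\<^sup>2"
    by (intro power_mono) auto
  also have "\<dots> \<le> (\<Sum>j\<in>UNIV. (cmod (a j))\<^sup>2) * (\<Sum>j\<in>UNIV. (cmod (b j))\<^sup>2)"
    by (rule Cauchy_Schwarz_ineq_sum)
  finally show ?thesis .
qed

lemma norm_matrix_mult_le:
  fixes A :: "complex^'k^'m" and B :: "complex^'n^'k"
  shows "norm (A ** B) \<le> norm A * norm B"
proof -
  have "(norm (A ** B))\<^sup>2 \<le> (\<Sum>i\<in>UNIV. \<Sum>l\<in>UNIV. (\<Sum>j\<in>UNIV. (cmod (A $ i $ j))\<^sup>2) * (\<Sum>j\<in>UNIV. (cmod (B $ j $ l))\<^sup>2))"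
    unfolding norm_matrix_squared
    by (intro sum_mono) (simp add: matrix_matrix_mult_def norm_sum_mult_squared_le)
  also have "\<dots> = (\<Sum>i\<in>UNIV. \<Sum>j\<in>UNIV. (cmod (A $ i $ j))\<^sup>2) * (\<Sum>l\<in>UNIV. \<Sum>j\<in>UNIV. (cmod (B $ j $ l))\<^sup>2)"
    by (simp add: sum_product)
  also have "(\<Sum>l\<in>UNIV. \<Sum>j\<in>UNIV. (cmod (B $ j $ l))\<^sup>2) = (norm B)\<^sup>2"
    unfolding norm_matrix_squared by (rule sum.swap)
  finally have "(norm (A ** B))\<^sup>2 \<le> (norm A * norm B)\<^sup>2"
    by (simp add: norm_matrix_squared[symmetric] power_mult_distrib)
  then show ?thesis by (rule power2_le_imp_le) simp
qed

lemma norm_conj_transpose [simp]: "norm (conj_transpose A) = norm A"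
proof (rule power2_eq_imp_eq)
  show "(norm (conj_transpose A))\<^sup>2 = (norm A)\<^sup>2"
    unfolding norm_matrix_squared by (subst sum.swap) simp
qed auto

lemma det_conj_transpose: "det (conj_transpose A) = cnj (det (A :: complex^'n^'n))"
proof -
  have "det (transpose (conj_transpose A)) = cnj (det A)"
    unfolding det_def by (simp add: transpose_def)
  then show ?thesis by (simp add: det_transpose)
qed

lemma det_diag_mat: "det (diag_mat d) = of_real (\<Prod>i\<in>UNIV. d i)"
  by (subst det_diagonal) (simp_all add: diag_mat_def)

definition logdet :: "complex^'n^'n \<Rightarrow> real" where
  "logdet S = ln (Re (det (mat 1 + S)))"

text \<open>At a semidefinite \<open>S\<close> this is the gradient of \<open>logdet\<close> for the
  real inner product of matrices.\<close>

definition resolvent :: "complex^'n^'n \<Rightarrow> complex^'n^'n" where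
  "resolvent S = matrix_inv (mat 1 + S)"

text \<open>Cauchy-Schwarz applied to the quadratic form, which is at least the squared norm. It
  gives invertibility, and the inverse is a contraction.\<close>

lemma norm_le_mat_1_plus_psd:
  assumes "psd S"
  shows "norm v \<le> norm ((mat 1 + S) *v v)"
proof -
  have "norm v * norm v \<le> v \<bullet> ((mat 1 + S) *v v)"
    using assms by (simp add: psd_iff matrix_vector_mult_add_rdistrib inner_add_right
        power2_norm_eq_inner[symmetric] power2_eq_square)
  also have "\<dots> \<le> norm v * norm ((mat 1 + S) *v v)" by (rule norm_cauchy_schwarz)
  finally show ?thesis by (cases "v = 0") auto
qed

lemma inverse_mat_1_plus_psd:
  assumes "psd S"
  shows "(mat 1 + S) ** resolvent S = mat 1" "resolvent S ** (mat 1 + S) = mat 1"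
proof -
  have "x = 0" if "(mat 1 + S) *v x = 0" for x
    using norm_le_mat_1_plus_psd[OF assms, of x] that by simp
  then have "\<exists>B. B ** (mat 1 + S) = mat 1"
    by (simp add: matrix_left_invertible_ker)
  then have inv: "invertible (mat 1 + S)" by (simp add: invertible_left_inverse)
  show "(mat 1 + S) ** resolvent S = mat 1" "resolvent S ** (mat 1 + S) = mat 1"
    using someI_ex[OF inv[unfolded invertible_def]] by (auto simp: resolvent_def matrix_inv_def)
qed

lemma norm_resolvent_mult_le: "psd S \<Longrightarrow> norm (resolvent S *v w) \<le> norm w"
  using norm_le_mat_1_plus_psd[of S "resolvent S *v w"]
  by (simp add: matrix_vector_mul_assoc inverse_mat_1_plus_psd)

lemma matrix_mult_axis: "A *v axis j 1 = column j (A :: complex^'n^'m)"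
  by (simp add: vec_eq_iff matrix_vector_mult_def axis_def column_def if_distrib[of "\<lambda>x. _ * x"] cong: if_cong)

text \<open>Each column is the image of a unit vector under a contraction; the square root comes
  from adding the squared column norms.\<close>

lemma norm_resolvent_le:
  assumes "psd (S :: complex^'n^'n)"
  shows "norm (resolvent S) \<le> sqrt CARD('n)"
proof -
  have "(norm (resolvent S))\<^sup>2 = (\<Sum>j\<in>UNIV. (norm (column j (resolvent S)))\<^sup>2)"
    unfolding norm_matrix_squared by (subst sum.swap) (simp add: norm_vec_def L2_set_def sum_nonneg column_def)
  also have "\<dots> \<le> (\<Sum>j\<in>(UNIV :: 'n set). 1)"
  proof (rule sum_mono)
    fix j
    have "norm (resolvent S *v axis j 1) \<le> norm (axis j (1::complex) :: complex^'n)"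
      by (rule norm_resolvent_mult_le[OF assms])
    then have "norm (column j (resolvent S)) \<le> 1" by (simp add: matrix_mult_axis norm_eq_1[of "axis j 1", THEN iffD2] inner_axis_axis)
    then show "(norm (column j (resolvent S)))\<^sup>2 \<le> 1" by (simp add: power_le_one)
  qed
  finally show ?thesis by (intro real_le_rsqrt) simp
qed

lemma matrix_diff_ldistrib: "A ** (B - C) = A ** B - A ** (C :: complex^'n^'k)"
  and matrix_diff_rdistrib: "(D - E) ** B = D ** B - E ** (B :: complex^'n^'k)"
  by (simp_all add: vec_eq_iff matrix_matrix_mult_def algebra_simps sum_subtractf)

text \<open>The resolvent identity: the difference equals
  \<open>resolvent S ** (T - S) ** resolvent T\<close>.\<close>

lemma resolvent_lipschitz:
  assumes "psd (S :: complex^'n^'n)" "psd T"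
  shows "norm (resolvent S - resolvent T) \<le> CARD('n) * norm (S - T)"
proof -
  have "resolvent S - resolvent T = resolvent S ** (T - S) ** resolvent T"
  proof -
    have "resolvent S ** ((mat 1 + T) - (mat 1 + S)) ** resolvent T
        = resolvent S ** ((mat 1 + T) ** resolvent T) - resolvent S ** (mat 1 + S) ** resolvent T"
      by (simp only: matrix_diff_ldistrib matrix_diff_rdistrib matrix_mul_assoc)
    then show ?thesis using assms by (simp add: inverse_mat_1_plus_psd)
  qed
  then have "norm (resolvent S - resolvent T) \<le> norm (resolvent S ** (T - S)) * norm (resolvent T)"
    by (metis norm_matrix_mult_le)
  also have "\<dots> \<le> norm (resolvent S) * norm (T - S) * norm (resolvent T)"
    by (intro mult_right_mono norm_matrix_mult_le) auto
  also have "\<dots> \<le> sqrt CARD('n) * norm (T - S) * sqrt CARD('n)"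
    using norm_resolvent_le assms by (intro mult_mono) auto
  also have "\<dots> = (sqrt CARD('n) * sqrt CARD('n)) * norm (T - S)" by (simp only: mult_ac)
  also have "\<dots> = CARD('n) * norm (S - T)" by (simp add: norm_minus_commute)
  finally show ?thesis .
qed

lemma psd_hermitian: "psd S \<Longrightarrow> conj_transpose S = S"
  by (simp add: psd_iff)

section \<open>Comparing two log-determinants through a common congruence\<close>

text \<open>The \<open>d i\<close> are the eigenvalues of \<open>resolvent S ** (mat 1 + T)\<close>.
  In these coordinates inequalities between log-determinants reduce to scalar inequalities in
  \<open>d\<close>.\<close>

lemma simultaneous_diagonalization:
  fixes S T :: "complex^'n^'n"
  assumes S: "psd S" and T: "psd T"
  obtains B C :: "complex^'n^'n" and d where
    "C ** B = mat 1" "B ** C = mat 1" "mat 1 + S = C ** conj_transpose C"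
    "mat 1 + T = C ** diag_mat d ** conj_transpose C" "\<And>i. d i > 0"
proof -
  have pos: "w \<bullet> ((mat 1 + X) *v w) > 0" if "psd X" "w \<noteq> 0" for X and w :: "complex^'n"
  proof -
    have "w \<bullet> w > 0" using that by simp
    then show ?thesis using that
      by (simp add: psd_iff matrix_vector_mult_add_rdistrib inner_add_right add_pos_nonneg)
  qed
  have "conj_transpose (mat 1 + S) = mat 1 + S" using S by (simp add: conj_transpose_add psd_hermitian)
  then obtain U :: "complex^'n^'n" and e where U: "conj_transpose U ** U = mat 1" "U ** conj_transpose U = mat 1"
    and M: "mat 1 + S = U ** diag_mat e ** conj_transpose U"
    by (rule hermitian_diagonalization)
  have e: "e i > 0" for i
    using quadratic_form_congruence[OF U(2), of e i] pos[OF S] M by metis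
  define C0 where "C0 = U ** diag_mat (\<lambda>i. sqrt (e i))"
  define B0 where "B0 = diag_mat (\<lambda>i. 1 / sqrt (e i)) ** conj_transpose U"
  have e': "e i \<noteq> 0" "sqrt (e i) * sqrt (e i) = e i" for i
    using e[of i] by auto
  have "C0 ** B0 = U ** (diag_mat (\<lambda>i. sqrt (e i)) ** diag_mat (\<lambda>i. 1 / sqrt (e i))) ** conj_transpose U"
    by (simp only: C0_def B0_def matrix_mul_assoc)
  also have "\<dots> = mat 1" using e' U by (simp add: diag_mat_mult_diag_mat)
  finally have CB: "C0 ** B0 = mat 1" .
  then have BC: "B0 ** C0 = mat 1" by (simp add: matrix_left_right_inverse)
  have "C0 ** conj_transpose C0 = U ** (diag_mat (\<lambda>i. sqrt (e i)) ** diag_mat (\<lambda>i. sqrt (e i))) ** conj_transpose U"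
    by (simp only: C0_def conj_transpose_mult conj_transpose_diag_mat matrix_mul_assoc)
  also have "\<dots> = mat 1 + S" using e' M by (simp add: diag_mat_mult_diag_mat)
  finally have MC: "mat 1 + S = C0 ** conj_transpose C0" by simp
  \<comment> \<open>\<open>N\<close> is \<open>mat 1 + T\<close> in coordinates in which
    \<open>mat 1 + S\<close> is the identity. Its unitary diagonalization \<open>V\<close> leaves
    that identity unchanged, so \<open>C0 ** V\<close> treats both matrices.\<close>
  define N where "N = B0 ** (mat 1 + T) ** conj_transpose B0"
  have "conj_transpose N = N"
    using T by (simp add: N_def conj_transpose_mult conj_transpose_add psd_hermitian matrix_mul_assoc)
  then obtain V :: "complex^'n^'n" and d where V: "conj_transpose V ** V = mat 1" "V ** conj_transpose V = mat 1"
    and N: "N = V ** diag_mat d ** conj_transpose V"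
    by (rule hermitian_diagonalization)
  define C where "C = C0 ** V"
  define B where "B = conj_transpose V ** B0"
  have "C ** B = C0 ** (V ** conj_transpose V) ** B0" by (simp only: C_def B_def matrix_mul_assoc)
  then have 1: "C ** B = mat 1" using V CB by simp
  then have 2: "B ** C = mat 1" by (simp add: matrix_left_right_inverse)
  have "C ** conj_transpose C = C0 ** (V ** conj_transpose V) ** conj_transpose C0"
    by (simp only: C_def conj_transpose_mult matrix_mul_assoc)
  then have 3: "mat 1 + S = C ** conj_transpose C" using V MC by simp
  have "C ** diag_mat d ** conj_transpose C = C0 ** N ** conj_transpose C0"
    by (simp only: C_def N conj_transpose_mult matrix_mul_assoc)
  also have "\<dots> = (C0 ** B0) ** (mat 1 + T) ** (conj_transpose B0 ** conj_transpose C0)"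
    by (simp only: N_def matrix_mul_assoc)
  also have "conj_transpose B0 ** conj_transpose C0 = mat 1"
    using CB by (metis conj_transpose_mult conj_transpose_mat_1)
  finally have 4: "mat 1 + T = C ** diag_mat d ** conj_transpose C" using CB by simp
  have "d i > 0" for i
    using quadratic_form_congruence[OF 1, of d i] pos[OF T] 4 by metis
  then show ?thesis using that 1 2 3 4 by blast
qed

text \<open>Here \<open>resolvent S = conj_transpose B ** B\<close>, so cyclicity of the trace
  cancels \<open>C\<close> against \<open>B\<close>.\<close>

lemma inner_resolvent_congruence:
  fixes B C :: "complex^'n^'n"
  assumes S: "psd S" and CB: "C ** B = mat 1" "B ** C = mat 1" "mat 1 + S = C ** conj_transpose C"
  shows "resolvent S \<bullet> (C ** diag_mat d ** conj_transpose C) = (\<Sum>i\<in>UNIV. d i)"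
proof -
  have B': "conj_transpose C ** conj_transpose B = mat 1"
    using CB(2) by (metis conj_transpose_mult conj_transpose_mat_1)
  have "(mat 1 + S) ** (conj_transpose B ** B) = C ** (conj_transpose C ** conj_transpose B) ** B"
    by (simp only: CB(3) matrix_mul_assoc)
  also have "\<dots> = mat 1" using B' CB by simp
  finally have "resolvent S = conj_transpose B ** B"
    using inverse_mat_1_plus_psd[OF S] by (metis matrix_mul_assoc matrix_mul_lid matrix_mul_rid)
  then have "resolvent S \<bullet> (C ** diag_mat d ** conj_transpose C)
      = Re (trace (conj_transpose B ** (B ** C) ** diag_mat d ** conj_transpose C))"
    by (simp add: inner_matrix_eq_trace conj_transpose_mult matrix_mul_assoc)
  also have "\<dots> = Re (trace (conj_transpose C ** conj_transpose B ** diag_mat d))"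
    using CB by (subst trace_mul_sym) (simp add: matrix_mul_assoc)
  also have "\<dots> = (\<Sum>i\<in>UNIV. d i)" using B' by (simp add: trace_def diag_mat_def)
  finally show ?thesis .
qed

text \<open>Both determinants carry the factor \<open>(cmod (det C))^2\<close>, which cancels in the
  difference of logarithms.\<close>

lemma logdet_diff_congruence:
  fixes B C :: "complex^'n^'n"
  assumes "mat 1 + S = C ** conj_transpose C" "mat 1 + T = C ** diag_mat d ** conj_transpose C"
    and d: "\<And>i. d i > 0" and CB: "C ** B = mat 1"
  shows "logdet T - logdet S = (\<Sum>i\<in>UNIV. ln (d i))"
proof -
  have "det C * det B = 1" using CB by (metis det_mul det_I)
  then have "det C \<noteq> 0" by auto
  then have c: "(cmod (det C))\<^sup>2 > 0" by simp
  have p: "(\<Prod>i\<in>UNIV. d i) > 0" using d by (simp add: prod_pos)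
  have cc: "det C * cnj (det C) = of_real ((cmod (det C))\<^sup>2)" by (simp only: complex_norm_square)
  have S: "det (mat 1 + S) = of_real ((cmod (det C))\<^sup>2)"
    by (simp only: assms(1) det_mul det_conj_transpose cc)
  have "det (mat 1 + T) = (det C * cnj (det C)) * of_real (\<Prod>i\<in>UNIV. d i)"
    by (simp only: assms(2) det_mul det_conj_transpose det_diag_mat mult_ac)
  then have T: "det (mat 1 + T) = of_real ((cmod (det C))\<^sup>2 * (\<Prod>i\<in>UNIV. d i))"
    by (simp only: cc of_real_mult)
  have "logdet T - logdet S = ln (\<Prod>i\<in>UNIV. d i)"
    unfolding logdet_def S T Re_complex_of_real using ln_mult_pos[OF c p] by simp
  also have "\<dots> = (\<Sum>i\<in>UNIV. ln (d i))" using d by (intro ln_prod) (auto simp: less_imp_neq[THEN not_sym])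
  finally show ?thesis .
qed

text \<open>Applying \<open>ln x \<le> x - 1\<close> at \<open>sqrt d\<close> instead of
  \<open>d\<close> keeps a square as deficit; this square is the source of strong concavity.\<close>

lemma ln_le_minus_one_sqrt: "ln d \<le> d - 1 - (sqrt d - 1)\<^sup>2" if "d > 0" for d :: real
proof -
  have "ln d = 2 * ln (sqrt d)" using that by (simp add: ln_sqrt)
  also have "\<dots> \<le> 2 * (sqrt d - 1)" using that by (intro mult_left_mono ln_le_minus_one) auto
  also have "\<dots> = d - 1 - (sqrt d - 1)\<^sup>2" using that by (simp add: power2_eq_square algebra_simps)
  finally show ?thesis .
qed

text \<open>In common coordinates the increment is the sum of \<open>ln (d i)\<close> and the
  gradient term is the sum of \<open>d i - 1\<close>. The deficit, the sum of the squares of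
  \<open>sqrt (d i) - 1\<close>, then bounds \<open>norm (T - S)\<close> once the \<open>d i\<close>
  and \<open>norm C\<close> are bounded.\<close>

lemma logdet_gradient:
  fixes S T :: "complex^'n^'n"
  assumes "psd S" "psd T"
  shows "logdet T \<le> logdet S + resolvent S \<bullet> (T - S)"
    and "norm S \<le> b \<Longrightarrow> norm T \<le> b \<Longrightarrow>
      logdet T \<le> logdet S + resolvent S \<bullet> (T - S)
        - (norm (T - S))\<^sup>2 / ((CARD('n) + sqrt CARD('n) * b)\<^sup>2 * (sqrt (CARD('n) + sqrt CARD('n) * b) + 1)\<^sup>2)"
proof -
  obtain B C :: "complex^'n^'n" and d where BC: "C ** B = mat 1" "B ** C = mat 1"
    and S: "mat 1 + S = C ** conj_transpose C"
    and T: "mat 1 + T = C ** diag_mat d ** conj_transpose C" and d: "\<And>i. d i > 0"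
    using simultaneous_diagonalization[OF assms] by metis
  have ld: "logdet T - logdet S = (\<Sum>i\<in>UNIV. ln (d i))"
    by (rule logdet_diff_congruence[OF S T d BC(1)])
  have "T - S = (mat 1 + T) - (mat 1 + S)" by simp
  also have "\<dots> = C ** diag_mat d ** conj_transpose C - C ** diag_mat (\<lambda>i. 1) ** conj_transpose C"
    by (simp only: S T) simp
  also have "\<dots> = C ** (diag_mat d - diag_mat (\<lambda>i. 1)) ** conj_transpose C"
    by (simp only: matrix_diff_ldistrib matrix_diff_rdistrib)
  finally have TS: "T - S = C ** diag_mat (\<lambda>i. d i - 1) ** conj_transpose C"
    by (simp only: diag_mat_diff)
  have grad: "resolvent S \<bullet> (T - S) = (\<Sum>i\<in>UNIV. d i - 1)"
    unfolding TS by (rule inner_resolvent_congruence[OF assms(1) BC S])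
  have main: "logdet T \<le> logdet S + resolvent S \<bullet> (T - S) - (\<Sum>i\<in>UNIV. (sqrt (d i) - 1)\<^sup>2)"
  proof -
    have "(\<Sum>i\<in>UNIV. ln (d i)) \<le> (\<Sum>i\<in>UNIV. d i - 1 - (sqrt (d i) - 1)\<^sup>2)"
      using d by (intro sum_mono ln_le_minus_one_sqrt)
    then show ?thesis using ld grad by (simp add: sum_subtractf)
  qed
  moreover have "0 \<le> (\<Sum>i\<in>UNIV. (sqrt (d i) - 1)\<^sup>2)" by (intro sum_nonneg) simp
  ultimately show "logdet T \<le> logdet S + resolvent S \<bullet> (T - S)" by linarith
  assume b: "norm S \<le> b" "norm T \<le> b"
  \<comment> \<open>This one number bounds every \<open>d i\<close> and also the squared norm of
    \<open>C\<close>; both are at most \<open>sqrt CARD('n)\<close> times the norm of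
    \<open>mat 1 + T\<close> or \<open>mat 1 + S\<close>.\<close>
  define m where "m = CARD('n) + sqrt CARD('n) * b"
  have normI: "norm (mat 1 :: complex^'n^'n) = sqrt CARD('n)"
  proof -
    have "(norm (mat 1 :: complex^'n^'n))\<^sup>2 = CARD('n)"
      by (simp add: power2_norm_eq_inner inner_mat_1_left trace_I)
    then show ?thesis by (metis norm_ge_zero real_sqrt_unique)
  qed
  have mbound: "sqrt CARD('n) * norm (mat 1 + X :: complex^'n^'n) \<le> m" if "norm X \<le> b" for X
  proof -
    have "norm (mat 1 + X) \<le> sqrt CARD('n) + b"
      using norm_triangle_ineq[of "mat 1" X] that normI by simp
    then have "sqrt CARD('n) * norm (mat 1 + X) \<le> sqrt CARD('n) * (sqrt CARD('n) + b)"
      by (intro mult_left_mono) auto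
    then show ?thesis by (simp add: m_def algebra_simps)
  qed
  have dm: "d i \<le> m" for i
  proof -
    have "d i \<le> (\<Sum>i\<in>UNIV. d i)" using d by (intro member_le_sum) (auto intro: less_imp_le)
    also have "\<dots> = resolvent S \<bullet> (mat 1 + T)"
      unfolding T by (rule inner_resolvent_congruence[OF assms(1) BC S, symmetric])
    also have "\<dots> \<le> norm (resolvent S) * norm (mat 1 + T)" by (rule norm_cauchy_schwarz)
    also have "\<dots> \<le> sqrt CARD('n) * norm (mat 1 + T)"
      by (intro mult_right_mono norm_resolvent_le assms) auto
    also have "\<dots> \<le> m" by (rule mbound) fact
    finally show ?thesis .
  qed
  have "m > 0" using dm d by (metis less_le_trans)
  have nC: "(norm C)\<^sup>2 \<le> m"
  proof -
    have "(norm C)\<^sup>2 = Re (trace (C ** conj_transpose C))"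
      unfolding power2_norm_eq_inner inner_matrix_eq_trace by (subst trace_mul_sym) (rule refl)
    also have "\<dots> = mat 1 \<bullet> (mat 1 + S)" by (simp only: S inner_mat_1_left)
    also have "\<dots> \<le> norm (mat 1 :: complex^'n^'n) * norm (mat 1 + S)" by (rule norm_cauchy_schwarz)
    also have "\<dots> \<le> m" using mbound[OF b(1)] by (simp add: normI)
    finally show ?thesis .
  qed
  have "(norm (T - S))\<^sup>2 \<le> m\<^sup>2 * (\<Sum>i\<in>UNIV. (d i - 1)\<^sup>2)"
  proof -
    have "norm (T - S) \<le> norm C * norm (diag_mat (\<lambda>i. d i - 1)) * norm C"
    proof -
      have "norm (T - S) \<le> norm (C ** diag_mat (\<lambda>i. d i - 1)) * norm C"
        unfolding TS using norm_matrix_mult_le[of "C ** diag_mat (\<lambda>i. d i - 1)" "conj_transpose C"] by simp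
      also have "\<dots> \<le> norm C * norm (diag_mat (\<lambda>i. d i - 1)) * norm C"
        by (intro mult_right_mono norm_matrix_mult_le) auto
      finally show ?thesis .
    qed
    also have "\<dots> = (norm C)\<^sup>2 * norm (diag_mat (\<lambda>i. d i - 1))" by (simp add: power2_eq_square)
    also have "\<dots> \<le> m * norm (diag_mat (\<lambda>i. d i - 1))" by (intro mult_right_mono nC) auto
    finally have "(norm (T - S))\<^sup>2 \<le> (m * norm (diag_mat (\<lambda>i. d i - 1)))\<^sup>2"
      by (intro power_mono) auto
    moreover have "(norm (diag_mat (\<lambda>i. d i - 1)))\<^sup>2 = (\<Sum>i\<in>UNIV. (d i - 1)\<^sup>2)"
    proof -
      have "(cmod (diag_mat (\<lambda>i. d i - 1) $ i $ j))\<^sup>2 = (if i = j then (d i - 1)\<^sup>2 else 0)" for i j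
        by (simp add: diag_mat_def norm_of_real del: of_real_diff)
      then show ?thesis by (simp add: norm_matrix_squared)
    qed
    ultimately show ?thesis by (simp add: power_mult_distrib)
  qed
  also have "\<dots> \<le> m\<^sup>2 * ((sqrt m + 1)\<^sup>2 * (\<Sum>i\<in>UNIV. (sqrt (d i) - 1)\<^sup>2))"
  proof -
    have "(d i - 1)\<^sup>2 \<le> (sqrt m + 1)\<^sup>2 * (sqrt (d i) - 1)\<^sup>2" for i
    proof -
      have "d i - 1 = (sqrt (d i) + 1) * (sqrt (d i) - 1)"
        using d[of i] by (simp add: algebra_simps)
      then have "(d i - 1)\<^sup>2 = (sqrt (d i) + 1)\<^sup>2 * (sqrt (d i) - 1)\<^sup>2"
        by (metis power_mult_distrib)
      also have "\<dots> \<le> (sqrt m + 1)\<^sup>2 * (sqrt (d i) - 1)\<^sup>2"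
        using dm[of i] d[of i] by (intro mult_right_mono power_mono) auto
      finally show ?thesis .
    qed
    then show ?thesis by (auto simp: sum_distrib_left intro!: mult_left_mono sum_mono)
  qed
  finally have "(norm (T - S))\<^sup>2 \<le> (m\<^sup>2 * (sqrt m + 1)\<^sup>2) * (\<Sum>i\<in>UNIV. (sqrt (d i) - 1)\<^sup>2)"
    by (simp add: mult_ac)
  moreover have "m\<^sup>2 * (sqrt m + 1)\<^sup>2 > 0" using \<open>m > 0\<close>
    by (intro mult_pos_pos zero_less_power add_nonneg_pos) auto
  ultimately have "(norm (T - S))\<^sup>2 / (m\<^sup>2 * (sqrt m + 1)\<^sup>2) \<le> (\<Sum>i\<in>UNIV. (sqrt (d i) - 1)\<^sup>2)"
    by (simp add: pos_divide_le_eq mult_ac)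
  then show "logdet T \<le> logdet S + resolvent S \<bullet> (T - S)
        - (norm (T - S))\<^sup>2 / ((CARD('n) + sqrt CARD('n) * b)\<^sup>2 * (sqrt (CARD('n) + sqrt CARD('n) * b) + 1)\<^sup>2)"
    using main unfolding m_def by linarith
qed

lemma logdet_strongly_concave:
  "\<exists>c>0. \<forall>S T :: complex^'n^'n. psd S \<longrightarrow> psd T \<longrightarrow> norm S \<le> b \<longrightarrow> norm T \<le> b \<longrightarrow>
      logdet T \<le> logdet S + resolvent S \<bullet> (T - S) - c * (norm (T - S))\<^sup>2"
proof -
  \<comment> \<open>For negative \<open>b\<close> the claim is vacuous; the maximum merely keeps
    \<open>m\<close> positive.\<close>
  let ?b = "max b 0"
  define m where "m = CARD('n) + sqrt CARD('n) * ?b"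
  have "m > 0" unfolding m_def by (intro add_pos_nonneg) auto
  then have "1 / (m\<^sup>2 * (sqrt m + 1)\<^sup>2) > 0"
    by (intro divide_pos_pos mult_pos_pos zero_less_power add_nonneg_pos) auto
  moreover have "logdet T \<le> logdet S + resolvent S \<bullet> (T - S) - 1 / (m\<^sup>2 * (sqrt m + 1)\<^sup>2) * (norm (T - S))\<^sup>2"
    if "psd S" "psd T" "norm S \<le> b" "norm T \<le> b" for S T :: "complex^'n^'n"
    using logdet_gradient(2)[OF that(1,2), of ?b] that(3,4) by (simp add: m_def)
  ultimately show ?thesis by blast
qed

lemma logdet_zero [simp]: "logdet 0 = 0"
  by (simp add: logdet_def)

text \<open>Growth of square-root order, from \<open>ln d \<le> 2 * sqrt d\<close>. Being slower
  than linear, it loses against the affine power term and so bounds the superlevel sets of the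
  ratio.\<close>

lemma logdet_growth:
  fixes S :: "complex^'n^'n"
  assumes "psd S"
  shows "logdet S \<le> 2 * real CARD('n) * sqrt CARD('n) * sqrt (1 + norm S)"
proof -
  obtain B C :: "complex^'n^'n" and d where BC: "C ** B = mat 1" "B ** C = mat 1"
    and C: "mat 1 + 0 = C ** conj_transpose C"
    and S: "mat 1 + S = C ** diag_mat d ** conj_transpose C" and d: "\<And>i. d i > 0"
    using simultaneous_diagonalization[OF psd_zero assms] by metis
  have sum: "(\<Sum>i\<in>UNIV. d i) \<le> CARD('n) * (1 + norm S)"
  proof -
    have "(\<Sum>i\<in>UNIV. d i) = resolvent 0 \<bullet> (mat 1 + S)"
      unfolding S by (rule inner_resolvent_congruence[OF psd_zero BC C, symmetric])
    also have "resolvent 0 = (mat 1 :: complex^'n^'n)"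
      using inverse_mat_1_plus_psd[OF psd_zero] by simp
    also have "mat 1 \<bullet> (mat 1 + S) = CARD('n) + mat 1 \<bullet> S"
      by (simp add: inner_add_right inner_mat_1_left[of "mat 1"] trace_I)
    also have "mat 1 \<bullet> S \<le> real CARD('n) * norm S"
    proof -
      have "norm (mat 1 :: complex^'n^'n) \<le> sqrt CARD('n)"
        using norm_resolvent_le[OF psd_zero] \<open>resolvent 0 = mat 1\<close> by metis
      also have "\<dots> \<le> sqrt ((real CARD('n))\<^sup>2)"
        by (intro real_sqrt_le_mono self_le_power) (auto simp: Suc_leI)
      finally have "norm (mat 1 :: complex^'n^'n) \<le> CARD('n)" by simp
      then show ?thesis
        using norm_cauchy_schwarz[of "mat 1" S] by (meson mult_right_mono norm_ge_zero order_trans)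
    qed
    finally show ?thesis by (simp add: algebra_simps)
  qed
  have "logdet S - logdet (0 :: complex^'n^'n) = (\<Sum>i\<in>UNIV. ln (d i))"
    by (rule logdet_diff_congruence[OF C S d BC(1)])
  also have "\<dots> \<le> (\<Sum>i\<in>(UNIV :: 'n set). 2 * sqrt (CARD('n) * (1 + norm S)))"
  proof (rule sum_mono)
    fix i
    have "ln (d i) = 2 * ln (sqrt (d i))" using d[of i] by (simp add: ln_sqrt)
    also have "\<dots> \<le> 2 * sqrt (d i)" using d[of i] ln_bound[of "sqrt (d i)"] by simp
    also have "d i \<le> (\<Sum>i\<in>UNIV. d i)" using d by (intro member_le_sum) (auto intro: less_imp_le)
    then have "2 * sqrt (d i) \<le> 2 * sqrt (CARD('n) * (1 + norm S))" using sum by simp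
    finally show "ln (d i) \<le> 2 * sqrt (CARD('n) * (1 + norm S))" .
  qed
  finally show ?thesis by (simp add: real_sqrt_mult)
qed

text \<open>The form of the resolvent is nonnegative: with \<open>v = (mat 1 + S) *v w\<close> its
  value at \<open>v\<close> is \<open>w \<bullet> w + w \<bullet> (S *v w)\<close>. Summing over a
  rank-one decomposition of \<open>S\<close> gives the claim.\<close>

lemma inner_resolvent_self_nonneg:
  assumes "psd S"
  shows "0 \<le> resolvent S \<bullet> S"
proof -
  have "0 \<le> resolvent S \<bullet> (outer v)" for v
  proof -
    define w where "w = resolvent S *v v"
    have v: "v = (mat 1 + S) *v w"
      using assms by (simp add: w_def matrix_vector_mul_assoc inverse_mat_1_plus_psd)
    have "resolvent S \<bullet> outer v = v \<bullet> w" by (simp add: inner_commute[of "resolvent S"] inner_outer_left w_def)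
    also have "\<dots> = w \<bullet> w + w \<bullet> (S *v w)"
      by (simp add: v matrix_vector_mult_add_rdistrib inner_add_left inner_add_right inner_commute)
    also have "\<dots> \<ge> 0" using assms by (simp add: psd_iff)
    finally show ?thesis .
  qed
  then have "0 \<le> resolvent S \<bullet> sum_list (map outer vs)" for vs
    by (induction vs) (auto simp: inner_add_right)
  then show ?thesis using psd_eq_sum_outer[OF assms] by metis
qed


subsection \<open>A Hoelder error bound for linear systems over products of semidefinite cones\<close>

text \<open>Only real subspaces \<open>V\<close> matter; they suffice to describe the exposed faces met below and
  avoid complex orthogonality.\<close>

definition face :: "(complex^'n) set \<Rightarrow> (complex^'n^'n) set" where
  "face V = {Q. \<exists>vs. set vs \<subseteq> V \<and> Q = sum_list (map outer vs)}"

lemma face_UNIV: "face UNIV = {Q. psd Q}"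
  by (auto simp: face_def psd_sum_outer elim: psd_eq_sum_outer)

lemma face_subset_psd: "Q \<in> face V \<Longrightarrow> psd Q"
  by (auto simp: face_def psd_sum_outer)

lemma face_mono: "V \<subseteq> W \<Longrightarrow> face V \<subseteq> face W"
  by (auto simp: face_def)

lemma zero_in_face [simp]: "0 \<in> face V"
  unfolding face_def by (auto intro: exI[of _ "[]"])

lemma outer_in_face: "v \<in> V \<Longrightarrow> outer v \<in> face V"
  unfolding face_def by (auto intro!: exI[of _ "[v]"])

lemma face_add:
  assumes "P \<in> face V" "Q \<in> face V"
  shows "P + Q \<in> face V"
proof -
  obtain us vs where "set us \<subseteq> V" "set vs \<subseteq> V"
    "P = sum_list (map outer us)" "Q = sum_list (map outer vs)"
    using assms by (auto simp: face_def)
  then show ?thesis unfolding face_def by (auto intro!: exI[of _ "us @ vs"])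
qed

lemma face_scaleR:
  assumes "subspace V" "Q \<in> face V" "0 \<le> r"
  shows "r *\<^sub>R Q \<in> face V"
proof -
  obtain vs where vs: "set vs \<subseteq> V" "Q = sum_list (map outer vs)"
    using assms by (auto simp: face_def)
  have "r *\<^sub>R sum_list (map outer vs) = sum_list (map outer (map ((*\<^sub>R) (sqrt r)) vs))"
    using assms(3) by (induction vs) (auto simp: outer_scaleR scaleR_add_right)
  moreover have "set (map ((*\<^sub>R) (sqrt r)) vs) \<subseteq> V"
    using vs assms(1) by (auto simp: subspace_scale)
  ultimately show ?thesis using vs unfolding face_def by blast
qed

lemma Cauchy_Schwarz_sum_list:
  fixes f g :: "'a \<Rightarrow> real"
  shows "(\<Sum>x\<leftarrow>xs. f x * g x) \<le> sqrt (\<Sum>x\<leftarrow>xs. (f x)\<^sup>2) * sqrt (\<Sum>x\<leftarrow>xs. (g x)\<^sup>2)"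
proof -
  have "(\<Sum>x\<leftarrow>xs. f x * g x)\<^sup>2 \<le> (\<Sum>x\<leftarrow>xs. (f x)\<^sup>2) * (\<Sum>x\<leftarrow>xs. (g x)\<^sup>2)"
    using Cauchy_Schwarz_ineq_sum[of "\<lambda>i. f (xs ! i)" "\<lambda>i. g (xs ! i)" "{0..<length xs}"]
    by (simp add: sum_list_sum_nth)
  from real_sqrt_le_mono[OF this]
  have "\<bar>\<Sum>x\<leftarrow>xs. f x * g x\<bar> \<le> sqrt (\<Sum>x\<leftarrow>xs. (f x)\<^sup>2) * sqrt (\<Sum>x\<leftarrow>xs. (g x)\<^sup>2)"
    by (simp only: real_sqrt_abs real_sqrt_mult)
  then show ?thesis by linarith
qed

lemma inner_sum_outer: "sum_list (map outer vs) \<bullet> Z = (\<Sum>v\<leftarrow>vs. outer v \<bullet> Z)"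
  by (induction vs) (simp_all add: inner_add_left)

text \<open>Every rank-one vector of \<open>Q\<close> is projected onto the null vectors of
  \<open>Z\<close>, at a squared cost controlled by \<open>outer v \<bullet> Z\<close>.
  Cauchy-Schwarz over the list yields \<open>sqrt (Q \<bullet> Z)\<close>; this square root is what
  halves the Hoelder exponent. Projections shorten vectors, so the trace does not grow.\<close>

lemma facial_projection:
  fixes Z :: "complex^'n^'n"
  assumes V: "subspace V" and nonneg: "\<And>v. v \<in> V \<Longrightarrow> 0 \<le> outer v \<bullet> Z"
  defines "V' \<equiv> {v \<in> V. outer v \<bullet> Z = 0}"
  shows "subspace V'"
    and "\<exists>c\<ge>0. \<forall>Q\<in>face V. \<exists>P\<in>face V'.
      norm (Q - P) \<le> c * sqrt (Q \<bullet> Z) * sqrt (Re (trace Q)) \<and> Re (trace P) \<le> Re (trace Q)"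
    and "Q \<in> face V \<Longrightarrow> 0 \<le> Q \<bullet> Z"
    and "Q \<in> face V \<Longrightarrow> Q \<bullet> Z = 0 \<Longrightarrow> Q \<in> face V'"
    and "Q \<in> face V \<Longrightarrow> Q \<bullet> Z \<noteq> 0 \<Longrightarrow> dim V' < dim V"
proof -
  have q: "outer v \<bullet> Z = v \<bullet> (Z *v v)" for v by (rule inner_outer_left)
  note split = semidefinite_form_split[of "(*v) Z" V, OF matrix_vector_mul_linear V]
  show sV': "subspace V'" unfolding V'_def q by (rule split(1)) (use nonneg q in auto)
  have "\<exists>c>0. \<forall>v\<in>V. \<exists>a\<in>V. a \<bullet> (Z *v a) = 0 \<and> norm a \<le> norm v \<and> c * (norm (v - a))\<^sup>2 \<le> v \<bullet> (Z *v v)"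
    by (rule split(2)) (use nonneg q in auto)
  then obtain c where c: "c > 0" and
    ex: "\<forall>v\<in>V. \<exists>a\<in>V. a \<bullet> (Z *v a) = 0 \<and> norm a \<le> norm v \<and> c * (norm (v - a))\<^sup>2 \<le> v \<bullet> (Z *v v)"
    by blast
  have "\<forall>v\<in>V. \<exists>a. a \<in> V' \<and> norm a \<le> norm v \<and> c * (norm (v - a))\<^sup>2 \<le> outer v \<bullet> Z"
    using ex unfolding V'_def q by blast
  from bchoice[OF this] obtain \<pi> where "\<forall>v\<in>V. \<pi> v \<in> V' \<and> norm (\<pi> v) \<le> norm v \<and>
      c * (norm (v - \<pi> v))\<^sup>2 \<le> outer v \<bullet> Z" by blast
  then have \<pi>: "\<And>v. v \<in> V \<Longrightarrow> \<pi> v \<in> V'" "\<And>v. v \<in> V \<Longrightarrow> norm (\<pi> v) \<le> norm v"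
    "\<And>v. v \<in> V \<Longrightarrow> c * (norm (v - \<pi> v))\<^sup>2 \<le> outer v \<bullet> Z"
    by auto
  show nn: "0 \<le> Q \<bullet> Z" if "Q \<in> face V" for Q
    using that nonneg unfolding face_def by (auto simp: inner_sum_outer subset_iff intro!: sum_list_nonneg)
  show "Q \<in> face V'" if "Q \<in> face V" "Q \<bullet> Z = 0" for Q
  proof -
    obtain vs where vs: "set vs \<subseteq> V" "Q = sum_list (map outer vs)"
      using \<open>Q \<in> face V\<close> by (auto simp: face_def)
    then have "(\<Sum>v\<leftarrow>vs. outer v \<bullet> Z) = 0" using that by (simp add: inner_sum_outer)
    then have "\<forall>v\<in>set vs. outer v \<bullet> Z = 0"
      using sum_list_nonneg_eq_0_iff[of "map (\<lambda>v. outer v \<bullet> Z) vs"] vs(1) nonneg by auto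
    then show ?thesis using vs by (auto simp: face_def V'_def)
  qed
  show "dim V' < dim V" if "Q \<in> face V" "Q \<bullet> Z \<noteq> 0" for Q
  proof -
    obtain vs where vs: "set vs \<subseteq> V" "Q = sum_list (map outer vs)"
      using \<open>Q \<in> face V\<close> by (auto simp: face_def)
    have "\<exists>v\<in>set vs. outer v \<bullet> Z \<noteq> 0"
    proof (rule ccontr)
      assume "\<not> ?thesis"
      then have "(\<Sum>v\<leftarrow>vs. outer v \<bullet> Z) = 0" by (induction vs) auto
      then show False using that vs by (simp add: inner_sum_outer)
    qed
    then have "V' \<subset> V" using vs(1) by (auto simp: V'_def)
    then show ?thesis using dim_psubset[of V' V] span_eq_iff[THEN iffD2, OF sV'] span_eq_iff[THEN iffD2, OF V]
      by simp
  qed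
  show "\<exists>c\<ge>0. \<forall>Q\<in>face V. \<exists>P\<in>face V'.
      norm (Q - P) \<le> c * sqrt (Q \<bullet> Z) * sqrt (Re (trace Q)) \<and> Re (trace P) \<le> Re (trace Q)"
  proof (intro exI[of _ "2 / sqrt c"] conjI ballI)
    show "0 \<le> 2 / sqrt c" using c by simp
    fix Q assume "Q \<in> face V"
    then obtain vs where vs: "set vs \<subseteq> V" "Q = sum_list (map outer vs)"
      by (auto simp: face_def)
    define P where "P = sum_list (map outer (map \<pi> vs))"
    have "set (map \<pi> vs) \<subseteq> V'" using vs \<pi>(1) by auto
    then have "P \<in> face V'" unfolding face_def P_def by (intro CollectI exI[of _ "map \<pi> vs"]) simp
    have trQ: "Re (trace Q) = (\<Sum>v\<leftarrow>vs. (norm v)\<^sup>2)" by (simp add: vs trace_sum_outer)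
    have "norm (Q - P) \<le> (\<Sum>v\<leftarrow>vs. (2 * norm v) * norm (v - \<pi> v))"
      using vs(1) unfolding vs(2) P_def
    proof (induction vs)
      case (Cons v vs)
      have "norm (outer v - outer (\<pi> v)) \<le> (norm v + norm (\<pi> v)) * norm (v - \<pi> v)"
        by (rule norm_outer_diff)
      also have "\<dots> \<le> (2 * norm v) * norm (v - \<pi> v)"
        using Cons.prems \<pi>(2)[of v] by (intro mult_right_mono) auto
      finally have "norm (outer v - outer (\<pi> v)) \<le> (2 * norm v) * norm (v - \<pi> v)" .
      then show ?case
        using Cons norm_diff_triangle_ineq[of "outer v" "sum_list (map outer vs)" "outer (\<pi> v)"
            "sum_list (map outer (map \<pi> vs))"] by simp
    qed simp
    also have "\<dots> \<le> sqrt (\<Sum>v\<leftarrow>vs. (2 * norm v)\<^sup>2) * sqrt (\<Sum>v\<leftarrow>vs. (norm (v - \<pi> v))\<^sup>2)"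
      by (rule Cauchy_Schwarz_sum_list)
    also have "(\<Sum>v\<leftarrow>vs. (2 * norm v)\<^sup>2) = 4 * Re (trace Q)"
      by (simp add: trQ power_mult_distrib sum_list_const_mult)
    also have "sqrt (4 * Re (trace Q)) = 2 * sqrt (Re (trace Q))" by (simp add: real_sqrt_mult)
    also have "sqrt (\<Sum>v\<leftarrow>vs. (norm (v - \<pi> v))\<^sup>2) \<le> sqrt (Q \<bullet> Z) / sqrt c"
    proof -
      have "c * (\<Sum>v\<leftarrow>vs. (norm (v - \<pi> v))\<^sup>2) \<le> (\<Sum>v\<leftarrow>vs. outer v \<bullet> Z)"
        unfolding sum_list_const_mult[symmetric] using vs(1) \<pi>(3) by (intro sum_list_mono) auto
      also have "\<dots> = Q \<bullet> Z" by (simp add: vs(2) inner_sum_outer)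
      finally have "(\<Sum>v\<leftarrow>vs. (norm (v - \<pi> v))\<^sup>2) \<le> (Q \<bullet> Z) / c"
        using c by (simp add: pos_le_divide_eq mult_ac)
      then show ?thesis by (simp add: real_sqrt_divide[symmetric])
    qed
    then have "2 * sqrt (Re (trace Q)) * sqrt (\<Sum>v\<leftarrow>vs. (norm (v - \<pi> v))\<^sup>2)
        \<le> 2 * sqrt (Re (trace Q)) * (sqrt (Q \<bullet> Z) / sqrt c)"
      by (intro mult_left_mono) (auto simp: trQ intro!: sum_list_nonneg)
    finally have "norm (Q - P) \<le> 2 / sqrt c * sqrt (Q \<bullet> Z) * sqrt (Re (trace Q))"
      by (simp add: mult_ac)
    moreover have "Re (trace P) \<le> Re (trace Q)"
    proof -
      have "Re (trace P) = (\<Sum>v\<leftarrow>vs. (norm (\<pi> v))\<^sup>2)"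
        unfolding P_def trace_sum_outer by (simp add: comp_def)
      also have "\<dots> \<le> Re (trace Q)"
        unfolding trQ using vs(1) \<pi>(2) by (intro sum_list_mono power_mono) auto
      finally show ?thesis .
    qed
    ultimately show "\<exists>P\<in>face V'. norm (Q - P) \<le> 2 / sqrt c * sqrt (Q \<bullet> Z) * sqrt (Re (trace Q)) \<and>
        Re (trace P) \<le> Re (trace Q)"
      using \<open>P \<in> face V'\<close> by blast
  qed
qed

lemma trace_psd_nonneg: "psd Q \<Longrightarrow> 0 \<le> Re (trace Q)"
  using psd_norm_le_trace norm_ge_zero order_trans by blast

text \<open>The Slater case. The segment from the image of \<open>x\<close> through \<open>b\<close>
  can be prolonged by \<open>\<rho>\<close> inside the image cone, to a point \<open>u\<close> with
  preimage \<open>w\<close>. The convex combination of \<open>x\<close> and \<open>w\<close> lying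
  over \<open>b\<close> is near \<open>x\<close>, because its weight at \<open>w\<close> is at most
  the residual divided by \<open>\<rho>\<close>. The functional \<open>e\<close> reads the trace off
  the image, which bounds \<open>w\<close>.\<close>

lemma regular_error_bound:
  fixes T :: "nat \<Rightarrow> complex^'n^'n \<Rightarrow> 'b::euclidean_space"
  assumes T: "\<And>i. i < K \<Longrightarrow> linear (T i)" and e: "\<And>i Q. i < K \<Longrightarrow> e \<bullet> T i Q = Re (trace Q)"
    and V: "\<And>i. i < K \<Longrightarrow> subspace (V i)"
    and ri: "b \<in> rel_interior {\<Sum>i<K. T i (x i) | x. \<forall>i<K. x i \<in> face (V i)}"
  shows "\<exists>c\<ge>0. \<forall>x. (\<forall>i<K. x i \<in> face (V i)) \<longrightarrow> (\<Sum>i<K. Re (trace (x i))) \<le> B \<longrightarrow>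
    (\<exists>y. (\<forall>i<K. y i \<in> face (V i)) \<and> (\<Sum>i<K. T i (y i)) = b \<and>
      (\<Sum>i<K. norm (y i - x i)) \<le> c * norm ((\<Sum>i<K. T i (x i)) - b))"
proof -
  let ?M = "{\<Sum>i<K. T i (x i) | x. \<forall>i<K. x i \<in> face (V i)}"
  obtain \<rho> where \<rho>: "\<rho> > 0" "cball b \<rho> \<inter> affine hull ?M \<subseteq> ?M" and bM: "b \<in> ?M"
    using ri by (auto simp: mem_rel_interior_cball)
  have tr: "(\<Sum>i<K. Re (trace (x i))) = e \<bullet> (\<Sum>i<K. T i (x i))" for x
    by (simp add: inner_sum_right e)
  \<comment> \<open>The numerator bounds the total trace of \<open>w\<close>, which is
    \<open>e \<bullet> u\<close>, plus that of \<open>x\<close>.\<close>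
  define c where "c = (norm e * (norm b + \<rho>) + \<bar>B\<bar>) / \<rho>"
  show ?thesis
  proof (intro exI[of _ c] conjI allI impI)
    show "c \<ge> 0" using \<rho> by (simp add: c_def)
    fix x assume x: "\<forall>i<K. x i \<in> face (V i)" and B: "(\<Sum>i<K. Re (trace (x i))) \<le> B"
    define r where "r = b - (\<Sum>i<K. T i (x i))"
    show "\<exists>y. (\<forall>i<K. y i \<in> face (V i)) \<and> (\<Sum>i<K. T i (y i)) = b \<and>
      (\<Sum>i<K. norm (y i - x i)) \<le> c * norm ((\<Sum>i<K. T i (x i)) - b)"
    proof (cases "r = 0")
      case True
      then show ?thesis using x by (intro exI[of _ x]) (auto simp: r_def)
    next
      case False
      define s where "s = \<rho> / norm r"
      have s: "s > 0" using False \<rho> by (simp add: s_def)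
      define u where "u = b + s *\<^sub>R r"
      have "(1 + s) *\<^sub>R b + (- s) *\<^sub>R (\<Sum>i<K. T i (x i)) \<in> affine hull ?M"
        using bM x by (intro mem_affine[OF affine_affine_hull] hull_inc) auto
      also have "(1 + s) *\<^sub>R b + (- s) *\<^sub>R (\<Sum>i<K. T i (x i)) = u"
        by (simp add: u_def r_def algebra_simps)
      finally have "u \<in> affine hull ?M" .
      moreover have "u \<in> cball b \<rho>" using False \<rho> by (simp add: u_def s_def dist_norm)
      ultimately obtain w where w: "\<forall>i<K. w i \<in> face (V i)" "u = (\<Sum>i<K. T i (w i))"
        using \<rho>(2) by blast
      \<comment> \<open>Chosen so that the residual \<open>- r\<close> at \<open>x\<close> cancels
        the overshoot \<open>s *\<^sub>R r\<close> at \<open>w\<close>, that is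
        \<open>1 - t = t * s\<close>.\<close>
      define t where "t = 1 / (1 + s)"
      have t: "0 \<le> t" "t \<le> 1" "1 - t = t * s" using s by (auto simp: t_def field_simps)
      define y where "y i = (1 - t) *\<^sub>R x i + t *\<^sub>R w i" for i
      have "y i \<in> face (V i)" if "i < K" for i
        unfolding y_def using t x w(1) V that by (intro face_add face_scaleR) auto
      moreover have "(\<Sum>i<K. T i (y i)) = b"
      proof -
        have "T i (y i) = (1 - t) *\<^sub>R T i (x i) + t *\<^sub>R T i (w i)" if "i < K" for i
          unfolding y_def using T[OF that] by (simp add: linear_add linear_scale)
        then have "(\<Sum>i<K. T i (y i)) = (1 - t) *\<^sub>R (\<Sum>i<K. T i (x i)) + t *\<^sub>R u"
          by (simp add: sum.distrib scaleR_sum_right w(2))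
        also have "\<dots> = (1 - t) *\<^sub>R (b - r) + t *\<^sub>R b + (t * s) *\<^sub>R r"
          by (simp add: u_def r_def scaleR_add_right)
        also have "\<dots> = b" unfolding t(3)[symmetric] by (simp add: algebra_simps)
        finally show ?thesis .
      qed
      moreover have "(\<Sum>i<K. norm (y i - x i)) \<le> c * norm ((\<Sum>i<K. T i (x i)) - b)"
      proof -
        have "norm (y i - x i) \<le> t * (Re (trace (w i)) + Re (trace (x i)))" if "i < K" for i
        proof -
          have "y i - x i = t *\<^sub>R (w i - x i)" by (simp add: y_def algebra_simps)
          then have "norm (y i - x i) = t * norm (w i - x i)" using t by simp
          also have "norm (w i - x i) \<le> norm (w i) + norm (x i)" by (rule norm_triangle_ineq4)
          also have "norm (w i) + norm (x i) \<le> Re (trace (w i)) + Re (trace (x i))"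
            using w(1) x that by (intro add_mono psd_norm_le_trace face_subset_psd) auto
          finally show ?thesis using t by (simp add: mult_left_mono)
        qed
        then have "(\<Sum>i<K. norm (y i - x i)) \<le> (\<Sum>i<K. t * (Re (trace (w i)) + Re (trace (x i))))"
          by (intro sum_mono) auto
        also have "\<dots> = t * (e \<bullet> u + (\<Sum>i<K. Re (trace (x i))))"
          by (simp add: sum_distrib_left[symmetric] sum.distrib tr[of w] w(2))
        also have "\<dots> \<le> t * (norm e * (norm b + \<rho>) + \<bar>B\<bar>)"
        proof -
          have "norm u \<le> norm b + \<rho>" using norm_triangle_ineq[of b "s *\<^sub>R r"] False \<rho> s
            by (simp add: u_def s_def)
          then have "norm e * norm u \<le> norm e * (norm b + \<rho>)" by (intro mult_left_mono) auto
          then have "e \<bullet> u \<le> norm e * (norm b + \<rho>)" using norm_cauchy_schwarz[of e u] by linarith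
          then show ?thesis using B t by (intro mult_left_mono) auto
        qed
        also have "\<dots> = t * \<rho> * c" using \<rho> by (simp add: c_def)
        also have "t * \<rho> \<le> norm r"
        proof -
          have "t * s \<le> 1" using t by linarith
          then show ?thesis using False by (simp add: s_def pos_divide_le_eq)
        qed
        then have "t * \<rho> * c \<le> norm r * c" using \<open>c \<ge> 0\<close> by (rule mult_right_mono)
        finally show ?thesis by (simp add: r_def norm_minus_commute mult_ac)
      qed
      ultimately show ?thesis by blast
    qed
  qed
qed

text \<open>Facial reduction by induction on the total dimension. If \<open>b\<close> lies on the
  relative boundary of the image cone, a supporting functional vanishes on every solution and
  confines it to smaller faces. An approximate solution is projected there at a cost of order the
  square root of its residual, and the induction hypothesis applies to the projection.\<close>

lemma hoelder_error_bound_faces: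
  fixes T :: "nat \<Rightarrow> complex^'n^'n \<Rightarrow> 'b::euclidean_space"
  assumes T: "\<And>i. i < K \<Longrightarrow> linear (T i)" and e: "\<And>i Q. i < K \<Longrightarrow> e \<bullet> T i Q = Re (trace Q)"
    and "\<And>i. i < K \<Longrightarrow> subspace (V i)" "\<And>i. i < K \<Longrightarrow> xs i \<in> face (V i)"
    and b: "b = (\<Sum>i<K. T i (xs i))"
  shows "\<exists>p c. 0 < p \<and> p \<le> 1 \<and> 0 \<le> c \<and> (\<forall>x. (\<forall>i<K. x i \<in> face (V i)) \<longrightarrow> (\<Sum>i<K. Re (trace (x i))) \<le> B \<longrightarrow>
    (\<exists>y. (\<forall>i<K. y i \<in> face (V i)) \<and> (\<Sum>i<K. T i (y i)) = b \<and>
      (\<Sum>i<K. norm (y i - x i)) \<le> c * norm ((\<Sum>i<K. T i (x i)) - b) powr p))"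
  using assms(3,4)
proof (induction "\<Sum>i<K. dim (V i)" arbitrary: V rule: less_induct)
  case less
  note V = less.prems(1) and xs = less.prems(2)
  let ?M = "{\<Sum>i<K. T i (x i) | x. \<forall>i<K. x i \<in> face (V i)}"
  have bM: "b \<in> ?M" using xs b by blast
  have addM: "u + v \<in> ?M" if "u \<in> ?M" "v \<in> ?M" for u v
  proof -
    obtain x where x: "\<forall>i<K. x i \<in> face (V i)" "u = (\<Sum>i<K. T i (x i))"
      using \<open>u \<in> ?M\<close> by blast
    obtain y where y: "\<forall>i<K. y i \<in> face (V i)" "v = (\<Sum>i<K. T i (y i))"
      using \<open>v \<in> ?M\<close> by blast
    from x y have "\<forall>i<K. x i + y i \<in> face (V i)" "u + v = (\<Sum>i<K. T i (x i + y i))"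
      using T by (auto simp: face_add linear_add sum.distrib[symmetric] intro!: sum.cong)
    then show ?thesis by (intro CollectI exI[of _ "\<lambda>i. x i + y i"]) auto
  qed
  have scaleM: "r *\<^sub>R u \<in> ?M" if "u \<in> ?M" "0 \<le> r" for u r
  proof -
    obtain x where "\<forall>i<K. x i \<in> face (V i)" "u = (\<Sum>i<K. T i (x i))"
      using \<open>u \<in> ?M\<close> by blast
    then have "\<forall>i<K. r *\<^sub>R x i \<in> face (V i)" "r *\<^sub>R u = (\<Sum>i<K. T i (r *\<^sub>R x i))"
      using T V that by (auto simp: face_scaleR linear_scale scaleR_sum_right intro!: sum.cong)
    then show ?thesis by (intro CollectI exI[of _ "\<lambda>i. r *\<^sub>R x i"]) auto
  qed
  have convM: "convex ?M" by (intro convexI addM scaleM) auto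
  show ?case
  proof (cases "b \<in> rel_interior ?M")
    case True
    obtain c where "c \<ge> 0" "\<forall>x. (\<forall>i<K. x i \<in> face (V i)) \<longrightarrow> (\<Sum>i<K. Re (trace (x i))) \<le> B \<longrightarrow>
      (\<exists>y. (\<forall>i<K. y i \<in> face (V i)) \<and> (\<Sum>i<K. T i (y i)) = b \<and>
        (\<Sum>i<K. norm (y i - x i)) \<le> c * norm ((\<Sum>i<K. T i (x i)) - b))"
      using regular_error_bound[OF T e V True, of B] by blast
    then show ?thesis by (intro exI[of _ 1] exI[of _ c]) simp
  next
    case False
    obtain z where z: "\<And>y. y \<in> ?M \<Longrightarrow> z \<bullet> b \<le> z \<bullet> y" "\<And>y. y \<in> rel_interior ?M \<Longrightarrow> z \<bullet> b < z \<bullet> y"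
      by (rule supporting_hyperplane_rel_boundary[OF convM bM False]) blast
    \<comment> \<open>The image is a cone: comparing \<open>b\<close> with \<open>0\<close> and with
      its double forces the supporting value to be zero.\<close>
    have "0 *\<^sub>R b \<in> ?M" "2 *\<^sub>R b \<in> ?M" by (intro scaleM bM; simp)+
    from this[THEN z(1)] have zb: "z \<bullet> b = 0" by simp
    \<comment> \<open>The supporting functional pulled back to block \<open>i\<close>. It is
      nonnegative on the rank-one matrices of the current face.\<close>
    define Z where "Z i = adjoint (T i) z" for i
    have Z: "Q \<bullet> Z i = z \<bullet> T i Q" if "i < K" for i Q
      unfolding Z_def using adjoint_works[OF T[OF that]] by (simp add: inner_commute)
    have Zsum: "z \<bullet> (\<Sum>i<K. T i (x i)) = (\<Sum>i<K. x i \<bullet> Z i)" for x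
      by (simp add: inner_sum_right Z)
    have nonneg: "0 \<le> outer v \<bullet> Z i" if "i < K" "v \<in> V i" for i v
    proof -
      define x where "x j = (if j = i then outer v else 0)" for j
      have "(\<Sum>j<K. T j (x j)) \<in> ?M" using that by (auto simp: x_def outer_in_face)
      then have "0 \<le> z \<bullet> (\<Sum>j<K. T j (x j))" using z(1) zb by auto
      also have "\<dots> = (\<Sum>j<K. if j = i then outer v \<bullet> Z i else 0)"
        unfolding Zsum by (intro sum.cong) (auto simp: x_def)
      also have "\<dots> = outer v \<bullet> Z i" using that by simp
      finally show ?thesis .
    qed
    define V' where "V' i = {v \<in> V i. outer v \<bullet> Z i = 0}" for i
    have fp: "subspace (V' i)" "\<exists>c\<ge>0. \<forall>Q\<in>face (V i). \<exists>P\<in>face (V' i).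
        norm (Q - P) \<le> c * sqrt (Q \<bullet> Z i) * sqrt (Re (trace Q)) \<and> Re (trace P) \<le> Re (trace Q)"
      "\<And>Q. Q \<in> face (V i) \<Longrightarrow> 0 \<le> Q \<bullet> Z i"
      "\<And>Q. Q \<in> face (V i) \<Longrightarrow> Q \<bullet> Z i = 0 \<Longrightarrow> Q \<in> face (V' i)"
      "\<And>Q. Q \<in> face (V i) \<Longrightarrow> Q \<bullet> Z i \<noteq> 0 \<Longrightarrow> dim (V' i) < dim (V i)" if "i < K" for i
      using facial_projection[of "V i" "Z i", OF V[OF that] nonneg[OF that]] unfolding V'_def by blast+
    have sub: "V' i \<subseteq> V i" for i by (auto simp: V'_def)
    \<comment> \<open>The supporting functional is strictly positive on the relative interior of the
      image, so it does not vanish on all blocks and at least one dimension drops.\<close>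
    have less': "(\<Sum>i<K. dim (V' i)) < (\<Sum>i<K. dim (V i))"
    proof -
      obtain u where "u \<in> rel_interior ?M" using rel_interior_eq_empty[OF convM] bM by blast
      moreover then have "u \<in> ?M" using rel_interior_subset by blast
      ultimately obtain x where x: "\<forall>i<K. x i \<in> face (V i)" "0 < z \<bullet> (\<Sum>i<K. T i (x i))"
        using z(2) zb by auto
      have "\<exists>i<K. x i \<bullet> Z i \<noteq> 0"
      proof (rule ccontr)
        assume "\<not> ?thesis"
        then have "(\<Sum>i<K. x i \<bullet> Z i) = 0" by simp
        then show False using x(2) unfolding Zsum by simp
      qed
      then obtain i where i: "i < K" "x i \<bullet> Z i \<noteq> 0" by blast
      then have "dim (V' i) < dim (V i)" using fp(5)[OF i(1) _ i(2)] x(1) by blast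
      then have "\<exists>i\<in>{..<K}. dim (V' i) < dim (V i)" using i(1) by blast
      then show ?thesis using sub by (intro sum_strict_mono_ex1) (auto intro: dim_subset)
    qed
    have xs': "xs i \<in> face (V' i)" if "i < K" for i
    proof (rule fp(4)[OF that xs[OF that]])
      have "(\<Sum>i<K. xs i \<bullet> Z i) = 0" using zb Zsum b by simp
      then show "xs i \<bullet> Z i = 0"
        using fp(3) xs that by (subst (asm) sum_nonneg_eq_0_iff) auto
    qed
    have "\<exists>p c. 0 < p \<and> p \<le> 1 \<and> 0 \<le> c \<and> (\<forall>x. (\<forall>i<K. x i \<in> face (V' i)) \<longrightarrow> (\<Sum>i<K. Re (trace (x i))) \<le> B \<longrightarrow>
      (\<exists>y. (\<forall>i<K. y i \<in> face (V' i)) \<and> (\<Sum>i<K. T i (y i)) = b \<and>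
        (\<Sum>i<K. norm (y i - x i)) \<le> c * norm ((\<Sum>i<K. T i (x i)) - b) powr p))"
      by (rule less.hyps[OF less' fp(1) xs'])
    then obtain p c where p: "0 < p" "p \<le> 1" "0 \<le> c" and IH: "\<forall>x. (\<forall>i<K. x i \<in> face (V' i)) \<longrightarrow> (\<Sum>i<K. Re (trace (x i))) \<le> B \<longrightarrow>
      (\<exists>y. (\<forall>i<K. y i \<in> face (V' i)) \<and> (\<Sum>i<K. T i (y i)) = b \<and>
        (\<Sum>i<K. norm (y i - x i)) \<le> c * norm ((\<Sum>i<K. T i (x i)) - b) powr p)"
      by (elim exE conjE) (rule that)
    define G where "G i C \<longleftrightarrow> 0 \<le> C \<and> (\<forall>Q\<in>face (V i). \<exists>P\<in>face (V' i).
        norm (Q - P) \<le> C * sqrt (Q \<bullet> Z i) * sqrt (Re (trace Q)) \<and> Re (trace P) \<le> Re (trace Q))" for i C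
    have "\<exists>C. G i C" if "i < K" for i using fp(2)[OF that] unfolding G_def .
    then obtain C where "\<And>i. i < K \<Longrightarrow> G i (C i)" by metis
    then have C: "\<And>i. i < K \<Longrightarrow> C i \<ge> 0" "\<And>i Q. i < K \<Longrightarrow> Q \<in> face (V i) \<Longrightarrow> \<exists>P\<in>face (V' i).
        norm (Q - P) \<le> C i * sqrt (Q \<bullet> Z i) * sqrt (Re (trace Q)) \<and> Re (trace P) \<le> Re (trace Q)"
      unfolding G_def by blast+
    have bl: "bounded_linear (T i)" if "i < K" for i
      using T[OF that] by (simp add: linear_conv_bounded_linear)
    define Lm where "Lm = (\<Sum>i<K. onorm (T i))"
    have Lm: "norm (T i Q) \<le> Lm * norm Q" if "i < K" for i Q
    proof -
      have "onorm (T i) \<le> Lm" unfolding Lm_def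
        by (rule member_le_sum) (use that bl onorm_pos_le in auto)
      then have "onorm (T i) * norm Q \<le> Lm * norm Q" by (rule mult_right_mono) simp
      then show ?thesis using onorm[OF bl[OF that], of Q] by linarith
    qed
    have Lm0: "Lm \<ge> 0" unfolding Lm_def by (rule sum_nonneg) (use bl onorm_pos_le in auto)
    \<comment> \<open>With \<open>r\<close> the residual of \<open>x\<close>:
      \<open>Cm * sqrt r\<close> bounds the move onto the smaller faces, \<open>R\<close> bounds
      \<open>r\<close> itself, and \<open>D * sqrt r\<close> bounds the residual after the
      move.\<close>
    define Cm where "Cm = (\<Sum>i<K. C i) * sqrt (norm z) * sqrt \<bar>B\<bar>"
    have Cm0: "Cm \<ge> 0" using C(1) by (auto simp: Cm_def intro!: mult_nonneg_nonneg sum_nonneg)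
    define R where "R = norm b + Lm * \<bar>B\<bar>"
    have R0: "R \<ge> 0" using Lm0 by (simp add: R_def)
    define D where "D = sqrt R + Lm * Cm"
    have D0: "D \<ge> 0" using Lm0 Cm0 R0 by (simp add: D_def)
    \<comment> \<open>The first term comes from the induction hypothesis, the second from the
      projection after writing \<open>sqrt r = r powr ((1 - p) / 2) * r powr (p / 2)\<close> and
      using \<open>r \<le> R\<close>.\<close>
    define c2 where "c2 = c * D powr p + Cm * R powr ((1 - p) / 2)"
    show ?thesis
    proof (rule exI[of _ "p / 2"], rule exI[of _ c2], intro conjI allI impI)
      show "0 < p / 2" "p / 2 \<le> 1" using p by auto
      show "0 \<le> c2" using p Cm0 by (simp add: c2_def)
      fix x assume x: "\<forall>i<K. x i \<in> face (V i)" and B: "(\<Sum>i<K. Re (trace (x i))) \<le> B"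
      have tr0: "0 \<le> Re (trace (x i))" if "i < K" for i
        using x that by (auto intro: trace_psd_nonneg face_subset_psd)
      have trB: "Re (trace (x i)) \<le> \<bar>B\<bar>" if "i < K" for i
        using member_le_sum[of i "{..<K}" "\<lambda>i. Re (trace (x i))"] tr0 that B by auto
      define r where "r = norm ((\<Sum>i<K. T i (x i)) - b)"
      have r0: "r \<ge> 0" by (simp add: r_def)
      have normx: "(\<Sum>i<K. norm (x i)) \<le> \<bar>B\<bar>"
      proof -
        have "(\<Sum>i<K. norm (x i)) \<le> (\<Sum>i<K. Re (trace (x i)))"
          using x by (intro sum_mono psd_norm_le_trace face_subset_psd) auto
        then show ?thesis using B by linarith
      qed
      have normT: "norm (\<Sum>i<K. T i (y i)) \<le> Lm * (\<Sum>i<K. norm (y i))" for y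
        unfolding sum_distrib_left by (intro order_trans[OF norm_sum] sum_mono Lm) auto
      have rR: "r \<le> R"
      proof -
        have "r \<le> norm (\<Sum>i<K. T i (x i)) + norm b" unfolding r_def by (rule norm_triangle_ineq4)
        also have "norm (\<Sum>i<K. T i (x i)) \<le> Lm * \<bar>B\<bar>"
          using normT[of x] mult_left_mono[OF normx Lm0] by linarith
        finally show ?thesis by (simp add: R_def)
      qed
      have Zr: "x i \<bullet> Z i \<le> norm z * r" if "i < K" for i
      proof -
        have "x i \<bullet> Z i \<le> (\<Sum>i<K. x i \<bullet> Z i)"
          using fp(3) x that by (intro member_le_sum) auto
        also have "\<dots> = z \<bullet> ((\<Sum>i<K. T i (x i)) - b)" using zb by (simp add: Zsum inner_diff_right)
        also have "\<dots> \<le> norm z * r" unfolding r_def by (rule norm_cauchy_schwarz)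
        finally show ?thesis .
      qed
      have "\<forall>i. \<exists>P. i < K \<longrightarrow> P \<in> face (V' i) \<and>
          norm (x i - P) \<le> C i * sqrt (x i \<bullet> Z i) * sqrt (Re (trace (x i))) \<and> Re (trace P) \<le> Re (trace (x i))"
        using C(2) x by blast
      from choice[OF this] obtain x' where x': "\<And>i. i < K \<Longrightarrow> x' i \<in> face (V' i)"
          "\<And>i. i < K \<Longrightarrow> norm (x i - x' i) \<le> C i * sqrt (x i \<bullet> Z i) * sqrt (Re (trace (x i)))"
          "\<And>i. i < K \<Longrightarrow> Re (trace (x' i)) \<le> Re (trace (x i))"
        by blast
      have dx: "(\<Sum>i<K. norm (x i - x' i)) \<le> Cm * sqrt r"
      proof -
        have "norm (x i - x' i) \<le> C i * (sqrt (norm z * r) * sqrt \<bar>B\<bar>)" if "i < K" for i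
        proof -
          have "sqrt (x i \<bullet> Z i) * sqrt (Re (trace (x i))) \<le> sqrt (norm z * r) * sqrt \<bar>B\<bar>"
            using Zr[OF that] trB[OF that] tr0[OF that] fp(3)[OF that] x that r0
            by (intro mult_mono real_sqrt_le_mono) auto
          from order_trans[OF x'(2)[OF that, unfolded mult.assoc] mult_left_mono[OF this C(1)[OF that]]]
          show ?thesis .
        qed
        then have "(\<Sum>i<K. norm (x i - x' i)) \<le> (\<Sum>i<K. C i * (sqrt (norm z * r) * sqrt \<bar>B\<bar>))"
          by (intro sum_mono) auto
        also have "\<dots> = Cm * sqrt r"
          by (simp add: Cm_def sum_distrib_right[symmetric] real_sqrt_mult mult_ac)
        finally show ?thesis .
      qed
      have trx': "(\<Sum>i<K. Re (trace (x' i))) \<le> B"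
        using x'(3) B by (meson lessThan_iff order_trans sum_mono)
      obtain y where y: "\<forall>i<K. y i \<in> face (V' i)" "(\<Sum>i<K. T i (y i)) = b"
        "(\<Sum>i<K. norm (y i - x' i)) \<le> c * norm ((\<Sum>i<K. T i (x' i)) - b) powr p"
        using IH[THEN spec, THEN mp, THEN mp, of x', OF _ trx'] x'(1) by blast
      have r': "norm ((\<Sum>i<K. T i (x' i)) - b) \<le> D * sqrt r"
      proof -
        have "(\<Sum>i<K. T i (x' i)) - b = ((\<Sum>i<K. T i (x i)) - b) - (\<Sum>i<K. T i (x i - x' i))"
          using T by (simp add: linear_diff sum_subtractf)
        then have "norm ((\<Sum>i<K. T i (x' i)) - b) \<le> r + norm (\<Sum>i<K. T i (x i - x' i))"
          unfolding r_def by (metis norm_triangle_ineq4)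
        moreover have "norm (\<Sum>i<K. T i (x i - x' i)) \<le> Lm * (Cm * sqrt r)"
          using normT[of "\<lambda>i. x i - x' i"] mult_left_mono[OF dx Lm0] by linarith
        moreover have "sqrt r * sqrt r \<le> sqrt R * sqrt r"
          using rR r0 by (intro mult_right_mono) auto
        then have "r \<le> sqrt R * sqrt r" using r0 by simp
        ultimately show ?thesis by (simp add: D_def algebra_simps)
      qed
      have half: "sqrt r powr p = r powr (p / 2)"
        using r0 by (simp add: powr_half_sqrt[symmetric] powr_powr)
      have "(\<Sum>i<K. norm (y i - x i)) \<le> (\<Sum>i<K. norm (y i - x' i) + norm (x i - x' i))"
      proof (rule sum_mono)
        fix i
        have "y i - x i = (y i - x' i) - (x i - x' i)" by simp
        then show "norm (y i - x i) \<le> norm (y i - x' i) + norm (x i - x' i)"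
          by (metis norm_triangle_ineq4)
      qed
      also have "\<dots> \<le> c * norm ((\<Sum>i<K. T i (x' i)) - b) powr p + Cm * sqrt r"
        using y(3) dx by (simp add: sum.distrib)
      also have "\<dots> \<le> c * (D powr p * r powr (p / 2)) + Cm * (R powr ((1 - p) / 2) * r powr (p / 2))"
      proof (intro add_mono mult_left_mono p Cm0)
        have "norm ((\<Sum>i<K. T i (x' i)) - b) powr p \<le> (D * sqrt r) powr p"
          using r' p by (intro powr_mono2) auto
        then show "norm ((\<Sum>i<K. T i (x' i)) - b) powr p \<le> D powr p * r powr (p / 2)"
          using D0 r0 half by (simp add: powr_mult)
        have "sqrt r = r powr ((1 - p) / 2 + p / 2)"
          using r0 by (simp add: powr_half_sqrt[symmetric] add_divide_distrib[symmetric])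
        also have "\<dots> = r powr ((1 - p) / 2) * r powr (p / 2)" by (rule powr_add)
        also have "\<dots> \<le> R powr ((1 - p) / 2) * r powr (p / 2)"
          using rR r0 p by (intro mult_right_mono powr_mono2) auto
        finally show "sqrt r \<le> R powr ((1 - p) / 2) * r powr (p / 2)" .
      qed
      finally have "(\<Sum>i<K. norm (y i - x i)) \<le> c2 * r powr (p / 2)"
        by (simp add: c2_def algebra_simps)
      moreover have "\<forall>i<K. y i \<in> face (V i)" using y(1) face_mono[OF sub] by blast
      ultimately show "\<exists>y. (\<forall>i<K. y i \<in> face (V i)) \<and> (\<Sum>i<K. T i (y i)) = b \<and>
          (\<Sum>i<K. norm (y i - x i)) \<le> c2 * norm ((\<Sum>i<K. T i (x i)) - b) powr (p / 2)"
        using y(2) unfolding r_def by blast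
    qed
  qed
qed

text \<open>The trace is appended to the linear map as an extra coordinate. This prescribes the
  total power and at the same time supplies the functional \<open>e\<close> demanded by the error
  bound on faces.\<close>

lemma hoelder_error_bound_psd:
  fixes A :: "nat \<Rightarrow> complex^'n^'n \<Rightarrow> 'b::euclidean_space"
  assumes A: "\<And>i. i < K \<Longrightarrow> linear (A i)" and xs: "\<And>i. i < K \<Longrightarrow> psd (xs i)"
  shows "\<exists>p c. 0 < p \<and> p \<le> 1 \<and> 0 \<le> c \<and> (\<forall>x. (\<forall>i<K. psd (x i)) \<longrightarrow> (\<Sum>i<K. Re (trace (x i))) \<le> B \<longrightarrow>
    (\<exists>y. (\<forall>i<K. psd (y i)) \<and> (\<Sum>i<K. A i (y i)) = (\<Sum>i<K. A i (xs i)) \<and>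
      (\<Sum>i<K. Re (trace (y i))) = (\<Sum>i<K. Re (trace (xs i))) \<and>
      (\<Sum>i<K. norm (y i - x i)) \<le> c * (norm ((\<Sum>i<K. A i (x i)) - (\<Sum>i<K. A i (xs i)))
        + \<bar>(\<Sum>i<K. Re (trace (x i))) - (\<Sum>i<K. Re (trace (xs i)))\<bar>) powr p))"
proof -
  define T where "T i Q = (A i Q, Re (trace Q))" for i Q
  have T: "linear (T i)" if "i < K" for i
    using A[OF that] linear_Re_trace by (auto simp: linear_iff T_def)
  have e: "(0, 1) \<bullet> T i Q = Re (trace Q)" for i Q by (simp add: T_def inner_Pair_0)
  have sT: "(\<Sum>i<K. T i (x i)) = (\<Sum>i<K. A i (x i), \<Sum>i<K. Re (trace (x i)))" for x
    by (simp add: T_def sum_prod)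
  obtain p c where p: "0 < p" "p \<le> 1" "0 \<le> c" and eb: "\<And>x. \<forall>i<K. psd (x i) \<Longrightarrow> (\<Sum>i<K. Re (trace (x i))) \<le> B \<Longrightarrow>
    \<exists>y. (\<forall>i<K. psd (y i)) \<and> (\<Sum>i<K. T i (y i)) = (\<Sum>i<K. T i (xs i)) \<and>
      (\<Sum>i<K. norm (y i - x i)) \<le> c * norm ((\<Sum>i<K. T i (x i)) - (\<Sum>i<K. T i (xs i))) powr p"
    using hoelder_error_bound_faces[of K T "(0, 1)" "\<lambda>i. UNIV" xs, OF T e _ _ refl, of B] xs
    by (auto simp: face_UNIV)
  show ?thesis
  proof (rule exI[of _ p], rule exI[of _ c], intro conjI allI impI p)
    fix x :: "nat \<Rightarrow> complex^'n^'n" assume "\<forall>i<K. psd (x i)" "(\<Sum>i<K. Re (trace (x i))) \<le> B"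
    from eb[OF this] obtain y where y: "\<forall>i<K. psd (y i)" "(\<Sum>i<K. T i (y i)) = (\<Sum>i<K. T i (xs i))"
      "(\<Sum>i<K. norm (y i - x i)) \<le> c * norm ((\<Sum>i<K. T i (x i)) - (\<Sum>i<K. T i (xs i))) powr p" by blast
    have "norm ((\<Sum>i<K. T i (x i)) - (\<Sum>i<K. T i (xs i)))
      \<le> norm ((\<Sum>i<K. A i (x i)) - (\<Sum>i<K. A i (xs i))) + \<bar>(\<Sum>i<K. Re (trace (x i))) - (\<Sum>i<K. Re (trace (xs i)))\<bar>"
      unfolding sT diff_Pair by (rule order_trans[OF norm_Pair_le]) simp
    then have "c * norm ((\<Sum>i<K. T i (x i)) - (\<Sum>i<K. T i (xs i))) powr p
      \<le> c * (norm ((\<Sum>i<K. A i (x i)) - (\<Sum>i<K. A i (xs i))) + \<bar>(\<Sum>i<K. Re (trace (x i))) - (\<Sum>i<K. Re (trace (xs i)))\<bar>) powr p"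
      using p by (intro mult_left_mono powr_mono2) auto
    then show "\<exists>y. (\<forall>i<K. psd (y i)) \<and> (\<Sum>i<K. A i (y i)) = (\<Sum>i<K. A i (xs i)) \<and>
      (\<Sum>i<K. Re (trace (y i))) = (\<Sum>i<K. Re (trace (xs i))) \<and>
      (\<Sum>i<K. norm (y i - x i)) \<le> c * (norm ((\<Sum>i<K. A i (x i)) - (\<Sum>i<K. A i (xs i)))
        + \<bar>(\<Sum>i<K. Re (trace (x i))) - (\<Sum>i<K. Re (trace (xs i)))\<bar>) powr p"
      using y unfolding sT by (intro exI[of _ y]) auto
  qed
qed


subsection \<open>Block-coordinate ascent for a concave-over-affine ratio\<close>

text \<open>The tangent inequality of the concave function \<open>x powr p\<close> at
  \<open>a\<close>, multiplied by \<open>a powr (1 - p)\<close>; it follows from Young's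
  inequality.\<close>

lemma bernoulli_powr:
  fixes a b p :: real
  assumes "0 < a" "0 \<le> b" "0 < p" "p < 1"
  shows "p * (a - b) \<le> a powr (1 - p) * (a powr p - b powr p)"
proof (cases "b = 0")
  case True
  have "a powr (1 - p) * a powr p = a" using assms by (simp add: powr_add[symmetric])
  then show ?thesis using True assms by (simp add: mult_left_le_one_le)
next
  case False
  have "a powr (1 - p) * b powr p \<le> (1 - p) * a + p * b"
    using Youngs_inequality_0[of "1 - p" p a b] assms False by simp
  moreover have "a powr (1 - p) * a powr p = a" using assms by (simp add: powr_add[symmetric])
  ultimately show ?thesis by (simp add: algebra_simps)
qed

text \<open>The finite-length argument for descent methods with a Kurdyka-Lojasiewicz inequality:
  \<open>e\<close> is the optimality gap and \<open>d\<close> the step length.\<close>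

lemma kl_finite_length:
  fixes d e :: "nat \<Rightarrow> real"
  assumes d: "\<And>k. 0 \<le> d k" and e: "\<And>k. 0 \<le> e k"
    and c: "0 < c" and p: "0 < p" "p < 1" and C: "0 \<le> C"
    and dec: "\<And>k. c * (d k)\<^sup>2 \<le> e k - e (Suc k)"
    and kl: "\<And>k. e (Suc k) \<le> C * d k * e (Suc k) powr p"
  shows "summable d" "e \<longlonglongrightarrow> 0"
proof -
  define M where "M = C / (p * c)"
  have M: "M \<ge> 0" using p c C by (simp add: M_def)
  define \<phi> where "\<phi> k = e k powr p" for k
  have mono: "e (Suc k) \<le> e k" for k using dec[of k] c by (smt (verit) mult_nonneg_nonneg zero_le_power2)
  have \<phi>: "0 \<le> \<phi> k" "\<phi> (Suc k) \<le> \<phi> k" for k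
    using mono e p by (auto simp: \<phi>_def intro: powr_mono2)
  \<comment> \<open>Decrease, tangent inequality and \<open>kl\<close> together bound the squared
    step by the product of the preceding step and a telescoping difference; the arithmetic-geometric
    mean inequality then separates the two factors.\<close>
  have step: "d (Suc k) \<le> (d k + M * (\<phi> (Suc k) - \<phi> (Suc (Suc k)))) / 2" for k
  proof (cases "e (Suc k) = 0")
    case True
    then have "c * (d (Suc k))\<^sup>2 \<le> 0" using dec[of "Suc k"] e[of "Suc (Suc k)"] by simp
    then have "d (Suc k) = 0" using c by (simp add: mult_le_0_iff)
    then show ?thesis using d[of k] M \<phi>(2)[of "Suc k"] by simp
  next
    case False
    then have pos: "e (Suc k) > 0" using e[of "Suc k"] by simp
    have "e (Suc k) powr (1 - p) * e (Suc k) powr p \<le> C * d k * e (Suc k) powr p"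
      using kl[of k] pos by (simp add: powr_add[symmetric])
    then have k1: "e (Suc k) powr (1 - p) \<le> C * d k" using pos by simp
    have "p * (c * (d (Suc k))\<^sup>2) \<le> p * (e (Suc k) - e (Suc (Suc k)))"
      using dec[of "Suc k"] p by (intro mult_left_mono) auto
    also have "\<dots> \<le> e (Suc k) powr (1 - p) * (\<phi> (Suc k) - \<phi> (Suc (Suc k)))"
      unfolding \<phi>_def by (rule bernoulli_powr[OF pos e p])
    also have "\<dots> \<le> C * d k * (\<phi> (Suc k) - \<phi> (Suc (Suc k)))"
      using k1 \<phi>(2) by (intro mult_right_mono) auto
    finally have "(d (Suc k))\<^sup>2 \<le> d k * (M * (\<phi> (Suc k) - \<phi> (Suc (Suc k))))"
      using p c by (simp add: M_def field_simps)
    also have "\<dots> \<le> ((d k + M * (\<phi> (Suc k) - \<phi> (Suc (Suc k)))) / 2)\<^sup>2"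
      using zero_le_power2[of "d k - M * (\<phi> (Suc k) - \<phi> (Suc (Suc k)))"]
      by (simp add: power2_eq_square algebra_simps)
    finally show ?thesis
      by (rule power2_le_imp_le) (use d[of k] M \<phi>(2)[of "Suc k"] in simp)
  qed
  \<comment> \<open>The factor one half lets the sum of steps on the right be absorbed by the one on
    the left; the rest telescopes.\<close>
  have bound: "(\<Sum>k<n. d k) \<le> 2 * d 0 + M * \<phi> 1" for n
  proof -
    have "(\<Sum>k<n. d k) \<le> (\<Sum>k<Suc n. d k)" using d by simp
    also have "\<dots> = d 0 + (\<Sum>k<n. d (Suc k))" by (rule sum.lessThan_Suc_shift)
    also have "(\<Sum>k<n. d (Suc k)) \<le> (\<Sum>k<n. (d k + M * (\<phi> (Suc k) - \<phi> (Suc (Suc k)))) / 2)"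
      by (intro sum_mono step)
    also have "\<dots> = ((\<Sum>k<n. d k) + M * (\<Sum>k<n. \<phi> (Suc k) - \<phi> (Suc (Suc k)))) / 2"
      by (simp add: sum_divide_distrib[symmetric] sum.distrib sum_distrib_left)
    also have "(\<Sum>k<n. \<phi> (Suc k) - \<phi> (Suc (Suc k))) = \<phi> 1 - \<phi> (Suc n)"
      using sum_lessThan_telescope'[of "\<lambda>k. \<phi> (Suc k)" n] by simp
    finally have "(\<Sum>k<n. d k) \<le> 2 * d 0 + M * (\<phi> 1 - \<phi> (Suc n))"
      by (simp add: field_simps)
    also have "\<dots> \<le> 2 * d 0 + M * \<phi> 1" using M \<phi>(1) by (intro add_left_mono mult_left_mono) auto
    finally show ?thesis .
  qed
  show sm: "summable d" by (rule summableI_nonneg_bounded[OF d bound])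
  have "e (Suc k) \<le> C * d k * e 0 powr p" for k
  proof -
    have "e k \<le> e 0" for k by (induction k) (auto intro: order_trans[OF mono])
    then have "C * d k * e (Suc k) powr p \<le> C * d k * e 0 powr p"
      using C d e p by (intro mult_left_mono powr_mono2) auto
    then show ?thesis using kl[of k] by linarith
  qed
  moreover have "(\<lambda>k. C * d k * e 0 powr p) \<longlonglongrightarrow> C * 0 * e 0 powr p"
    by (intro tendsto_intros summable_LIMSEQ_zero[OF sm])
  ultimately have "(\<lambda>k. e (Suc k)) \<longlonglongrightarrow> 0"
    using e by (intro tendsto_sandwich[OF _ _ tendsto_const, of 0 "\<lambda>k. e (Suc k)" sequentially]) auto
  then show "e \<longlonglongrightarrow> 0" by (simp add: filterlim_sequentially_Suc)
qed

text \<open>The families are functions on \<open>nat\<close>, not points of a Euclidean space, so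
  the subsequence is refined one index at a time.\<close>

lemma bounded_family_convergent_subsequence:
  fixes X :: "nat \<Rightarrow> nat \<Rightarrow> 'a::euclidean_space"
  assumes "\<And>n i. i < K \<Longrightarrow> norm (X n i) \<le> B"
  shows "\<exists>r l. strict_mono r \<and> (\<forall>i<K. (\<lambda>n. X (r n) i) \<longlonglongrightarrow> l i)"
  using assms
proof (induction K)
  case 0
  show ?case by (intro exI[of _ id]) (auto simp: strict_mono_def)
next
  case (Suc K)
  then obtain r l where r: "strict_mono r" "\<And>i. i < K \<Longrightarrow> (\<lambda>n. X (r n) i) \<longlonglongrightarrow> l i"
    by (metis less_SucI)
  have "bounded (range (\<lambda>n. X (r n) K))" using Suc.prems by (auto simp: bounded_iff)
  then obtain m s where s: "strict_mono s" "((\<lambda>n. X (r n) K) \<circ> s) \<longlonglongrightarrow> m"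
    using bounded_imp_convergent_subsequence by blast
  have "(\<lambda>n. X ((r \<circ> s) n) i) \<longlonglongrightarrow> (l(K := m)) i" if "i < Suc K" for i
  proof (cases "i = K")
    case True
    then show ?thesis using s(2) by (simp add: comp_def)
  next
    case False
    then show ?thesis using LIMSEQ_subseq_LIMSEQ[OF r(2) s(1), of i] that by (simp add: comp_def)
  qed
  then show ?case using strict_mono_o[OF r(1) s(1)] by blast
qed

text \<open>The convergence argument without matrices. \<open>C\<close> is the cone of one user's
  covariances, \<open>E\<close> that of the aggregates, \<open>D\<close> the gradient of
  \<open>f\<close>, \<open>tr\<close> the transmit power, and \<open>V i\<close> the blocks that
  waste no power. A single constant \<open>L\<close> serves as gradient bound, Lipschitz constant
  and growth constant.\<close>

locale concave_ratio =
  fixes K :: nat and A :: "nat \<Rightarrow> 'a::euclidean_space \<Rightarrow> 'b::euclidean_space"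
    and C :: "'a set" and E :: "'b set" and tr :: "'a \<Rightarrow> real"
    and f :: "'b \<Rightarrow> real" and D :: "'b \<Rightarrow> 'b" and L a P0 :: real and V :: "nat \<Rightarrow> 'a set"
  assumes K: "K \<ge> 1"
    and linear_A: "\<And>i. i < K \<Longrightarrow> linear (A i)" and linear_tr: "linear tr"
    and closed_C: "closed C" and zero_C: "0 \<in> C"
    and add_C: "\<And>x y. x \<in> C \<Longrightarrow> y \<in> C \<Longrightarrow> x + y \<in> C"
    and scale_C: "\<And>x r. x \<in> C \<Longrightarrow> 0 \<le> r \<Longrightarrow> r *\<^sub>R x \<in> C"
    and norm_le_tr: "\<And>x. x \<in> C \<Longrightarrow> norm x \<le> tr x"
    and zero_E: "0 \<in> E" and add_E: "\<And>s t. s \<in> E \<Longrightarrow> t \<in> E \<Longrightarrow> s + t \<in> E"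
    and A_E: "\<And>i x. i < K \<Longrightarrow> x \<in> C \<Longrightarrow> A i x \<in> E"
    and pointed_E: "\<And>s t. s \<in> E \<Longrightarrow> t \<in> E \<Longrightarrow> s + t = 0 \<Longrightarrow> s = 0"
    and f_zero: "f 0 = 0"
    and f_concave: "\<And>s t. s \<in> E \<Longrightarrow> t \<in> E \<Longrightarrow> f t \<le> f s + D s \<bullet> (t - s)"
    and f_strongly_concave: "\<And>b. \<exists>c>0. \<forall>s\<in>E. \<forall>t\<in>E. norm s \<le> b \<longrightarrow> norm t \<le> b \<longrightarrow>
      f t \<le> f s + D s \<bullet> (t - s) - c * (norm (t - s))\<^sup>2"
    and L: "0 \<le> L" and D_bounded: "\<And>s. s \<in> E \<Longrightarrow> norm (D s) \<le> L"
    and D_lipschitz: "\<And>s t. s \<in> E \<Longrightarrow> t \<in> E \<Longrightarrow> norm (D s - D t) \<le> L * norm (s - t)"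
    and f_growth: "\<And>s. s \<in> E \<Longrightarrow> f s \<le> L * sqrt (1 + norm s)"
    and D_nonneg: "\<And>s. s \<in> E \<Longrightarrow> 0 \<le> D s \<bullet> s"
    and A_nonzero: "\<And>i. i < K \<Longrightarrow> \<exists>x\<in>C. A i x \<noteq> 0"
    and a: "0 < a" and P0: "0 < P0"
    and subspace_V: "\<And>i. i < K \<Longrightarrow> subspace (V i)"
    and A_inj_V: "\<And>i x. i < K \<Longrightarrow> x \<in> V i \<Longrightarrow> A i x = 0 \<Longrightarrow> x = 0"
    and wasteful: "\<And>i x. i < K \<Longrightarrow> x \<in> C \<Longrightarrow> x \<notin> V i \<Longrightarrow> \<exists>y\<in>C. A i y = A i x \<and> tr y < tr x"
    and error_bound: "\<And>B z. \<forall>i<K. z i \<in> C \<Longrightarrow> \<exists>p c. 0 < p \<and> p \<le> 1 \<and> 0 \<le> c \<and>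
      (\<forall>x. (\<forall>i<K. x i \<in> C) \<longrightarrow> (\<Sum>i<K. tr (x i)) \<le> B \<longrightarrow>
        (\<exists>y. (\<forall>i<K. y i \<in> C) \<and> (\<Sum>i<K. A i (y i)) = (\<Sum>i<K. A i (z i)) \<and>
          (\<Sum>i<K. tr (y i)) = (\<Sum>i<K. tr (z i)) \<and>
          (\<Sum>i<K. norm (y i - x i)) \<le> c * (norm ((\<Sum>i<K. A i (x i)) - (\<Sum>i<K. A i (z i)))
            + \<bar>(\<Sum>i<K. tr (x i)) - (\<Sum>i<K. tr (z i))\<bar>) powr p))"
begin

definition S :: "(nat \<Rightarrow> 'a) \<Rightarrow> 'b" where "S x = (\<Sum>i<K. A i (x i))"
definition t :: "(nat \<Rightarrow> 'a) \<Rightarrow> real" where "t x = (\<Sum>i<K. tr (x i))"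
definition P :: "(nat \<Rightarrow> 'a) \<Rightarrow> real" where "P x = a * t x + P0"
definition G :: "(nat \<Rightarrow> 'a) \<Rightarrow> real" where "G x = f (S x) / P x"
definition F :: "(nat \<Rightarrow> 'a) set" where "F = {x. \<forall>i<K. x i \<in> C}"
definition dst :: "(nat \<Rightarrow> 'a) \<Rightarrow> (nat \<Rightarrow> 'a) \<Rightarrow> real" where "dst x y = (\<Sum>i<K. norm (x i - y i))"
definition block_opt :: "nat \<Rightarrow> (nat \<Rightarrow> 'a) \<Rightarrow> bool" where
  "block_opt i x \<longleftrightarrow> (\<forall>Y\<in>C. G (x(i := Y)) \<le> G x)"
definition LA :: real where "LA = (\<Sum>i<K. onorm (A i))"
definition Lt :: real where "Lt = onorm tr"
text \<open>From \<open>f (S x) \<le> L + L * LA * t x\<close>: the constant part is compared with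
  \<open>P0\<close>, the linear part with \<open>a * t x\<close>.\<close>

definition Gmax :: real where "Gmax = L / P0 + L * LA / a"
definition LG :: real where "LG = (L * LA + Gmax * a * Lt) / P0"

section \<open>Elementary bounds and Lipschitz continuity of the ratio\<close>

lemma bounded_linear_A: "i < K \<Longrightarrow> bounded_linear (A i)"
  using linear_A by (simp add: linear_conv_bounded_linear)

lemma LA_nonneg: "0 \<le> LA"
  unfolding LA_def by (rule sum_nonneg) (use bounded_linear_A onorm_pos_le in auto)

lemma norm_A_le: "i < K \<Longrightarrow> norm (A i x) \<le> LA * norm x"
proof -
  assume i: "i < K"
  have "onorm (A i) \<le> LA" unfolding LA_def
    by (rule member_le_sum) (use i bounded_linear_A onorm_pos_le in auto)
  then have "onorm (A i) * norm x \<le> LA * norm x" by (rule mult_right_mono) simp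
  then show ?thesis using onorm[OF bounded_linear_A[OF i], of x] by linarith
qed

lemma Lt_nonneg: "0 \<le> Lt"
  using linear_tr onorm_pos_le by (simp add: Lt_def linear_conv_bounded_linear)

lemma tr_le: "\<bar>tr x\<bar> \<le> Lt * norm x"
  using onorm[of tr x] linear_tr by (simp add: Lt_def linear_conv_bounded_linear)

lemma Gmax_nonneg: "0 \<le> Gmax"
  using L P0 a LA_nonneg by (simp add: Gmax_def)

lemma LG_nonneg: "0 \<le> LG"
  using L P0 a LA_nonneg Gmax_nonneg Lt_nonneg by (simp add: LG_def)

lemma tr_nonneg: "x \<in> C \<Longrightarrow> 0 \<le> tr x"
  using norm_le_tr norm_ge_zero order_trans by blast

lemma t_nonneg: "x \<in> F \<Longrightarrow> 0 \<le> t x"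
  by (auto simp: t_def F_def intro!: sum_nonneg tr_nonneg)

lemma P_ge: "x \<in> F \<Longrightarrow> P0 \<le> P x"
  using a t_nonneg by (simp add: P_def)

lemma P_pos: "x \<in> F \<Longrightarrow> 0 < P x"
  using P_ge P0 by fastforce

lemma S_in_E: "x \<in> F \<Longrightarrow> S x \<in> E"
proof -
  assume "x \<in> F"
  have "(\<Sum>i<n. A i (x i)) \<in> E" if "n \<le> K" for n
    using that
  proof (induction n)
    case (Suc n)
    then have "A n (x n) \<in> E" using \<open>x \<in> F\<close> by (intro A_E) (auto simp: F_def)
    then show ?case using Suc by (simp add: add_E)
  qed (simp add: zero_E)
  then show ?thesis by (simp add: S_def)
qed

lemma S_diff: "S x - S y = (\<Sum>i<K. A i (x i - y i))"
  by (simp add: S_def sum_subtractf[symmetric] linear_diff[OF linear_A])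

lemma t_diff: "t x - t y = (\<Sum>i<K. tr (x i - y i))"
  by (simp add: t_def sum_subtractf[symmetric] linear_diff[OF linear_tr])

lemma dst_nonneg: "0 \<le> dst x y"
  by (simp add: dst_def sum_nonneg)

lemma norm_S_diff_le: "norm (S x - S y) \<le> LA * dst x y"
  unfolding S_diff dst_def sum_distrib_left
  by (intro order_trans[OF norm_sum] sum_mono norm_A_le) auto

lemma t_diff_le: "\<bar>t x - t y\<bar> \<le> Lt * dst x y"
  unfolding t_diff dst_def sum_distrib_left
  by (intro order_trans[OF sum_abs] sum_mono tr_le)

lemma norm_S_le: "x \<in> F \<Longrightarrow> norm (S x) \<le> LA * t x"
proof -
  assume x: "x \<in> F"
  have "norm (S x) \<le> (\<Sum>i<K. LA * norm (x i))"
    unfolding S_def by (intro order_trans[OF norm_sum] sum_mono norm_A_le) auto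
  also have "\<dots> \<le> (\<Sum>i<K. LA * tr (x i))"
    using x LA_nonneg by (intro sum_mono mult_left_mono norm_le_tr) (auto simp: F_def)
  finally show ?thesis by (simp add: t_def sum_distrib_left)
qed

lemma norm_S_bound: "x \<in> F \<Longrightarrow> t x \<le> b \<Longrightarrow> norm (S x) \<le> LA * b"
  using norm_S_le mult_left_mono[OF _ LA_nonneg] order_trans by meson

lemma f_nonneg: "s \<in> E \<Longrightarrow> 0 \<le> f s"
  using f_concave[of s 0] D_nonneg[of s] zero_E f_zero by simp

text \<open>Strong concavity between \<open>s\<close> and \<open>0\<close>, where
  \<open>D_nonneg\<close> gives the linear term a favourable sign.\<close>

lemma f_pos: "s \<in> E \<Longrightarrow> s \<noteq> 0 \<Longrightarrow> 0 < f s"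
proof -
  assume s: "s \<in> E" "s \<noteq> 0"
  obtain c where c: "c > 0" "f 0 \<le> f s + D s \<bullet> (0 - s) - c * (norm (0 - s))\<^sup>2"
    using f_strongly_concave[of "norm s"] s zero_E by fastforce
  then have "c * (norm s)\<^sup>2 \<le> f s" using D_nonneg[OF s(1)] f_zero by simp
  moreover have "c * (norm s)\<^sup>2 > 0" using c s by simp
  ultimately show ?thesis by linarith
qed

lemma f_lipschitz: "s \<in> E \<Longrightarrow> u \<in> E \<Longrightarrow> f s - f u \<le> L * norm (s - u)"
proof -
  assume "s \<in> E" "u \<in> E"
  then have "f s - f u \<le> D u \<bullet> (s - u)" using f_concave[of u s] by simp
  also have "\<dots> \<le> norm (D u) * norm (s - u)" by (rule norm_cauchy_schwarz)
  also have "\<dots> \<le> L * norm (s - u)" using \<open>u \<in> E\<close> by (intro mult_right_mono D_bounded) auto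
  finally show ?thesis .
qed

lemma f_eq: "x \<in> F \<Longrightarrow> f (S x) = G x * P x"
  using P_pos[of x] by (simp add: G_def)

lemma G_nonneg: "x \<in> F \<Longrightarrow> 0 \<le> G x"
  using f_nonneg S_in_E P_pos[of x] by (simp add: G_def)

lemma G_pos: "x \<in> F \<Longrightarrow> S x \<noteq> 0 \<Longrightarrow> 0 < G x"
  using f_pos S_in_E P_pos[of x] by (simp add: G_def)

lemma G_le_Gmax: "x \<in> F \<Longrightarrow> G x \<le> Gmax"
proof -
  assume x: "x \<in> F"
  have "f (S x) \<le> L * sqrt (1 + norm (S x))" using f_growth S_in_E x by simp
  also have "\<dots> \<le> L * (1 + norm (S x))"
    using L by (intro mult_left_mono real_le_lsqrt) (auto simp: power2_eq_square algebra_simps)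
  also have "\<dots> \<le> L * (1 + LA * t x)" using L norm_S_le[OF x] by (intro mult_left_mono) auto
  also have "\<dots> \<le> Gmax * P x"
  proof -
    have "Gmax * P x = L + L * LA * t x + L * a * t x / P0 + L * LA * P0 / a"
      using a P0 by (simp add: Gmax_def P_def field_simps)
    moreover have "0 \<le> L * a * t x / P0" "0 \<le> L * LA * P0 / a"
      using a P0 L LA_nonneg t_nonneg[OF x] by auto
    ultimately show ?thesis by (simp add: algebra_simps)
  qed
  finally show ?thesis using P_pos[OF x] by (simp add: G_def pos_divide_le_eq)
qed

text \<open>After multiplication by \<open>P x\<close> the difference splits into the variation of
  \<open>f\<close> and \<open>G y\<close> times the variation of \<open>P\<close>, both Lipschitz;
  dividing by \<open>P x \<ge> P0\<close> gives \<open>LG\<close>.\<close>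

lemma G_diff_le: "x \<in> F \<Longrightarrow> y \<in> F \<Longrightarrow> G x - G y \<le> LG * dst x y"
proof -
  assume x: "x \<in> F" and y: "y \<in> F"
  have "(G x - G y) * P x = (f (S x) - f (S y)) - G y * (P x - P y)"
    by (simp add: f_eq x y algebra_simps)
  also have "\<dots> \<le> L * (LA * dst x y) + Gmax * (a * (Lt * dst x y))"
  proof -
    have "f (S x) - f (S y) \<le> L * norm (S x - S y)" using x y by (intro f_lipschitz S_in_E)
    also have "\<dots> \<le> L * (LA * dst x y)" using L norm_S_diff_le by (intro mult_left_mono)
    finally have 1: "f (S x) - f (S y) \<le> L * (LA * dst x y)" .
    have "- (P x - P y) = a * (t y - t x)" by (simp add: P_def algebra_simps)
    also have "\<dots> \<le> a * \<bar>t x - t y\<bar>" using a by (intro mult_left_mono) auto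
    also have "\<dots> \<le> a * (Lt * dst x y)" using a t_diff_le by (intro mult_left_mono) auto
    finally have "G y * (- (P x - P y)) \<le> G y * (a * (Lt * dst x y))"
      using G_nonneg[OF y] by (rule mult_left_mono)
    also have "\<dots> \<le> Gmax * (a * (Lt * dst x y))"
      using G_le_Gmax[OF y] a Lt_nonneg dst_nonneg by (intro mult_right_mono) auto
    finally show ?thesis using 1 unfolding mult_minus_right by linarith
  qed
  also have "\<dots> = LG * dst x y * P0" using P0 by (simp add: LG_def field_simps)
  also have "\<dots> \<le> LG * dst x y * P x"
    using LG_nonneg dst_nonneg P_ge[OF x] by (intro mult_left_mono) auto
  finally show ?thesis using P_pos[OF x] by simp
qed

lemma dst_commute: "dst x y = dst y x"
  by (simp add: dst_def norm_minus_commute)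

lemma abs_G_diff_le: "x \<in> F \<Longrightarrow> y \<in> F \<Longrightarrow> \<bar>G x - G y\<bar> \<le> LG * dst x y"
  using G_diff_le[of x y] G_diff_le[of y x] by (simp add: dst_commute)

lemma S_cong: "(\<And>i. i < K \<Longrightarrow> x i = y i) \<Longrightarrow> S x = S y"
  and t_cong: "(\<And>i. i < K \<Longrightarrow> x i = y i) \<Longrightarrow> t x = t y"
  by (simp_all add: S_def t_def)

lemma G_cong: "(\<And>i. i < K \<Longrightarrow> x i = y i) \<Longrightarrow> G x = G y"
  unfolding G_def P_def using S_cong[of x y] t_cong[of x y] by simp

lemma F_upd: "x \<in> F \<Longrightarrow> Y \<in> C \<Longrightarrow> x(i := Y) \<in> F"
  by (simp add: F_def)

lemma sum_upd_diff: "i < K \<Longrightarrow> (\<Sum>j<K. h j ((x(i := Y)) j)) - (\<Sum>j<K. h j (x j)) = h i Y - (h i (x i) :: 'c::ab_group_add)"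
  by (simp add: sum.remove[of "{..<K}" i])

lemma S_upd: "i < K \<Longrightarrow> S (x(i := Y)) = S x + A i (Y - x i)"
  using sum_upd_diff[of i A x Y] by (simp add: S_def linear_diff[OF linear_A] algebra_simps)

lemma t_upd: "i < K \<Longrightarrow> t (x(i := Y)) = t x + tr (Y - x i)"
  using sum_upd_diff[of i "\<lambda>_. tr" x Y] by (simp add: t_def linear_diff[OF linear_tr] algebra_simps)

lemma P_upd: "i < K \<Longrightarrow> P (x(i := Y)) = P x + a * tr (Y - x i)"
  by (simp add: P_def t_upd algebra_simps)

section \<open>Existence of block maximizers and of global maximizers\<close>

text \<open>The numerator grows at most like \<open>sqrt (t x)\<close>, the denominator linearly, so
  a positive ratio caps the power.\<close>

lemma superlevel_bounded:
  assumes "0 < \<gamma>"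
  shows "\<exists>B. \<forall>x\<in>F. \<gamma> \<le> G x \<longrightarrow> t x \<le> B"
proof (intro exI ballI impI)
  fix x assume x: "x \<in> F" and \<gamma>: "\<gamma> \<le> G x"
  \<comment> \<open>For \<open>t x > 1\<close> the bound follows by squaring
    \<open>\<gamma> * a * t x \<le> L * sqrt ((1 + LA) * t x)\<close>.\<close>
  show "t x \<le> max 1 (L\<^sup>2 * (1 + LA) / (\<gamma> * a)\<^sup>2)"
  proof (cases "t x \<le> 1")
    case False
    have "\<gamma> * a * t x \<le> \<gamma> * P x" using assms P0 by (simp add: P_def algebra_simps)
    also have "\<dots> \<le> f (S x)" using \<gamma> P_pos[OF x] by (simp add: f_eq[OF x] mult_right_mono)
    also have "\<dots> \<le> L * sqrt (1 + norm (S x))" using f_growth S_in_E x by simp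
    also have "\<dots> \<le> L * sqrt ((1 + LA) * t x)"
      using L norm_S_le[OF x] False by (intro mult_left_mono real_sqrt_le_mono) (auto simp: algebra_simps)
    finally have "(\<gamma> * a * t x)\<^sup>2 \<le> (L * sqrt ((1 + LA) * t x))\<^sup>2"
      using assms a False by (intro power_mono) auto
    also have "\<dots> = L\<^sup>2 * ((1 + LA) * t x)"
      using LA_nonneg False by (simp add: power_mult_distrib)
    finally have "(\<gamma> * a)\<^sup>2 * t x * t x \<le> L\<^sup>2 * (1 + LA) * t x"
      by (simp add: power2_eq_square mult_ac)
    then have "(\<gamma> * a)\<^sup>2 * t x \<le> L\<^sup>2 * (1 + LA)" using False by simp
    then have "t x \<le> L\<^sup>2 * (1 + LA) / (\<gamma> * a)\<^sup>2"
      using assms a by (simp add: pos_le_divide_eq mult_ac)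
    then show ?thesis by simp
  qed simp
qed

text \<open>A nonzero channel contributes some nonzero element of \<open>E\<close>, and pointedness
  prevents the other users from cancelling it. Hence any block maximization, even from zero, reaches
  a positive value.\<close>

lemma ex_upd_G_pos:
  assumes x: "x \<in> F" and i: "i < K"
  shows "\<exists>Y\<in>C. 0 < G (x(i := Y))"
proof -
  obtain Y where Y: "Y \<in> C" "A i Y \<noteq> 0" using A_nonzero[OF i] by blast
  define s where "s = S (x(i := 0))"
  have s: "s \<in> E" unfolding s_def by (intro S_in_E F_upd x zero_C)
  have "S (x(i := Y)) = A i Y + s"
    using S_upd[OF i, of "x(i := 0)" Y] by (simp add: s_def)
  moreover have "A i Y + s \<noteq> 0" using pointed_E[OF A_E[OF i Y(1)] s] Y(2) by blast
  ultimately show ?thesis using Y F_upd[OF x Y(1)] G_pos by metis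
qed

lemma norm_le_t: "x \<in> F \<Longrightarrow> i < K \<Longrightarrow> norm (x i) \<le> t x"
proof -
  assume x: "x \<in> F" and i: "i < K"
  have "tr (x i) \<le> t x" unfolding t_def
    by (rule member_le_sum) (use i x tr_nonneg in \<open>auto simp: F_def\<close>)
  then show ?thesis using norm_le_tr[of "x i"] x i by (simp add: F_def)
qed

text \<open>Blocks at least as good as a block with positive value have bounded power, so the search
  reduces to a compact set on which \<open>G\<close> is continuous.\<close>

lemma ex_block_max:
  assumes x: "x \<in> F" and i: "i < K"
  shows "\<exists>X\<in>C. \<forall>Y\<in>C. G (x(i := Y)) \<le> G (x(i := X))"
proof -
  obtain Y0 where Y0: "Y0 \<in> C" "0 < G (x(i := Y0))" using ex_upd_G_pos[OF assms] by blast
  obtain B where B: "\<And>y. y \<in> F \<Longrightarrow> G (x(i := Y0)) \<le> G y \<Longrightarrow> t y \<le> B"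
    using superlevel_bounded[OF Y0(2)] by blast
  let ?C = "C \<inter> cball 0 B"
  have inB: "Y \<in> ?C" if "Y \<in> C" "G (x(i := Y0)) \<le> G (x(i := Y))" for Y
    using B[OF F_upd[OF x that(1), of i] that(2)] norm_le_t[OF F_upd[OF x that(1), of i] i] that(1) by simp
  have "compact ?C" using closed_C by (simp add: closed_Int_compact)
  moreover have "?C \<noteq> {}" using inB[OF Y0(1)] by auto
  moreover have "continuous_on ?C (\<lambda>Y. G (x(i := Y)))"
  proof (rule lipschitz_on_continuous_on[of LG], rule lipschitz_onI)
    fix Y Z assume "Y \<in> ?C" "Z \<in> ?C"
    then have "\<bar>G (x(i := Y)) - G (x(i := Z))\<bar> \<le> LG * dst (x(i := Y)) (x(i := Z))"
      by (intro abs_G_diff_le F_upd x) auto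
    also have "dst (x(i := Y)) (x(i := Z)) = norm (Y - Z)"
    proof -
      have "dst (x(i := Y)) (x(i := Z)) = (\<Sum>j<K. if j = i then norm (Y - Z) else 0)"
        unfolding dst_def by (intro sum.cong) auto
      then show ?thesis using i by simp
    qed
    finally show "dist (G (x(i := Y))) (G (x(i := Z))) \<le> LG * dist Y Z"
      unfolding dist_real_def dist_norm .
  qed (rule LG_nonneg)
  ultimately have "\<exists>X\<in>?C. \<forall>Y\<in>?C. G (x(i := Y)) \<le> G (x(i := X))"
    by (rule continuous_attains_sup)
  then obtain X where X: "X \<in> ?C" "\<And>Y. Y \<in> ?C \<Longrightarrow> G (x(i := Y)) \<le> G (x(i := X))" by blast
  have "G (x(i := Y)) \<le> G (x(i := X))" if "Y \<in> C" for Y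
  proof (cases "G (x(i := Y0)) \<le> G (x(i := Y))")
    case True
    then show ?thesis using X(2) inB that by blast
  next
    case False
    then show ?thesis using X(2)[OF inB[OF Y0(1)]] by simp
  qed
  then show ?thesis using X(1) by blast
qed

lemma G_tendsto:
  assumes "\<And>n. X n \<in> F" "x \<in> F" "\<And>i. i < K \<Longrightarrow> (\<lambda>n. X n i) \<longlonglongrightarrow> x i"
  shows "(\<lambda>n. G (X n)) \<longlonglongrightarrow> G x"
proof -
  have "(\<lambda>n. LG * dst (X n) x) \<longlonglongrightarrow> LG * (\<Sum>i<K. norm (x i - x i))"
    unfolding dst_def by (intro tendsto_intros assms(3)) auto
  then have "(\<lambda>n. LG * dst (X n) x) \<longlonglongrightarrow> 0" by simp
  then have "(\<lambda>n. G (X n) - G x) \<longlonglongrightarrow> 0"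
    by (rule Lim_null_comparison[rotated]) (use abs_G_diff_le assms in auto)
  then show ?thesis by (simp add: LIM_zero_iff)
qed

lemma F_closed:
  assumes "\<And>n. X n \<in> F" "\<And>i. i < K \<Longrightarrow> (\<lambda>n. X n i) \<longlonglongrightarrow> x i"
  shows "x \<in> F"
  unfolding F_def
  using closed_sequentially[OF closed_C, of "\<lambda>n. X n i" "x i" for i] assms by (auto simp: F_def)

lemma ex_max: "\<exists>x\<in>F. 0 < G x \<and> (\<forall>y\<in>F. G y \<le> G x)"
proof -
  have "(\<lambda>_. 0) \<in> F" by (simp add: F_def zero_C)
  then obtain Y where "Y \<in> C" "0 < G ((\<lambda>_. 0)(0 := Y))" using ex_upd_G_pos[of _ 0] K by fastforce
  moreover define x0 where "x0 = (\<lambda>_::nat. 0)(0 := Y)"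
  ultimately have x0: "x0 \<in> F" "0 < G x0" using F_upd \<open>(\<lambda>_. 0) \<in> F\<close> by auto
  define m where "m = (SUP x\<in>F. G x)"
  have bdd: "bdd_above (G ` F)" using G_le_Gmax by (auto simp: bdd_above_def)
  have le_m: "G x \<le> m" if "x \<in> F" for x unfolding m_def by (rule cSUP_upper[OF that bdd])
  \<comment> \<open>A maximizing sequence is kept above the positive value \<open>G x0\<close>, so
    that its power stays bounded and a subsequence converges.\<close>
  have "\<exists>x\<in>F. G x0 \<le> G x \<and> m - 1 / real (Suc n) \<le> G x" for n
  proof -
    have "m - 1 / real (Suc n) < m" by simp
    moreover have "F \<noteq> {}" using x0 by blast
    ultimately have "\<exists>y\<in>F. m - 1 / real (Suc n) < G y"
      using less_cSUP_iff[of F G, OF _ bdd] unfolding m_def by blast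
    then obtain y where y: "y \<in> F" "m - 1 / real (Suc n) < G y" by blast
    show ?thesis
    proof (cases "G x0 \<le> G y")
      case True
      then show ?thesis using y by (intro bexI[of _ y]) auto
    next
      case False
      then show ?thesis using x0 y by (intro bexI[of _ x0]) auto
    qed
  qed
  then obtain X where X: "\<And>n. X n \<in> F" "\<And>n. G x0 \<le> G (X n)" "\<And>n. m - 1 / real (Suc n) \<le> G (X n)"
    by metis
  obtain B where B: "\<And>x. x \<in> F \<Longrightarrow> G x0 \<le> G x \<Longrightarrow> t x \<le> B"
    using superlevel_bounded[OF x0(2)] by blast
  have "norm (X n i) \<le> B" if "i < K" for n i
    using norm_le_t[OF X(1) that] B[OF X(1) X(2)] order_trans by blast
  then obtain r l where r: "strict_mono r" "\<And>i. i < K \<Longrightarrow> (\<lambda>n. X (r n) i) \<longlonglongrightarrow> l i"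
    using bounded_family_convergent_subsequence[of K X B] by blast
  have l: "l \<in> F" by (rule F_closed[OF X(1) r(2)])
  have lim: "(\<lambda>n. G (X (r n))) \<longlonglongrightarrow> G l" by (rule G_tendsto[OF X(1) l r(2)])
  have "(\<lambda>n. m - 1 / real (Suc (r n))) \<longlonglongrightarrow> m - 0"
    using LIMSEQ_subseq_LIMSEQ[OF lim_1_over_n[THEN LIMSEQ_Suc] r(1)]
    by (intro tendsto_intros) (simp add: comp_def)
  then have "m \<le> G l" using X(3) LIMSEQ_le[OF _ lim, of "\<lambda>n. m - 1 / real (Suc (r n))" m] by simp
  then show ?thesis using l le_m x0 by (intro bexI[of _ l]) (auto intro: order_trans less_le_trans)
qed

section \<open>Optimality conditions and the gain of one block step\<close>

text \<open>The linearized Dinkelbach condition, obtained without differentiating: block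
  \<open>i\<close> moves a fraction \<open>u\<close> towards \<open>Y\<close>, concavity is used at
  the moved point, and Lipschitz continuity of \<open>D\<close> carries the inequality back as
  \<open>u\<close> shrinks.\<close>

lemma block_opt_first_order:
  assumes x: "x \<in> F" and i: "i < K" and opt: "block_opt i x" and Y: "Y \<in> C"
  shows "D (S x) \<bullet> A i (Y - x i) \<le> G x * a * tr (Y - x i)"
proof (rule field_le_epsilon)
  fix e :: real assume e: "e > 0"
  define d where "d = A i (Y - x i)"
  define M where "M = L * (norm d)\<^sup>2 + 1"
  have M: "M > 0" using L by (simp add: M_def add_nonneg_pos)
  define u where "u = min 1 (e / M)"
  have u: "0 < u" "u \<le> 1" "u * M \<le> e"
    using e M by (auto simp: u_def min_def field_simps)
  define Z where "Z = x i + u *\<^sub>R (Y - x i)"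
  have "Z = (1 - u) *\<^sub>R x i + u *\<^sub>R Y" by (simp add: Z_def algebra_simps)
  then have Z: "Z \<in> C" using x i Y u by (auto simp: F_def intro!: add_C scale_C)
  define z where "z = x(i := Z)"
  have z: "z \<in> F" unfolding z_def by (rule F_upd[OF x Z])
  have Sz: "S z = S x + u *\<^sub>R d"
    by (simp add: z_def S_upd[OF i] Z_def d_def linear_scale[OF linear_A[OF i]])
  have Pz: "P z = P x + a * (u * tr (Y - x i))"
    by (simp add: z_def P_upd[OF i] Z_def linear_scale[OF linear_tr])
  have "G z \<le> G x" using opt Z by (simp add: block_opt_def z_def)
  then have "f (S z) \<le> G x * P z" using P_pos[OF z] by (simp add: f_eq[OF z] mult_right_mono)
  also have "\<dots> = f (S x) + u * (G x * a * tr (Y - x i))"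
    by (simp add: Pz f_eq[OF x] algebra_simps)
  \<comment> \<open>Concavity at \<open>z\<close>, not at \<open>x\<close>: only this bounds the
    directional term from above.\<close>
  also have "f (S x) \<le> f (S z) + D (S z) \<bullet> (S x - S z)" by (intro f_concave S_in_E x z)
  also have "S x - S z = - (u *\<^sub>R d)" by (simp add: Sz)
  finally have "u * (D (S z) \<bullet> d) \<le> u * (G x * a * tr (Y - x i))" by simp
  then have 1: "D (S z) \<bullet> d \<le> G x * a * tr (Y - x i)" using u by simp
  have "(D (S x) - D (S z)) \<bullet> d \<le> norm (D (S x) - D (S z)) * norm d" by (rule norm_cauchy_schwarz)
  also have "\<dots> \<le> (L * norm (S x - S z)) * norm d"
    using x z by (intro mult_right_mono D_lipschitz S_in_E) auto
  also have "\<dots> = u * (L * (norm d)\<^sup>2)" using u by (simp add: Sz power2_eq_square)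
  also have "\<dots> \<le> u * M" using u by (intro mult_left_mono) (auto simp: M_def)
  also have "\<dots> \<le> e" by (rule u)
  finally show "D (S x) \<bullet> A i (Y - x i) \<le> G x * a * tr (Y - x i) + e"
    using 1 by (simp add: inner_diff_left d_def)
qed

text \<open>Otherwise some block produces the same \<open>S\<close> with less power, which strictly
  raises a positive ratio.\<close>

lemma block_opt_in_V:
  assumes x: "x \<in> F" and i: "i < K" and opt: "block_opt i x" and pos: "0 < G x"
  shows "x i \<in> V i"
proof (rule ccontr)
  assume "x i \<notin> V i"
  moreover have "x i \<in> C" using x i by (simp add: F_def)
  ultimately obtain Y where Y: "Y \<in> C" "A i Y = A i (x i)" "tr Y < tr (x i)"
    using wasteful[OF i] by blast
  let ?y = "x(i := Y)"
  have y: "?y \<in> F" by (rule F_upd[OF x Y(1)])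
  have "S ?y = S x" by (simp add: S_upd[OF i] linear_diff[OF linear_A[OF i]] Y)
  then have "G ?y * P ?y = G x * P x" using f_eq[OF y] f_eq[OF x] by simp
  moreover have "P ?y < P x" using Y(3) a by (simp add: P_upd[OF i] linear_diff[OF linear_tr] mult_pos_neg)
  then have "G x * P ?y < G x * P x" using pos by simp
  moreover have "G ?y * P ?y \<le> G x * P ?y"
    using opt Y(1) P_pos[OF y] by (intro mult_right_mono) (auto simp: block_opt_def)
  ultimately show False by simp
qed

text \<open>Here \<open>x\<close> is the state after the update and \<open>Y\<close> the old block.
  The first-order condition at \<open>x\<close> absorbs the linear term of strong concavity and
  leaves a quadratic loss in \<open>A i (Y - x i)\<close>; injectivity on \<open>V i\<close> turns
  it into a loss in \<open>Y - x i\<close>.\<close>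

lemma sufficient_increase:
  "\<exists>c>0. \<forall>i<K. \<forall>x\<in>F. \<forall>Y\<in>C. t x \<le> B \<longrightarrow> t (x(i := Y)) \<le> B \<longrightarrow> block_opt i x \<longrightarrow>
     x i \<in> V i \<longrightarrow> Y \<in> V i \<longrightarrow> c * (norm (x i - Y))\<^sup>2 \<le> G x - G (x(i := Y))"
proof -
  obtain c where c: "c > 0" "\<And>s u. s \<in> E \<Longrightarrow> u \<in> E \<Longrightarrow> norm s \<le> LA * \<bar>B\<bar> \<Longrightarrow> norm u \<le> LA * \<bar>B\<bar> \<Longrightarrow>
      f u \<le> f s + D s \<bullet> (u - s) - c * (norm (u - s))\<^sup>2"
    using f_strongly_concave[of "LA * \<bar>B\<bar>"] by blast
  have "\<exists>b>0. \<forall>y\<in>V i. b * norm y \<le> norm (A i y)" if "i < K" for i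
    using injective_imp_isometric[OF closed_subspace[OF subspace_V[OF that]] subspace_V[OF that]
        bounded_linear_A[OF that]] A_inj_V[OF that] by (auto simp: mult.commute)
  then obtain b where b: "\<And>i. i < K \<Longrightarrow> b i > 0" "\<And>i y. i < K \<Longrightarrow> y \<in> V i \<Longrightarrow> b i * norm y \<le> norm (A i y)"
    by metis
  define b0 where "b0 = Min (b ` {..<K})"
  have b0: "b0 > 0" "\<And>i. i < K \<Longrightarrow> b0 \<le> b i"
    using K b(1) by (auto simp: b0_def Min_gr_iff lessThan_empty_iff)
  define PB where "PB = a * \<bar>B\<bar> + P0"
  have PB: "PB > 0" using a P0 by (simp add: PB_def add_nonneg_pos)
  define c' where "c' = c * b0\<^sup>2 / PB"
  have "c' * (norm (x i - Y))\<^sup>2 \<le> G x - G (x(i := Y))"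
    if i: "i < K" and x: "x \<in> F" and Y: "Y \<in> C" and tB: "t x \<le> B" "t (x(i := Y)) \<le> B"
      and opt: "block_opt i x" and V: "x i \<in> V i" "Y \<in> V i" for i x Y
  proof -
    let ?y = "x(i := Y)"
    have y: "?y \<in> F" by (rule F_upd[OF x Y])
    have nS: "norm (S z) \<le> LA * \<bar>B\<bar>" if "z \<in> F" "t z \<le> B" for z
      using that by (intro norm_S_bound) auto
    have Sd: "S ?y - S x = A i (Y - x i)" by (simp add: S_upd[OF i])
    have "f (S ?y) \<le> f (S x) + D (S x) \<bullet> A i (Y - x i) - c * (norm (A i (Y - x i)))\<^sup>2"
      using c(2)[OF S_in_E[OF x] S_in_E[OF y] nS[OF x tB(1)] nS[OF y tB(2)]] by (simp only: Sd)
    also have "D (S x) \<bullet> A i (Y - x i) \<le> G x * a * tr (Y - x i)"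
      by (rule block_opt_first_order[OF x i opt Y])
    finally have 1: "G ?y * P ?y \<le> G x * P ?y - c * (norm (A i (Y - x i)))\<^sup>2"
      by (simp add: f_eq[OF x] f_eq[OF y] P_upd[OF i] algebra_simps)
    have "b0 * norm (Y - x i) \<le> b i * norm (Y - x i)" by (intro mult_right_mono b0 i) auto
    also have "\<dots> \<le> norm (A i (Y - x i))" using V subspace_V[OF i] by (intro b(2) i) (auto intro: subspace_diff)
    finally have "(b0 * norm (Y - x i))\<^sup>2 \<le> (norm (A i (Y - x i)))\<^sup>2"
      using b0 by (intro power_mono) auto
    then have "c * (b0 * norm (Y - x i))\<^sup>2 \<le> c * (norm (A i (Y - x i)))\<^sup>2"
      using c(1) by (intro mult_left_mono) auto
    with 1 have 2: "c * (b0 * norm (Y - x i))\<^sup>2 \<le> (G x - G ?y) * P ?y"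
      by (simp add: algebra_simps)
    also have "\<dots> \<le> (G x - G ?y) * PB"
    proof (rule mult_left_mono)
      show "P ?y \<le> PB" unfolding P_def PB_def using tB(2) a by (intro add_right_mono mult_left_mono) auto
      show "0 \<le> G x - G ?y" using opt Y by (simp add: block_opt_def)
    qed
    finally show ?thesis using PB
      by (simp add: c'_def pos_divide_le_eq power_mult_distrib norm_minus_commute mult_ac)
  qed
  moreover have "c' > 0" using c b0 PB by (simp add: c'_def)
  ultimately show ?thesis by blast
qed

lemma global_opt_block_opt: "\<forall>y\<in>F. G y \<le> G x \<Longrightarrow> x \<in> F \<Longrightarrow> block_opt i x"
  unfolding block_opt_def using F_upd by blast

section \<open>The Kurdyka-Lojasiewicz inequality\<close>

text \<open>At the maximizer \<open>z\<close> strong concavity bounds the squared deviation of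
  \<open>S\<close> by the gap. The power deviation is then bounded too, and both feed the error
  bound for the slice on which \<open>S\<close> and \<open>t\<close> have the values of
  \<open>z\<close>; every point of that slice is optimal.\<close>

lemma gap_error_bound:
  assumes z: "z \<in> F" and opt: "\<forall>y\<in>F. G y \<le> G z" and pos: "0 < G z"
  shows "\<exists>p c. 0 < p \<and> p < 1 \<and> 0 \<le> c \<and> (\<forall>x\<in>F. t x \<le> B \<longrightarrow>
    (\<exists>y\<in>F. G y = G z \<and> dst y x \<le> c * (G z - G x) powr p))"
proof -
  define B' where "B' = max \<bar>B\<bar> (t z)"
  obtain c0 where c0: "c0 > 0" "\<And>s u. s \<in> E \<Longrightarrow> u \<in> E \<Longrightarrow> norm s \<le> LA * B' \<Longrightarrow> norm u \<le> LA * B' \<Longrightarrow>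
      f u \<le> f s + D s \<bullet> (u - s) - c0 * (norm (u - s))\<^sup>2"
    using f_strongly_concave[of "LA * B'"] by blast
  have "\<forall>i<K. z i \<in> C" using z by (simp add: F_def)
  from error_bound[OF this, of B]
  have "\<exists>q c. 0 < q \<and> q \<le> 1 \<and> 0 \<le> c \<and> (\<forall>x\<in>F. t x \<le> B \<longrightarrow> (\<exists>y\<in>F. S y = S z \<and> t y = t z \<and>
      dst y x \<le> c * (norm (S x - S z) + \<bar>t x - t z\<bar>) powr q))"
    by (simp only: F_def S_def t_def dst_def mem_Collect_eq Ball_def Bex_def)
  then obtain q c where q: "0 < q" "q \<le> 1" "0 \<le> c"
    and eb: "\<forall>x\<in>F. t x \<le> B \<longrightarrow> (\<exists>y\<in>F. S y = S z \<and> t y = t z \<and>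
      dst y x \<le> c * (norm (S x - S z) + \<bar>t x - t z\<bar>) powr q)"
    by (elim exE conjE) (rule that)
  define PB where "PB = a * \<bar>B\<bar> + P0"
  have PB: "PB > 0" using a P0 by (simp add: PB_def add_nonneg_pos)
  define c1 where "c1 = sqrt (PB / c0)"
  define c2 where "c2 = c1 + (L * c1 + PB * sqrt (G z)) / (G z * a)"
  have c1: "c1 \<ge> 0" using PB c0 by (simp add: c1_def)
  have c2: "c2 \<ge> 0" using c1 PB pos a L by (simp add: c2_def)
  have "\<exists>y\<in>F. G y = G z \<and> dst y x \<le> (c * c2 powr q) * (G z - G x) powr (q / 2)"
    if x: "x \<in> F" and tx: "t x \<le> B" for x
  proof -
    define gap where "gap = G z - G x"
    have gap: "0 \<le> gap" "gap \<le> G z" using opt x G_nonneg[OF x] by (auto simp: gap_def)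
    define \<tau> where "\<tau> = t x - t z"
    define d where "d = S x - S z"
    have fo: "D (S z) \<bullet> d \<le> G z * a * \<tau>"
    proof -
      have "D (S z) \<bullet> d = (\<Sum>i<K. D (S z) \<bullet> A i (x i - z i))"
        by (simp add: d_def S_diff inner_sum_right)
      also have "\<dots> \<le> (\<Sum>i<K. G z * a * tr (x i - z i))"
        using x by (intro sum_mono block_opt_first_order z global_opt_block_opt opt) (auto simp: F_def)
      also have "\<dots> = G z * a * \<tau>" by (simp add: \<tau>_def t_diff sum_distrib_left)
      finally show ?thesis .
    qed
    have nS: "norm (S z) \<le> LA * B'" "norm (S x) \<le> LA * B'"
      using z x tx by (auto simp: B'_def intro!: norm_S_bound)
    have fx: "f (S x) = f (S z) + G z * a * \<tau> - gap * P x"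
      by (simp add: f_eq[OF x] f_eq[OF z] gap_def \<tau>_def P_def algebra_simps)
    have sc: "c0 * (norm d)\<^sup>2 \<le> D (S z) \<bullet> d - G z * a * \<tau> + gap * P x"
      using c0(2)[OF S_in_E[OF z] S_in_E[OF x] nS] fx by (simp add: d_def)
    have "P x \<le> PB" unfolding P_def PB_def using tx a by (intro add_right_mono mult_left_mono) auto
    then have gP: "gap * P x \<le> gap * PB" using gap by (intro mult_left_mono)
    have "c0 * (norm d)\<^sup>2 \<le> gap * PB" using sc fo gP by linarith
    then have "(norm d)\<^sup>2 \<le> PB / c0 * gap" using c0 by (simp add: field_simps)
    then have "norm d \<le> sqrt (PB / c0 * gap)" by (rule real_le_rsqrt)
    then have dn: "norm d \<le> c1 * sqrt gap" by (simp only: c1_def real_sqrt_mult)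
    have Dd: "\<bar>D (S z) \<bullet> d\<bar> \<le> L * norm d"
      using Cauchy_Schwarz_ineq2[of "D (S z)" d] mult_right_mono[OF D_bounded[OF S_in_E[OF z]], of "norm d"]
      by simp
    have "0 \<le> c0 * (norm d)\<^sup>2" using c0 by simp
    \<comment> \<open>Excess power is bounded by the strong-concavity inequality \<open>sc\<close>,
      a power deficit by the first-order condition \<open>fo\<close>.\<close>
    then have "G z * a * \<bar>\<tau>\<bar> \<le> L * norm d + gap * PB"
    proof (cases "\<tau> \<ge> 0")
      case True
      then show ?thesis using sc gP Dd \<open>0 \<le> c0 * (norm d)\<^sup>2\<close> by auto
    next
      case False
      moreover have "0 \<le> gap * PB" using gap PB by simp
      ultimately show ?thesis using fo Dd by auto
    qed
    also have "L * norm d \<le> L * (c1 * sqrt gap)" using dn L by (intro mult_left_mono)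
    \<comment> \<open>Since \<open>gap \<le> G z\<close>, a linear term in the gap is dominated by
      one in its square root.\<close>
    also have "gap * PB \<le> (sqrt (G z) * sqrt gap) * PB"
    proof (rule mult_right_mono)
      have "sqrt gap * sqrt gap \<le> sqrt (G z) * sqrt gap" using gap by (intro mult_right_mono) auto
      then show "gap \<le> sqrt (G z) * sqrt gap" using gap by simp
    qed (use PB in simp)
    finally have "G z * a * \<bar>\<tau>\<bar> \<le> (L * c1 + PB * sqrt (G z)) * sqrt gap"
      by (simp add: algebra_simps)
    then have "\<bar>\<tau>\<bar> \<le> (L * c1 + PB * sqrt (G z)) / (G z * a) * sqrt gap"
      using pos a by (simp add: field_simps)
    then have r: "norm d + \<bar>\<tau>\<bar> \<le> c2 * sqrt gap" using dn by (simp add: c2_def algebra_simps)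
    obtain y where y: "y \<in> F" "S y = S z" "t y = t z" "dst y x \<le> c * (norm d + \<bar>\<tau>\<bar>) powr q"
      using eb x tx unfolding d_def \<tau>_def by blast
    have "G y = G z" by (simp add: G_def P_def y)
    moreover have "dst y x \<le> (c * c2 powr q) * gap powr (q / 2)"
    proof -
      have "(norm d + \<bar>\<tau>\<bar>) powr q \<le> (c2 * sqrt gap) powr q" using r q by (intro powr_mono2) auto
      also have "\<dots> = c2 powr q * gap powr (q / 2)"
        using gap c2 by (simp add: powr_mult powr_half_sqrt[symmetric] powr_powr)
      finally have "c * (norm d + \<bar>\<tau>\<bar>) powr q \<le> c * (c2 powr q * gap powr (q / 2))"
        using q by (intro mult_left_mono)
      then show ?thesis using y(4) by (simp add: mult.assoc)
    qed
    ultimately show ?thesis using y(1) unfolding gap_def by blast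
  qed
  then have "\<forall>x\<in>F. t x \<le> B \<longrightarrow>
      (\<exists>y\<in>F. G y = G z \<and> dst y x \<le> (c * c2 powr q) * (G z - G x) powr (q / 2))" by blast
  then show ?thesis
    by - (rule exI[of _ "q / 2"], rule exI[of _ "c * c2 powr q"], use q in simp)
qed

text \<open>Concavity bounds the gap by the linearization at \<open>x\<close>, summed over blocks.
  The part of block \<open>i\<close> would be nonpositive at \<open>z i\<close>, the state right
  after its update, which agrees with \<open>x\<close> in that block; replacing \<open>z i\<close>
  by \<open>x\<close> costs a Lipschitz constant times \<open>d\<close>.\<close>

lemma gap_le_step:
  assumes x: "x \<in> F" and y: "y \<in> F" and le: "G x \<le> G y"
    and z: "\<And>i. i < K \<Longrightarrow> z i \<in> F" "\<And>i. i < K \<Longrightarrow> block_opt i (z i)" "\<And>i. i < K \<Longrightarrow> z i i = x i"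
      "\<And>i. i < K \<Longrightarrow> dst x (z i) \<le> d"
  shows "(G y - G x) * P0 \<le> (L * LA * LA + LG * a * Lt) * d * dst y x"
proof -
  have "(G y - G x) * P0 \<le> (G y - G x) * P y" using le P_ge[OF y] by (intro mult_left_mono) auto
  also have "\<dots> = f (S y) - f (S x) - G x * a * (t y - t x)"
    by (simp add: f_eq[OF x] f_eq[OF y] P_def algebra_simps)
  also have "\<dots> \<le> D (S x) \<bullet> (S y - S x) - G x * a * (t y - t x)"
    using f_concave[OF S_in_E[OF x] S_in_E[OF y]] by simp
  also have "\<dots> = (\<Sum>i<K. D (S x) \<bullet> A i (y i - x i) - G x * a * tr (y i - x i))"
    by (simp add: S_diff t_diff inner_sum_right sum_distrib_left sum_subtractf)
  also have "\<dots> \<le> (\<Sum>i<K. (L * LA * LA + LG * a * Lt) * d * norm (y i - x i))"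
  proof (rule sum_mono)
    fix i assume "i \<in> {..<K}"
    then have i: "i < K" by simp
    define \<delta> where "\<delta> = y i - x i"
    have d: "0 \<le> d" using z(4)[OF i] dst_nonneg order_trans by blast
    have "D (S (z i)) \<bullet> A i \<delta> \<le> G (z i) * a * tr \<delta>"
      using block_opt_first_order[OF z(1)[OF i] i z(2)[OF i], of "y i"] y i z(3)[OF i]
      by (simp add: F_def \<delta>_def)
    moreover have "(D (S x) - D (S (z i))) \<bullet> A i \<delta> \<le> L * LA * LA * d * norm \<delta>"
    proof -
      have "(D (S x) - D (S (z i))) \<bullet> A i \<delta> \<le> norm (D (S x) - D (S (z i))) * norm (A i \<delta>)"
        by (rule norm_cauchy_schwarz)
      also have "\<dots> \<le> (L * norm (S x - S (z i))) * (LA * norm \<delta>)"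
        using L i by (intro mult_mono D_lipschitz S_in_E x z norm_A_le) auto
      also have "\<dots> \<le> (L * (LA * d)) * (LA * norm \<delta>)"
      proof (intro mult_right_mono mult_left_mono L)
        show "norm (S x - S (z i)) \<le> LA * d"
          using norm_S_diff_le[of x "z i"] mult_left_mono[OF z(4)[OF i] LA_nonneg] by linarith
        show "0 \<le> LA * norm \<delta>" using LA_nonneg by simp
      qed
      finally show ?thesis by (simp add: mult_ac)
    qed
    moreover have "(G (z i) - G x) * a * tr \<delta> \<le> LG * a * Lt * d * norm \<delta>"
    proof -
      have "\<bar>G (z i) - G x\<bar> \<le> LG * d"
        using abs_G_diff_le[OF x z(1)[OF i]] mult_left_mono[OF z(4)[OF i] LG_nonneg] by (simp add: abs_minus_commute)
      then have "\<bar>G (z i) - G x\<bar> * a * \<bar>tr \<delta>\<bar> \<le> (LG * d) * a * (Lt * norm \<delta>)"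
        using a LG_nonneg d tr_le by (intro mult_mono) auto
      moreover have "(G (z i) - G x) * a * tr \<delta> \<le> \<bar>G (z i) - G x\<bar> * a * \<bar>tr \<delta>\<bar>"
        using a abs_ge_self[of "(G (z i) - G x) * a * tr \<delta>"] by (simp add: abs_mult)
      ultimately show ?thesis by (simp add: mult_ac)
    qed
    ultimately show "D (S x) \<bullet> A i (y i - x i) - G x * a * tr (y i - x i)
        \<le> (L * LA * LA + LG * a * Lt) * d * norm (y i - x i)"
      by (simp add: \<delta>_def[symmetric] inner_diff_left algebra_simps)
  qed
  also have "\<dots> = (L * LA * LA + LG * a * Lt) * d * dst y x"
    by (simp add: dst_def sum_distrib_left)
  finally show ?thesis .
qed

lemma cyclic_block_ascent_converges:
  fixes Q :: "nat \<Rightarrow> nat \<Rightarrow> 'a"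
  assumes Q0: "\<And>i. i < K \<Longrightarrow> Q 0 i \<in> C"
    and step: "\<And>k i. i < K \<Longrightarrow> is_arg_max (\<lambda>X. G ((mid_sweep Q k i)(i := X))) (\<lambda>X. X \<in> C) (Q (Suc k) i)"
  shows "\<forall>k. \<forall>i<K. G (mid_sweep Q k i) \<le> G (mid_sweep Q k (Suc i))"
    and "\<exists>l. \<forall>i\<le>K. (\<lambda>k. G (mid_sweep Q k i)) \<longlonglongrightarrow> l"
    and "\<exists>z. (\<forall>i<K. (\<lambda>k. Q k i) \<longlonglongrightarrow> z i) \<and> z \<in> F \<and> (\<forall>y\<in>F. G y \<le> G z) \<and> (\<lambda>k. G (Q k)) \<longlonglongrightarrow> G z"
proof -
  let ?m = "mid_sweep Q"
  have QC: "Q k i \<in> C" if "i < K" for k i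
    using Q0[OF that] step[OF that] by (cases k) (auto simp: is_arg_max_def)
  have mF: "?m k i \<in> F" for k i using QC by (simp add: F_def mid_sweep_def)
  have QF: "Q k \<in> F" for k using QC by (simp add: F_def)
  have upd: "(?m k (Suc i))(i := Y) = (?m k i)(i := Y)" for k i Y
    by (auto simp: mid_sweep_def fun_eq_iff)
  have upd_new: "(?m k i)(i := Q (Suc k) i) = ?m k (Suc i)" for k i
    by (auto simp: mid_sweep_def fun_eq_iff)
  have upd_old: "(?m k (Suc i))(i := Q k i) = ?m k i" for k i
    by (auto simp: mid_sweep_def fun_eq_iff)
  have m0: "?m k 0 = Q k" for k by (simp add: mid_sweep_def)
  have mK: "G (?m k K) = G (Q (Suc k))" for k by (rule G_cong) (simp add: mid_sweep_def)
  have bopt: "block_opt i (?m k (Suc i))" if "i < K" for k i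
    unfolding block_opt_def upd
    using step[OF that, of k] unfolding is_arg_max_def upd_new by (auto simp: not_less)
  have inc: "G (?m k i) \<le> G (?m k (Suc i))" if "i < K" for k i
    using bopt[OF that, of k] QC[OF that, of k] upd_old[of k i] unfolding block_opt_def by metis
  then show "\<forall>k. \<forall>i<K. G (?m k i) \<le> G (?m k (Suc i))" by blast
  have mono: "G (?m k i) \<le> G (?m k j)" if "i \<le> j" "j \<le> K" for k i j
    using that
  proof (induction j rule: dec_induct)
    case (step n)
    then show ?case using inc[of n k] by simp
  qed simp
  have monoQ: "G (Q k) \<le> G (Q (Suc k))" for k using mono[of 0 K k] by (simp add: m0 mK)
  \<comment> \<open>The value after the very first block update: positive even when the start has
    value 0, and a lower bound for all later values. It confines the iterates to bounded
    power.\<close>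
  define \<gamma> where "\<gamma> = G (?m 0 1)"
  have \<gamma>: "\<gamma> > 0"
  proof -
    obtain Y where Y: "Y \<in> C" "0 < G ((?m 0 0)(0 := Y))"
      using ex_upd_G_pos[OF mF[of 0 0], of 0] K by auto
    have "G ((?m 0 (Suc 0))(0 := Y)) \<le> G (?m 0 (Suc 0))"
      using bopt[of 0 0] K Y(1) unfolding block_opt_def by simp
    then show ?thesis using Y(2) unfolding upd \<gamma>_def by simp
  qed
  have \<gamma>Q: "\<gamma> \<le> G (Q (Suc k))" for k
  proof (induction k)
    case 0
    show ?case using mono[of 1 K 0] K by (simp add: \<gamma>_def mK)
  next
    case (Suc k)
    then show ?case using monoQ[of "Suc k"] by simp
  qed
  have \<gamma>m: "\<gamma> \<le> G (?m (Suc k) i)" if "i \<le> K" for k i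
    using \<gamma>Q[of k] mono[of 0 i "Suc k"] that by (simp add: m0)
  obtain B where B: "\<And>x. x \<in> F \<Longrightarrow> \<gamma> \<le> G x \<Longrightarrow> t x \<le> B"
    using superlevel_bounded[OF \<gamma>] by blast
  \<comment> \<open>Only updated blocks are known to lie in the signal spaces; the starting
    covariances need not. Hence the shift by one sweep in \<open>d\<close> and \<open>e\<close>
    below.\<close>
  have inV: "Q (Suc k) i \<in> V i" if i: "i < K" for k i
  proof -
    have "\<gamma> \<le> G (?m k (Suc i))"
      using mono[of 1 "Suc i" 0] \<gamma>m[of "Suc i"] i by (cases k) (auto simp: \<gamma>_def)
    then have "0 < G (?m k (Suc i))" using \<gamma> by linarith
    from block_opt_in_V[OF mF i bopt[OF i] this] show ?thesis by (simp add: mid_sweep_def)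
  qed
  obtain c where c: "c > 0" "\<forall>i<K. \<forall>x\<in>F. \<forall>Y\<in>C. t x \<le> B \<longrightarrow> t (x(i := Y)) \<le> B \<longrightarrow> block_opt i x \<longrightarrow>
     x i \<in> V i \<longrightarrow> Y \<in> V i \<longrightarrow> c * (norm (x i - Y))\<^sup>2 \<le> G x - G (x(i := Y))"
    using sufficient_increase[of B] by blast
  have gain: "c * (norm (Q (Suc (Suc k)) i - Q (Suc k) i))\<^sup>2 \<le> G (?m (Suc k) (Suc i)) - G (?m (Suc k) i)"
    if i: "i < K" for k i
  proof -
    let ?x = "?m (Suc k) (Suc i)"
    have "?x i = Q (Suc (Suc k)) i" by (simp add: mid_sweep_def)
    then show ?thesis
      using c(2)[rule_format, OF i mF[of "Suc k" "Suc i"] QC[OF i, of "Suc k"]]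
        B[OF mF \<gamma>m, of "Suc i" k] B[OF mF \<gamma>m, of i k] bopt[OF i, of "Suc k"] inV[OF i] i
      unfolding upd_old by auto
  qed
  obtain z where z: "z \<in> F" "0 < G z" "\<forall>y\<in>F. G y \<le> G z" using ex_max by blast
  from gap_error_bound[OF z(1,3,2), of B] obtain p c2 where p: "0 < p" "p < 1" "0 \<le> c2"
    and eb: "\<forall>x\<in>F. t x \<le> B \<longrightarrow> (\<exists>y\<in>F. G y = G z \<and> dst y x \<le> c2 * (G z - G x) powr p)"
    by (elim exE conjE) (rule that)
  define d where "d k = dst (Q (Suc (Suc k))) (Q (Suc k))" for k
  define e where "e k = G z - G (Q (Suc k))" for k
  define M where "M = L * LA * LA + LG * a * Lt"
  have M: "M \<ge> 0" using L LA_nonneg LG_nonneg a Lt_nonneg by (simp add: M_def)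
  have d0: "0 \<le> d k" for k by (simp add: d_def dst_nonneg)
  have e0: "0 \<le> e k" for k using z(3) QF by (simp add: e_def)
  \<comment> \<open>Division by \<open>K\<close> comes from Cauchy-Schwarz: \<open>d k\<close> sums
    norms, while the gains of the blocks sum their squares.\<close>
  have dec: "c / K * (d k)\<^sup>2 \<le> e k - e (Suc k)" for k
  proof -
    have "(d k)\<^sup>2 \<le> (\<Sum>i<K. (1::real)\<^sup>2) * (\<Sum>i<K. (norm (Q (Suc (Suc k)) i - Q (Suc k) i))\<^sup>2)"
      using Cauchy_Schwarz_ineq_sum[of "\<lambda>_. 1" "\<lambda>i. norm (Q (Suc (Suc k)) i - Q (Suc k) i)" "{..<K}"]
      by (simp add: d_def dst_def)
    then have "c / K * (d k)\<^sup>2 \<le> c / K * (K * (\<Sum>i<K. (norm (Q (Suc (Suc k)) i - Q (Suc k) i))\<^sup>2))"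
      using c(1) by (intro mult_left_mono) auto
    also have "\<dots> = (\<Sum>i<K. c * (norm (Q (Suc (Suc k)) i - Q (Suc k) i))\<^sup>2)"
      using K by (simp add: sum_distrib_left)
    also have "\<dots> \<le> (\<Sum>i<K. G (?m (Suc k) (Suc i)) - G (?m (Suc k) i))"
      by (intro sum_mono gain) simp
    also have "\<dots> = e k - e (Suc k)"
      by (simp add: sum_lessThan_telescope[of "\<lambda>i. G (?m (Suc k) i)"] mK m0 e_def)
    finally show ?thesis .
  qed
  have kl: "e (Suc k) \<le> (M * c2 / P0) * d k * e (Suc k) powr p" for k
  proof -
    let ?x = "Q (Suc (Suc k))"
    have "t ?x \<le> B" by (rule B[OF QF \<gamma>Q])
    then obtain y where y: "y \<in> F" "G y = G z" "dst y ?x \<le> c2 * e (Suc k) powr p"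
      using eb QF unfolding e_def by blast
    have "(G y - G ?x) * P0 \<le> M * d k * dst y ?x"
      unfolding M_def
    \<comment> \<open>The reference state of user \<open>i\<close> is the one just after its update
      in the same sweep. It differs from the end of the sweep only in later users, so it is within
      one sweep length.\<close>
    proof (rule gap_le_step[OF QF y(1), of _ "\<lambda>i. ?m (Suc k) (Suc i)"])
      show "G ?x \<le> G y" using y(2) z(3) QF by simp
      show "?m (Suc k) (Suc i) i = ?x i" for i by (simp add: mid_sweep_def)
      show "dst ?x (?m (Suc k) (Suc i)) \<le> d k" for i
        unfolding d_def dst_def by (intro sum_mono) (auto simp: mid_sweep_def)
    qed (use mF bopt in auto)
    also have "\<dots> \<le> M * d k * (c2 * e (Suc k) powr p)"
      using M d0 y(3) by (intro mult_left_mono) auto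
    finally show ?thesis using P0 y(2) by (simp add: e_def field_simps)
  qed
  have cK: "0 < c / K" and C: "0 \<le> M * c2 / P0" using c K M p P0 by auto
  note finite_length = kl_finite_length[of d e, OF d0 e0 cK p(1,2) C dec kl]
  have lim: "\<exists>l. (\<lambda>k. Q k i) \<longlonglongrightarrow> l" if i: "i < K" for i
  proof -
    define h where "h k = Q (Suc k) i" for k
    have "norm (h (Suc k) - h k) \<le> d k" for k
      unfolding h_def d_def dst_def
      by (rule member_le_sum[of i "{..<K}" "\<lambda>i. norm (Q (Suc (Suc k)) i - Q (Suc k) i)"]) (use i in auto)
    then have sm: "summable (\<lambda>k. h (Suc k) - h k)"
      by (intro summable_comparison_test'[OF finite_length(1), of 0])
    have "(\<lambda>n. (\<Sum>k<n. h (Suc k) - h k) + h 0) \<longlonglongrightarrow> (\<Sum>k. h (Suc k) - h k) + h 0"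
      by (intro tendsto_add summable_LIMSEQ[OF sm] tendsto_const)
    moreover have "(\<Sum>k<n. h (Suc k) - h k) + h 0 = h n" for n
      using sum_lessThan_telescope[of h n] by simp
    ultimately have "(\<lambda>k. Q (Suc k) i) \<longlonglongrightarrow> (\<Sum>k. h (Suc k) - h k) + h 0" by (simp only: h_def)
    from LIMSEQ_imp_Suc[OF this] show ?thesis by (rule exI)
  qed
  define l where "l i = lim (\<lambda>k. Q k i)" for i
  have l: "(\<lambda>k. Q k i) \<longlonglongrightarrow> l i" if "i < K" for i
    unfolding l_def using lim[OF that] by (intro convergent_LIMSEQ_iff[THEN iffD1]) (simp add: convergent_def)
  have lF: "l \<in> F" by (rule F_closed[OF QF l])
  have Gl: "(\<lambda>k. G (Q k)) \<longlonglongrightarrow> G l" by (rule G_tendsto[OF QF lF l])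
  have "(\<lambda>k. G z - e k) \<longlonglongrightarrow> G z - 0" by (intro tendsto_intros finite_length(2))
  then have "(\<lambda>k. G (Q (Suc k))) \<longlonglongrightarrow> G z" by (simp add: e_def)
  with LIMSEQ_Suc[OF Gl] have "G l = G z" by (rule LIMSEQ_unique)
  then show "\<exists>z. (\<forall>i<K. (\<lambda>k. Q k i) \<longlonglongrightarrow> z i) \<and> z \<in> F \<and> (\<forall>y\<in>F. G y \<le> G z) \<and> (\<lambda>k. G (Q k)) \<longlonglongrightarrow> G z"
    using l lF Gl z(3) by (intro exI[of _ l]) auto
  \<comment> \<open>Monotonicity squeezes the values inside a sweep between those at its two
    ends.\<close>
  have "(\<lambda>k. G (?m k i)) \<longlonglongrightarrow> G l" if "i \<le> K" for i
  proof (rule tendsto_sandwich[OF _ _ Gl LIMSEQ_Suc[OF Gl]])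
    show "\<forall>\<^sub>F k in sequentially. G (Q k) \<le> G (?m k i)" using mono[of 0 i] that by (simp add: m0)
    show "\<forall>\<^sub>F k in sequentially. G (?m k i) \<le> G (Q (Suc k))" using mono[of i K] that by (simp add: mK)
  qed
  then show "\<exists>l. \<forall>i\<le>K. (\<lambda>k. G (?m k i)) \<longlonglongrightarrow> l" by blast
qed

end


subsection \<open>Iterative water-filling\<close>

text \<open>One user's contribution to \<open>S\<close>; including the factor
  \<open>1 / noise\<close> lets \<open>logdet\<close> be free of parameters.\<close>

definition channel :: "real \<Rightarrow> complex^'m^'n \<Rightarrow> complex^'n^'n \<Rightarrow> complex^'m^'m" where
  "channel noise H Q = (1 / noise) *\<^sub>R (conj_transpose H ** Q ** H)"

lemma linear_channel: "linear (channel noise H)"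
proof (rule linearI)
  show "channel noise H (P + Q) = channel noise H P + channel noise H Q" for P Q
    by (simp add: channel_def vec_eq_iff matrix_matrix_mult_def algebra_simps sum.distrib)
  show "channel noise H (r *\<^sub>R Q) = r *\<^sub>R channel noise H Q" for r Q
    by (simp add: channel_def matrix_scalar_ac scalar_matrix_assoc[symmetric])
qed

lemma channel_sum_outer:
  "channel noise H (sum_list (map outer vs)) = (1 / noise) *\<^sub>R sum_list (map outer (map ((*v) (conj_transpose H)) vs))"
  using sum_list_mult_outer[of "conj_transpose H" vs] by (simp add: channel_def)

lemma psd_channel: "psd Q \<Longrightarrow> 0 \<le> noise \<Longrightarrow> psd (channel noise H Q)"
  unfolding channel_def using psd_congruence[of Q "conj_transpose H"] by (intro psd_scaleR) auto

lemma channel_nonzero: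
  assumes "H \<noteq> 0" "noise > 0"
  shows "\<exists>Q. psd Q \<and> channel noise H Q \<noteq> 0"
proof -
  obtain i j where "H $ i $ j \<noteq> 0" using assms(1) by (auto simp: vec_eq_iff)
  then have "conj_transpose H \<noteq> 0" by (metis complex_cnj_zero_iff conj_transpose_nth zero_index)
  then obtain u where u: "conj_transpose H *v u \<noteq> 0"
    using matrix_eq[of "conj_transpose H" 0] by auto
  have "channel noise H (outer u) = (1 / noise) *\<^sub>R outer (conj_transpose H *v u)"
    using channel_sum_outer[of noise H "[u]"] by simp
  then have "norm (channel noise H (outer u)) = (norm (conj_transpose H *v u))\<^sup>2 / noise"
    using assms(2) by (simp add: norm_outer)
  then have "channel noise H (outer u) \<noteq> 0" using u assms(2) by auto
  then show ?thesis using psd_outer by blast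
qed

text \<open>Covariances built from the range of \<open>H\<close>; all other transmit power is wasted.\<close>

definition signal_space :: "complex^'m^'n \<Rightarrow> (complex^'n^'n) set" where
  "signal_space H = span (outer ` range ((*v) H))"

text \<open>If the channel annihilates \<open>X\<close>, then \<open>X\<close> is orthogonal to
  every generator \<open>outer (H *v w)\<close>; lying in their span, it is orthogonal to
  itself.\<close>

lemma channel_injective_on_signal_space:
  assumes X: "X \<in> signal_space H" and 0: "channel noise H X = 0" and "noise > 0"
  shows "X = 0"
proof -
  have z: "conj_transpose H ** X ** H = 0" using 0 assms(3) by (simp add: channel_def)
  have "orthogonal X Y" if "Y \<in> outer ` range ((*v) H)" for Y
  proof -
    obtain w where Y: "Y = outer (H *v w)" using \<open>Y \<in> _\<close> by blast
    have "X \<bullet> Y = (H *v w) \<bullet> (X *v (H *v w))" by (simp add: Y inner_commute[of X] inner_outer_left)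
    also have "\<dots> = w \<bullet> ((conj_transpose H ** X ** H) *v w)"
      using inner_conj_transpose[of "conj_transpose H" w] by (simp add: matrix_vector_mul_assoc[symmetric])
    finally show ?thesis by (simp add: orthogonal_def z)
  qed
  with X have "orthogonal X X" unfolding signal_space_def by (rule orthogonal_to_span)
  then show ?thesis by (simp add: orthogonal_def)
qed

text \<open>Each rank-one vector is projected onto the range of \<open>H\<close>. The discarded part
  is annihilated by \<open>conj_transpose H\<close>, so the received signal is unchanged, while by
  Pythagoras the trace drops by the squared discarded parts. These cannot all vanish, since
  \<open>X\<close> would then lie in the signal space.\<close>

lemma wasteful_outside_signal_space:
  assumes "psd X" "X \<notin> signal_space H"
  shows "\<exists>Y. psd Y \<and> channel noise H Y = channel noise H X \<and> Re (trace Y) < Re (trace X)"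
proof -
  obtain vs where X: "X = sum_list (map outer vs)" using psd_eq_sum_outer[OF assms(1)] .
  have sR: "subspace (range ((*v) H))"
    using linear_subspace_image[OF matrix_vector_mul_linear subspace_UNIV] .
  have "\<forall>v. \<exists>a. a \<in> range ((*v) H) \<and> (norm v)\<^sup>2 = (norm a)\<^sup>2 + (norm (v - a))\<^sup>2 \<and>
      conj_transpose H *v v = conj_transpose H *v a"
  proof
    fix v
    obtain a b where ab: "a \<in> span (range ((*v) H))" "\<And>w. w \<in> span (range ((*v) H)) \<Longrightarrow> orthogonal b w" "v = a + b"
      by (rule orthogonal_subspace_decomp_exists[of "range ((*v) H)" v]) blast
    have "orthogonal a b" using ab(2)[OF ab(1)] by (simp add: orthogonal_commute)
    then have n: "(norm v)\<^sup>2 = (norm a)\<^sup>2 + (norm (v - a))\<^sup>2" using norm_add_Pythagorean[of a b] ab(3) by simp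
    have z: "(conj_transpose H *v b) \<bullet> w = 0" for w
    proof -
      have "H *v w \<in> span (range ((*v) H))" by (rule span_base) simp
      then have "b \<bullet> (H *v w) = 0" using ab(2) by (simp add: orthogonal_def)
      then show ?thesis by (simp add: inner_conj_transpose)
    qed
    have "conj_transpose H *v b = 0" using z[of "conj_transpose H *v b"] by simp
    then have "conj_transpose H *v v = conj_transpose H *v a"
      by (simp add: ab(3) matrix_vector_right_distrib)
    moreover have "a \<in> range ((*v) H)" using ab(1) span_eq_iff[THEN iffD2, OF sR] by simp
    ultimately show "\<exists>a. a \<in> range ((*v) H) \<and> (norm v)\<^sup>2 = (norm a)\<^sup>2 + (norm (v - a))\<^sup>2 \<and>
        conj_transpose H *v v = conj_transpose H *v a" using n by blast
  qed
  from choice[OF this] obtain \<pi> where "\<forall>v. \<pi> v \<in> range ((*v) H) \<and>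
      (norm v)\<^sup>2 = (norm (\<pi> v))\<^sup>2 + (norm (v - \<pi> v))\<^sup>2 \<and> conj_transpose H *v v = conj_transpose H *v \<pi> v" ..
  then have \<pi>: "\<pi> v \<in> range ((*v) H)" "(norm v)\<^sup>2 = (norm (\<pi> v))\<^sup>2 + (norm (v - \<pi> v))\<^sup>2"
    "conj_transpose H *v v = conj_transpose H *v \<pi> v" for v by blast+
  define Y where "Y = sum_list (map outer (map \<pi> vs))"
  have "psd Y" unfolding Y_def by (rule psd_sum_outer)
  moreover have "channel noise H Y = channel noise H X"
    unfolding X Y_def channel_sum_outer by (simp add: comp_def \<pi>(3)[symmetric])
  moreover have "Re (trace Y) < Re (trace X)"
  proof -
    have "(\<Sum>v\<leftarrow>vs. (norm v)\<^sup>2) = (\<Sum>v\<leftarrow>vs. (norm (\<pi> v))\<^sup>2 + (norm (v - \<pi> v))\<^sup>2)"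
      by (subst \<pi>(2)) (rule refl)
    then have trX: "Re (trace X) = Re (trace Y) + (\<Sum>v\<leftarrow>vs. (norm (v - \<pi> v))\<^sup>2)"
      unfolding X Y_def trace_sum_outer by (simp add: comp_def sum_list_addf)
    have nn: "0 \<le> (\<Sum>v\<leftarrow>vs. (norm (v - \<pi> v))\<^sup>2)" by (rule sum_list_nonneg) auto
    have "(\<Sum>v\<leftarrow>vs. (norm (v - \<pi> v))\<^sup>2) \<noteq> 0"
    proof
      assume "(\<Sum>v\<leftarrow>vs. (norm (v - \<pi> v))\<^sup>2) = 0"
      then have "\<forall>x\<in>set (map (\<lambda>v. (norm (v - \<pi> v))\<^sup>2) vs). x = 0"
        by (subst (asm) sum_list_nonneg_eq_0_iff) auto
      then have "\<pi> v = v" if "v \<in> set vs" for v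
        using that by (force simp: eq_commute[of _ "\<pi> v"])
      moreover have "outer (\<pi> v) \<in> signal_space H" for v
        unfolding signal_space_def by (intro span_base imageI \<pi>(1))
      ultimately have "outer v \<in> signal_space H" if "v \<in> set vs" for v
        using that by metis
      then have "X \<in> signal_space H"
        unfolding X signal_space_def by (induction vs) (auto intro: span_add span_zero)
      then show False using assms(2) by simp
    qed
    then show ?thesis using trX nn by linarith
  qed
  ultimately show ?thesis by blast
qed

text \<open>The traces add up to zero and each dominates a norm.\<close>

lemma psd_pointed: "psd S \<Longrightarrow> psd T \<Longrightarrow> S + T = 0 \<Longrightarrow> S = 0"
proof -
  assume "psd S" "psd T" "S + T = 0"
  then have "norm S \<le> Re (trace S)" "norm T \<le> Re (trace T)" by (auto intro: psd_norm_le_trace)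
  moreover have "trace S + trace T = 0"
    unfolding trace_add[symmetric] \<open>S + T = 0\<close> by (simp add: trace_def)
  then have "Re (trace S) + Re (trace T) = 0" by (metis plus_complex.sel(1) zero_complex.sel(1))
  moreover have "0 \<le> norm T" by simp
  ultimately have "norm S \<le> 0" by linarith
  then show "S = 0" by simp
qed

text \<open>The value given to \<open>L\<close> is the constant of \<open>logdet_growth\<close>; it
  also dominates the resolvent bound \<open>sqrt CARD('m)\<close> and the Lipschitz constant
  \<open>CARD('m)\<close>.\<close>

lemma concave_ratio_energy_efficiency:
  fixes H :: "nat \<Rightarrow> complex^'m^'n"
  assumes "K \<ge> 1" "noise > 0" "\<eta> > 0" "Pc > 0" "\<And>i. i < K \<Longrightarrow> H i \<noteq> 0"
  shows "concave_ratio K (\<lambda>i. channel noise (H i)) {Q. psd Q} {S. psd S} (\<lambda>Q. Re (trace Q))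
    logdet resolvent (2 * real CARD('m) * sqrt CARD('m)) (1 / \<eta>) Pc (\<lambda>i. signal_space (H i))"
proof -
  define m where "m = real CARD('m)"
  have m: "m \<ge> 1" by (simp add: m_def Suc_leI)
  then have m1: "1 \<le> sqrt m" by simp
  then have m2: "m \<le> 2 * m * sqrt m" using m mult_left_mono[OF m1, of "2 * m"] by linarith
  have "1 * sqrt m \<le> 2 * m * sqrt m" using m by (intro mult_right_mono) auto
  then have m3: "sqrt m \<le> 2 * m * sqrt m" by (simp only: mult_1)
  show ?thesis
  proof (unfold_locales, unfold mem_Collect_eq)
    show "norm (resolvent S) \<le> 2 * real CARD('m) * sqrt CARD('m)" if "psd S" for S :: "complex^'m^'m"
      using norm_resolvent_le[OF that] m3 unfolding m_def by linarith
    show "norm (resolvent S - resolvent T) \<le> 2 * real CARD('m) * sqrt CARD('m) * norm (S - T)"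
      if "psd S" "psd T" for S T :: "complex^'m^'m"
      using order_trans[OF resolvent_lipschitz[OF that] mult_right_mono[OF m2[unfolded m_def] norm_ge_zero]] .
    show "\<exists>c>0. \<forall>S\<in>{S. psd S}. \<forall>T\<in>{S. psd S}. norm S \<le> b \<longrightarrow> norm T \<le> b \<longrightarrow>
        logdet T \<le> logdet S + resolvent S \<bullet> (T - S) - c * (norm (T - S))\<^sup>2" for b and S T :: "complex^'m^'m"
      using logdet_strongly_concave[of b] by auto
    show "\<exists>x\<in>{Q. psd Q}. channel noise (H i) x \<noteq> 0" if "i < K" for i
      using channel_nonzero[OF assms(5)[OF that] assms(2)] by auto
    show "\<exists>y\<in>{Q. psd Q}. channel noise (H i) y = channel noise (H i) x \<and> Re (trace y) < Re (trace x)"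
      if "psd x" "x \<notin> signal_space (H i)" for i x
      using wasteful_outside_signal_space[OF that] by auto
    show "\<exists>p c. 0 < p \<and> p \<le> 1 \<and> 0 \<le> c \<and> (\<forall>x. (\<forall>i<K. psd (x i)) \<longrightarrow> (\<Sum>i<K. Re (trace (x i))) \<le> B \<longrightarrow>
        (\<exists>y. (\<forall>i<K. psd (y i)) \<and> (\<Sum>i<K. channel noise (H i) (y i)) = (\<Sum>i<K. channel noise (H i) (z i)) \<and>
          (\<Sum>i<K. Re (trace (y i))) = (\<Sum>i<K. Re (trace (z i))) \<and>
          (\<Sum>i<K. norm (y i - x i)) \<le> c * (norm ((\<Sum>i<K. channel noise (H i) (x i)) - (\<Sum>i<K. channel noise (H i) (z i)))
            + \<bar>(\<Sum>i<K. Re (trace (x i))) - (\<Sum>i<K. Re (trace (z i)))\<bar>) powr p))"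
      if "\<forall>i<K. psd (z i)" for B z
      by (rule hoelder_error_bound_psd) (use that linear_channel in auto)
    show "X = 0" if "i < K" "X \<in> signal_space (H i)" "channel noise (H i) X = 0" for i X
      using channel_injective_on_signal_space that assms(2) by blast
    show "subspace (signal_space (H i))" for i by (simp add: signal_space_def)
    show "logdet S \<le> 2 * real CARD('m) * sqrt CARD('m) * sqrt (1 + norm S)" if "psd S" for S :: "complex^'m^'m"
      by (rule logdet_growth[OF that])
  qed (use assms in \<open>auto simp: linear_add[OF linear_channel] linear_scale[OF linear_channel]
      linear_add[OF linear_Re_trace] linear_scale[OF linear_Re_trace] closed_psd psd_norm_le_trace logdet_gradient
      inner_resolvent_self_nonneg intro: psd_add psd_scaleR psd_channel psd_pointed\<close>)
qed

theorem mainTheorem1: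
  fixes K :: nat
    and W noise \<eta> Pdyn Psta Pc :: real
    and H :: "nat \<Rightarrow> complex^'m^'n"
    and Q :: "nat \<Rightarrow> nat \<Rightarrow> complex^'n^'n"
    and g :: "(nat \<Rightarrow> complex^'n^'n) \<Rightarrow> real"
  assumes "K \<ge> 1"
    and "W > 0" and "noise > 0" and "\<eta> > 0"
    and "Pc = real CARD('m) * Pdyn + Psta" and "Pc > 0"
    and "\<And>i. i < K \<Longrightarrow> H i \<noteq> 0"
    and "g = energy_efficiency W noise \<eta> Pc K H"
    and "iterative_water_filling g K Q"
  shows "(\<forall>k. \<forall>i<K. g (mid_sweep Q k i) \<le> g (mid_sweep Q k (Suc i)))
    \<and> (\<exists>L. \<forall>i\<le>K. (\<lambda>k. g (mid_sweep Q k i)) \<longlonglongrightarrow> L)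
    \<and> (\<exists>Qstar. (\<forall>i<K. (\<lambda>k. Q k i) \<longlonglongrightarrow> Qstar i)
          \<and> is_arg_max g (feasible K) Qstar
          \<and> (\<lambda>k. g (Q k)) \<longlonglongrightarrow> g Qstar)"
proof -
  interpret concave_ratio K "\<lambda>i. channel noise (H i)" "{Q. psd Q}" "{S. psd S}" "\<lambda>Q. Re (trace Q)"
    logdet resolvent "2 * real CARD('m) * sqrt CARD('m)" "1 / \<eta>" Pc "\<lambda>i. signal_space (H i)"
    by (rule concave_ratio_energy_efficiency) (use assms in auto)
  define w where "w = W / ln 2"
  have w: "w > 0" using assms(2) by (simp add: w_def)
  have g: "g X = w * G X" for X
  proof -
    have "(1 / noise) *\<^sub>R (\<Sum>i<K. conj_transpose (H i) ** X i ** H i) = S X"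
      by (simp add: S_def channel_def scaleR_sum_right)
    then show ?thesis
      by (simp add: assms(8) energy_efficiency_def G_def P_def t_def logdet_def log_def w_def)
  qed
  have F: "X \<in> F \<longleftrightarrow> feasible K X" for X by (simp add: F_def feasible_def)
  have Q0: "feasible K (Q 0)" and
    Qstep: "\<And>k i. i < K \<Longrightarrow> Q (Suc k) i = arg_max (\<lambda>X. g ((mid_sweep Q k i)(i := X))) psd"
    using assms(9) by (auto simp: iterative_water_filling_def)
  have opt: "is_arg_max (\<lambda>X. G ((mid_sweep Q k i)(i := X))) psd (Q (Suc k) i)"
    if "i < K" "mid_sweep Q k i \<in> F" for k i
  proof -
    have eq: "is_arg_max (\<lambda>X. g ((mid_sweep Q k i)(i := X))) psd = is_arg_max (\<lambda>X. G ((mid_sweep Q k i)(i := X))) psd"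
      using w by (simp add: is_arg_max_def fun_eq_iff g)
    \<comment> \<open>The update is a choice operator, so it is a maximizer only once some maximizer
      is known to exist.\<close>
    have "\<exists>X. is_arg_max (\<lambda>X. g ((mid_sweep Q k i)(i := X))) psd X"
      unfolding eq using ex_block_max[OF that(2,1)] by (auto simp: is_arg_max_def not_less)
    then have "is_arg_max (\<lambda>X. g ((mid_sweep Q k i)(i := X))) psd (Q (Suc k) i)"
      unfolding Qstep[OF that(1)] arg_max_def by (rule someI_ex)
    then show ?thesis unfolding eq .
  qed
  \<comment> \<open>Existence of the next block maximizer needs a feasible state, and feasibility of
    the next state needs that maximizer, so both advance together user by user.\<close>
  have mF: "mid_sweep Q k i \<in> F" if "Q k \<in> F" "i \<le> K" for k i
    using that(2)
  proof (induction i)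
    case 0
    then show ?case using that(1) by (simp add: mid_sweep_def)
  next
    case (Suc i)
    then have "psd (Q (Suc k) i)" using opt[of i k] by (simp add: is_arg_max_def)
    moreover have eq: "mid_sweep Q k (Suc i) = (mid_sweep Q k i)(i := Q (Suc k) i)"
      by (auto simp: mid_sweep_def fun_eq_iff)
    ultimately show ?case unfolding eq using Suc by (intro F_upd) auto
  qed
  have QF: "Q k \<in> F" for k
  proof (induction k)
    case 0
    show ?case using Q0 by (simp add: F)
  next
    case (Suc k)
    then show ?case using mF[of k K] by (simp add: F_def mid_sweep_def)
  qed
  have "is_arg_max (\<lambda>X. G ((mid_sweep Q k i)(i := X))) (\<lambda>X. X \<in> {Q. psd Q}) (Q (Suc k) i)"
    if "i < K" for k i using opt[OF that mF[OF QF]] that by simp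
  moreover have "Q 0 i \<in> {Q. psd Q}" if "i < K" for i using QF[of 0] that by (simp add: F_def)
  ultimately have conv: "\<forall>k. \<forall>i<K. G (mid_sweep Q k i) \<le> G (mid_sweep Q k (Suc i))"
    "\<exists>l. \<forall>i\<le>K. (\<lambda>k. G (mid_sweep Q k i)) \<longlonglongrightarrow> l"
    "\<exists>z. (\<forall>i<K. (\<lambda>k. Q k i) \<longlonglongrightarrow> z i) \<and> z \<in> F \<and> (\<forall>y\<in>F. G y \<le> G z) \<and> (\<lambda>k. G (Q k)) \<longlonglongrightarrow> G z"
    using cyclic_block_ascent_converges[of Q] by blast+
  have "\<forall>k. \<forall>i<K. g (mid_sweep Q k i) \<le> g (mid_sweep Q k (Suc i))"
    using conv(1) w by (simp add: g)
  moreover have "\<exists>L. \<forall>i\<le>K. (\<lambda>k. g (mid_sweep Q k i)) \<longlonglongrightarrow> L"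
  proof -
    obtain l where "\<forall>i\<le>K. (\<lambda>k. G (mid_sweep Q k i)) \<longlonglongrightarrow> l" using conv(2) by blast
    then have "\<forall>i\<le>K. (\<lambda>k. g (mid_sweep Q k i)) \<longlonglongrightarrow> w * l"
      unfolding g by (auto intro: tendsto_mult_left)
    then show ?thesis by blast
  qed
  moreover obtain z where z: "\<forall>i<K. (\<lambda>k. Q k i) \<longlonglongrightarrow> z i" "z \<in> F" "\<forall>y\<in>F. G y \<le> G z"
      "(\<lambda>k. G (Q k)) \<longlonglongrightarrow> G z" using conv(3) by blast
  then have "is_arg_max g (feasible K) z" using w by (simp add: is_arg_max_def F g not_less)
  moreover have "(\<lambda>k. g (Q k)) \<longlonglongrightarrow> g z" unfolding g by (intro tendsto_intros z(4))
  ultimately show ?thesis using z(1) by blast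
qed

end
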